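(* Let $\mathcal H=\bigoplus_{n\ge 0}\mathcal H_n$ be a graded connected Hopf algebra over $\mathbb R$ with each $\mathcal H_n$ finite-dimensional, fix an integer $n\ge 0$, and let $P$ be a probability distribution on the weak-compositions of $n$. Let $b_1,b_2,\dots$ be the integers determined by $\sum_{m\ge 0}\dim\mathcal H_m\,x^m=\prod_{i\ge1}(1-x^i)^{-b_i}$. For a partition $\lambda=(\lambda_1,\dots,\lambda_{l(\lambda)})$ of $n$ and a weak-composition $D=(d_1,\dots,d_{l(D)})$ of $n$, let $\beta^D_\lambda$ be the number of set compositions $B_1|\cdots|B_{l(D)}$ of $\{1,\dots,l(\lambda)\}$ (blocks may be empty) such that $\sum_{j\in B_i}\lambda_j=d_i$ for every $i$, and put $$\beta^P_\lambda:=\sum_D \frac{P(D)}{\binom{n}{D}}\beta^D_\lambda .$$ Then the eigenvalues of $m\Delta_P:\mathcal H_n\to\mathcal H_n$ are the numbers $\beta^P_\lambda$, $\lambda$ a partition of $n$, where the partition $\lambda$ contributes the eigenvalue $\beta^P_\lambda$ with multiplicity equal to the coefficient of $x_\lambda:=x_{\lambda_1}x_{\lambda_2}\cdots x_{\lambda_{l(\lambda)}}$ in $\prod_{i\ge1}(1-x_i)^{-b_i}$ (here $x_1,x_2,\dots$ are commuting indeterminates); i.e. the characteristic polynomial of $m\Delta_P$ on $\mathcal H_n$ is $\prod_\lambda(t-\beta^P_\lambda)^{m_\lambda}$ with $m_\lambda$ that coefficient. Furthermore, $m\Delta_P$ is diagonalisable if $\mathcal H$ is commutative or cocommutative.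
   Context: A graded connected Hopf algebra has $\mathcal H_0=\mathbb R\cdot 1$. Write $m$ for the multiplication of $\mathcal H$ (also for the multiplication of any finite number of factors) and $\Delta$ for the coproduct. A weak-composition of $n$ is a tuple $D=(d_1,\dots,d_{l(D)})$ of non-negative integers summing to $n$. The iterated coproduct $\Delta^{[l]}:\mathcal H\to\mathcal H^{\otimes l}$ is $(\Delta\otimes\mathrm{id}^{\otimes (l-2)})\circ\cdots\circ(\Delta\otimes\mathrm{id})\circ\Delta$ (with $\Delta^{[1]}=\mathrm{id}$). The refined coproduct $\Delta_D:\mathcal H_n\to\mathcal H_{d_1}\otimes\cdots\otimes\mathcal H_{d_{l(D)}}$ is $\Delta^{[l(D)]}$ followed by the projection onto $\mathcal H_{d_1}\otimes\cdots\otimes\mathcal H_{d_{l(D)}}$, and $m\Delta_D:=m\circ\Delta_D:\mathcal H_n\to\mathcal H_n$. For a probability distribution $P$ on weak-compositions of $n$, $m\Delta_P:=\sum_D\frac{P(D)}{\binom nD}m\Delta_D$, where $\binom nD=\frac{n!}{d_1!\cdots d_{l(D)}!}$. A set composition of a finite set $S$ into $l$ blocks is an ordered $l$-tuple $(B_1,\dots,B_l)$ of pairwise disjoint (possibly empty) subsets with union $S$. *)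

theory Defs
  imports
    "HOL-Probability.Probability"
    "HOL-Computational_Algebra.Formal_Power_Series"
    "HOL-Library.Poly_Mapping"
    "Jordan_Normal_Form.Char_Poly"
begin

section \<open>Iterated tensor powers of a real vector space\<close>

instantiation poly_mapping :: (type, real_vector) real_vector
begin

lift_definition scaleR_poly_mapping :: "real \<Rightarrow> ('a \<Rightarrow>\<^sub>0 'b) \<Rightarrow> 'a \<Rightarrow>\<^sub>0 'b"
  is "\<lambda>c f k. c *\<^sub>R f k"
  by (rule finite_subset) auto

instance
  by standard (transfer; simp add: fun_eq_iff scaleR_add_right scaleR_add_left)+

end

text \<open>
  The type \<open>'a tensor\<close> is the direct sum over all \<open>l \<ge> 0\<close> of the \<open>l\<close>-fold tensor powers
  of \<open>'a\<close> over the reals: the free vector space on lists, modulo linearity in each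
  entry.  The list \<open>[x\<^sub>1, \<dots>, x\<^sub>l]\<close> stands for the pure tensor of \<open>x\<^sub>1, \<dots>, x\<^sub>l\<close>; the zeroth
  power (spanned by the class of the empty list) is identified with the reals.
\<close>

definition multilinear_relations :: "('a::real_vector list \<Rightarrow>\<^sub>0 real) set" where
  "multilinear_relations =
     {Poly_Mapping.single (xs @ (a *\<^sub>R x + b *\<^sub>R y) # ys) 1
        - a *\<^sub>R Poly_Mapping.single (xs @ x # ys) 1
        - b *\<^sub>R Poly_Mapping.single (xs @ y # ys) 1 | xs ys a b x y. True}"

definition tensor_eq :: "('a::real_vector list \<Rightarrow>\<^sub>0 real) \<Rightarrow> ('a list \<Rightarrow>\<^sub>0 real) \<Rightarrow> bool" where
  "tensor_eq p q \<longleftrightarrow> p - q \<in> real_vector.span multilinear_relations"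

lemma equivp_tensor_eq: "equivp tensor_eq"
proof (rule equivpI)
  show "reflp tensor_eq"
    by (auto simp: reflp_def tensor_eq_def real_vector.span_zero)
  show "symp tensor_eq"
    unfolding symp_def tensor_eq_def
    using real_vector.span_neg[of "_ - _"] by fastforce
  show "transp tensor_eq"
    unfolding transp_def tensor_eq_def
    using real_vector.span_add[of "_ - _" _ "_ - _"] by fastforce
qed

quotient_type (overloaded) 'a tensor = "'a::real_vector list \<Rightarrow>\<^sub>0 real" / tensor_eq
  by (rule equivp_tensor_eq)

instantiation tensor :: (real_vector) real_vector
begin

lift_definition zero_tensor :: "'a tensor" is 0 .

lift_definition plus_tensor :: "'a tensor \<Rightarrow> 'a tensor \<Rightarrow> 'a tensor" is "(+)"
proof -
  fix p p' q q' :: "'a list \<Rightarrow>\<^sub>0 real"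
  assume "tensor_eq p p'" "tensor_eq q q'"
  then have "(p - p') + (q - q') \<in> real_vector.span multilinear_relations"
    unfolding tensor_eq_def by (rule real_vector.span_add)
  then show "tensor_eq (p + q) (p' + q')" by (simp add: tensor_eq_def algebra_simps)
qed

lift_definition uminus_tensor :: "'a tensor \<Rightarrow> 'a tensor" is uminus
proof -
  fix p p' :: "'a list \<Rightarrow>\<^sub>0 real"
  assume "tensor_eq p p'"
  then have "- (p - p') \<in> real_vector.span multilinear_relations"
    unfolding tensor_eq_def by (rule real_vector.span_neg)
  then show "tensor_eq (- p) (- p')" by (simp add: tensor_eq_def algebra_simps)
qed

lift_definition minus_tensor :: "'a tensor \<Rightarrow> 'a tensor \<Rightarrow> 'a tensor" is "(-)"
proof -
  fix p p' q q' :: "'a list \<Rightarrow>\<^sub>0 real"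
  assume "tensor_eq p p'" "tensor_eq q q'"
  then have "(p - p') - (q - q') \<in> real_vector.span multilinear_relations"
    unfolding tensor_eq_def by (rule real_vector.span_diff)
  then show "tensor_eq (p - q) (p' - q')" by (simp add: tensor_eq_def algebra_simps)
qed

lift_definition scaleR_tensor :: "real \<Rightarrow> 'a tensor \<Rightarrow> 'a tensor" is "scaleR"
proof -
  fix c and p p' :: "'a list \<Rightarrow>\<^sub>0 real"
  assume "tensor_eq p p'"
  then have "c *\<^sub>R (p - p') \<in> real_vector.span multilinear_relations"
    unfolding tensor_eq_def by (rule real_vector.span_scale)
  then show "tensor_eq (c *\<^sub>R p) (c *\<^sub>R p')" by (simp add: tensor_eq_def scaleR_diff_right)
qed

instance
  by standard (transfer; simp add: tensor_eq_def algebra_simps real_vector.span_zero)+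

end

lift_definition pure_tensor :: "'a::real_vector list \<Rightarrow> 'a tensor"
  is "\<lambda>xs. Poly_Mapping.single xs 1" .

definition multilinear :: "('a::real_vector list \<Rightarrow> 'b::real_vector) \<Rightarrow> bool" where
  "multilinear f \<longleftrightarrow> (\<forall>xs ys. linear (\<lambda>x. f (xs @ x # ys)))"

text \<open>
  \<open>tensor_lift f\<close> is the linear map with \<open>pure_tensor xs \<mapsto> f xs\<close>, provided that \<open>f\<close> is
  multilinear (only then does the choice of the representative not matter).
\<close>

definition free_lift :: "('a list \<Rightarrow> 'b::real_vector) \<Rightarrow> ('a list \<Rightarrow>\<^sub>0 real) \<Rightarrow> 'b" where
  "free_lift f p = (\<Sum>xs\<in>Poly_Mapping.keys p. Poly_Mapping.lookup p xs *\<^sub>R f xs)"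

definition tensor_lift :: "('a::real_vector list \<Rightarrow> 'b::real_vector) \<Rightarrow> 'a tensor \<Rightarrow> 'b" where
  "tensor_lift f t = free_lift f (rep_tensor t)"

definition tensor_append :: "'a::real_vector tensor \<Rightarrow> 'a tensor \<Rightarrow> 'a tensor" where
  "tensor_append s t = tensor_lift (\<lambda>xs. tensor_lift (\<lambda>ys. pure_tensor (xs @ ys)) t) s"

text \<open>
  The tensor product of linear maps \<open>f\<^sub>1, \<dots>, f\<^sub>k\<close>, each of them from \<open>'a\<close> into some tensor power
  of \<open>'b\<close>.  It is extended by zero to the tensor powers with exponent other than \<open>k\<close>.
\<close>

definition tensor_map ::
    "('a::real_vector \<Rightarrow> 'b::real_vector tensor) list \<Rightarrow> 'a tensor \<Rightarrow> 'b tensor" where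
  "tensor_map fs = tensor_lift (\<lambda>xs.
     if length xs = length fs
     then foldr tensor_append (map2 (\<lambda>f x. f x) fs xs) (pure_tensor []) else 0)"

abbreviation embed :: "'a::real_vector \<Rightarrow> 'a tensor" where
  "embed x \<equiv> pure_tensor [x]"

definition tensor_rev :: "'a::real_vector tensor \<Rightarrow> 'a tensor" where
  "tensor_rev = tensor_lift (\<lambda>xs. pure_tensor (rev xs))"

text \<open>The componentwise product of two tensors from the same tensor power of an algebra.\<close>

definition tensor_times :: "'a::real_algebra_1 tensor \<Rightarrow> 'a tensor \<Rightarrow> 'a tensor" where
  "tensor_times s t = tensor_lift (\<lambda>xs. tensor_lift (\<lambda>ys.
     if length xs = length ys then pure_tensor (map2 (*) xs ys) else 0) t) s"

definition mult_all :: "'a::real_algebra_1 tensor \<Rightarrow> 'a" where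
  "mult_all = tensor_lift prod_list"

subsection \<open>The universal property\<close>

lemma free_lift_superset:
  assumes "finite A" "Poly_Mapping.keys p \<subseteq> A"
  shows "free_lift f p = (\<Sum>xs\<in>A. Poly_Mapping.lookup p xs *\<^sub>R f xs)"
  unfolding free_lift_def using assms
  by (intro sum.mono_neutral_left) (auto simp: in_keys_iff)

lemma linear_free_lift: "linear (free_lift f)"
proof
  fix p q :: "'a list \<Rightarrow>\<^sub>0 real" and c :: real
  let ?A = "Poly_Mapping.keys p \<union> Poly_Mapping.keys q"
  have "Poly_Mapping.keys (p + q) \<subseteq> ?A" by (rule Poly_Mapping.keys_add)
  then show "free_lift f (p + q) = free_lift f p + free_lift f q"
    by (simp add: free_lift_superset[of ?A] lookup_add scaleR_add_left sum.distrib)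
  have "Poly_Mapping.keys (c *\<^sub>R p) \<subseteq> Poly_Mapping.keys p"
    by transfer auto
  moreover have "Poly_Mapping.lookup (c *\<^sub>R p) xs = c * Poly_Mapping.lookup p xs" for xs
    by transfer simp
  ultimately show "free_lift f (c *\<^sub>R p) = c *\<^sub>R free_lift f p"
    by (simp add: free_lift_superset[of "Poly_Mapping.keys p"] scaleR_sum_right)
qed

lemma free_lift_single [simp]: "free_lift f (Poly_Mapping.single xs c) = c *\<^sub>R f xs"
  by (simp add: free_lift_def)

lemma free_lift_cong:
  assumes "multilinear f" "tensor_eq p q"
  shows "free_lift f p = free_lift f q"
proof -
  interpret linear "free_lift f" by (rule linear_free_lift)
  have "free_lift f r = 0" if "r \<in> real_vector.span multilinear_relations" for r
    using that
  proof (induction rule: real_vector.span_induct_alt)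
    case base
    show ?case by (simp add: zero)
  next
    case (step c r s)
    from step.hyps obtain xs ys a b x y where r:
      "r = Poly_Mapping.single (xs @ (a *\<^sub>R x + b *\<^sub>R y) # ys) 1
        - a *\<^sub>R Poly_Mapping.single (xs @ x # ys) 1 - b *\<^sub>R Poly_Mapping.single (xs @ y # ys) 1"
      unfolding multilinear_relations_def by blast
    have "linear (\<lambda>x. f (xs @ x # ys))"
      using assms(1) by (simp add: multilinear_def)
    from linear_add[OF this] linear_scale[OF this]
    have "free_lift f r = 0" by (simp add: r diff scale)
    then show ?case using step.IH by (simp add: add scale)
  qed
  from this[of "p - q"] assms(2) show ?thesis
    by (simp add: tensor_eq_def diff)
qed

lemma tensor_lift_abs: "multilinear f \<Longrightarrow> tensor_lift f (abs_tensor p) = free_lift f p"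
  unfolding tensor_lift_def
  by (rule free_lift_cong) (auto intro: Quotient3_rep_abs[OF Quotient3_tensor]
      equivp_reflp[OF equivp_tensor_eq])

lemma tensor_lift_pure: "multilinear f \<Longrightarrow> tensor_lift f (pure_tensor xs) = f xs"
  by (simp add: pure_tensor.abs_eq tensor_lift_abs)

lemma linear_tensor_lift:
  assumes "multilinear f"
  shows "linear (tensor_lift f)"
proof
  interpret linear "free_lift f" by (rule linear_free_lift)
  fix s t :: "'a tensor" and c :: real
  show "tensor_lift f (s + t) = tensor_lift f s + tensor_lift f t"
    by (induction s; induction t) (simp add: plus_tensor.abs_eq tensor_lift_abs assms add)
  show "tensor_lift f (c *\<^sub>R s) = c *\<^sub>R tensor_lift f s"
    by (induction s) (simp add: scaleR_tensor.abs_eq tensor_lift_abs assms scale)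
qed

section \<open>Graded connected Hopf algebras\<close>

text \<open>The components of \<open>x\<close> in the direct sum of the \<open>H i\<close>, when that sum is the whole space.\<close>

definition is_decomposition :: "(nat \<Rightarrow> 'a::real_vector set) \<Rightarrow> 'a \<Rightarrow> (nat \<Rightarrow> 'a) \<Rightarrow> bool" where
  "is_decomposition H x f \<longleftrightarrow>
     (\<forall>i. f i \<in> H i) \<and> finite {i. f i \<noteq> 0} \<and> x = (\<Sum>i | f i \<noteq> 0. f i)"

definition component :: "(nat \<Rightarrow> 'a::real_vector set) \<Rightarrow> nat \<Rightarrow> 'a \<Rightarrow> 'a" where
  "component H i x = (THE f. is_decomposition H x f) i"

locale graded_connected_hopf_algebra =
  fixes H :: "nat \<Rightarrow> 'a::real_algebra_1 set"
    and \<Delta> :: "'a \<Rightarrow> 'a tensor"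
    and \<epsilon> :: "'a \<Rightarrow> real"
    and S :: "'a \<Rightarrow> 'a"
  assumes subspace_H: "real_vector.subspace (H i)"
    and direct_sum_H: "\<exists>!f. is_decomposition H x f"
    and one_in_H: "1 \<in> H 0"
    and mult_in_H: "x \<in> H i \<Longrightarrow> y \<in> H j \<Longrightarrow> x * y \<in> H (i + j)"
    and linear_coproduct: "linear \<Delta>"
    and coproduct_in_H: "x \<in> H i \<Longrightarrow>
      \<Delta> x \<in> real_vector.span (\<Union>j\<le>i. {pure_tensor [a, b] | a b. a \<in> H j \<and> b \<in> H (i - j)})"
    and linear_counit: "linear \<epsilon>"
    and counit_in_H: "x \<in> H i \<Longrightarrow> i > 0 \<Longrightarrow> \<epsilon> x = 0"
    and coassociative: "tensor_map [\<Delta>, embed] (\<Delta> x) = tensor_map [embed, \<Delta>] (\<Delta> x)"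
    and counit_left: "tensor_map [\<lambda>a. \<epsilon> a *\<^sub>R pure_tensor [], embed] (\<Delta> x) = embed x"
    and counit_right: "tensor_map [embed, \<lambda>a. \<epsilon> a *\<^sub>R pure_tensor []] (\<Delta> x) = embed x"
    and coproduct_one: "\<Delta> 1 = pure_tensor [1, 1]"
    and coproduct_mult: "\<Delta> (x * y) = tensor_times (\<Delta> x) (\<Delta> y)"
    and counit_one: "\<epsilon> 1 = 1"
    and counit_mult: "\<epsilon> (x * y) = \<epsilon> x * \<epsilon> y"
    and linear_antipode: "linear S"
    and antipode_left: "mult_all (tensor_map [\<lambda>a. embed (S a), embed] (\<Delta> x)) = \<epsilon> x *\<^sub>R 1"
    and antipode_right: "mult_all (tensor_map [embed, \<lambda>a. embed (S a)] (\<Delta> x)) = \<epsilon> x *\<^sub>R 1"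
    and connected: "H 0 = real_vector.span {1}"

definition cocommutative :: "('a::real_vector \<Rightarrow> 'a tensor) \<Rightarrow> bool" where
  "cocommutative \<Delta> \<longleftrightarrow> (\<forall>x. tensor_rev (\<Delta> x) = \<Delta> x)"

definition finite_dimensional :: "'a::real_vector set \<Rightarrow> bool" where
  "finite_dimensional V \<longleftrightarrow> (\<exists>B. finite B \<and> real_vector.span B = V)"

section \<open>Refined coproducts and descent operators\<close>

text \<open>
  For \<open>l = 0\<close> the iterated coproduct is the counit.  This convention is only needed for the
  empty weak-composition of \<open>0\<close>.
\<close>

fun iterated_coproduct ::
    "('a::real_vector \<Rightarrow> 'a tensor) \<Rightarrow> ('a \<Rightarrow> real) \<Rightarrow> nat \<Rightarrow> 'a \<Rightarrow> 'a tensor" where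
  "iterated_coproduct \<Delta> \<epsilon> 0 x = \<epsilon> x *\<^sub>R pure_tensor []"
| "iterated_coproduct \<Delta> \<epsilon> (Suc 0) x = embed x"
| "iterated_coproduct \<Delta> \<epsilon> (Suc (Suc l)) x =
     tensor_map (\<Delta> # replicate l embed) (iterated_coproduct \<Delta> \<epsilon> (Suc l) x)"

definition refined_coproduct ::
    "(nat \<Rightarrow> 'a::real_vector set) \<Rightarrow> ('a \<Rightarrow> 'a tensor) \<Rightarrow> ('a \<Rightarrow> real) \<Rightarrow> nat list \<Rightarrow> 'a \<Rightarrow> 'a tensor"
  where "refined_coproduct H \<Delta> \<epsilon> D x =
     tensor_map (map (\<lambda>d a. embed (component H d a)) D) (iterated_coproduct \<Delta> \<epsilon> (length D) x)"

definition mDelta ::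
    "(nat \<Rightarrow> 'a::real_algebra_1 set) \<Rightarrow> ('a \<Rightarrow> 'a tensor) \<Rightarrow> ('a \<Rightarrow> real) \<Rightarrow> nat list \<Rightarrow> 'a \<Rightarrow> 'a" where
  "mDelta H \<Delta> \<epsilon> D x = mult_all (refined_coproduct H \<Delta> \<epsilon> D x)"

definition weak_compositions :: "nat \<Rightarrow> nat list set" where
  "weak_compositions n = {D. sum_list D = n}"

definition multinomial :: "nat \<Rightarrow> nat list \<Rightarrow> real" where
  "multinomial n D = fact n / prod_list (map fact D)"

text \<open>
  Since parts may be zero, there are infinitely many weak-compositions of \<open>n\<close>, so a sum over all
  of them is in general a series in a finite-dimensional space.  As no norm is fixed
  on that space, the sum is described through linear functionals; in finite dimension this is
  convergence in the unique Hausdorff vector space topology.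
\<close>

definition vector_infsum :: "('i \<Rightarrow> 'a::real_vector) \<Rightarrow> 'i set \<Rightarrow> 'a" where
  "vector_infsum f A =
     (THE y. \<forall>\<phi> :: 'a \<Rightarrow> real. linear \<phi> \<longrightarrow> ((\<lambda>i. \<phi> (f i)) has_sum \<phi> y) A)"

definition mDelta_P ::
    "(nat \<Rightarrow> 'a::real_algebra_1 set) \<Rightarrow> ('a \<Rightarrow> 'a tensor) \<Rightarrow> ('a \<Rightarrow> real) \<Rightarrow>
     nat \<Rightarrow> nat list pmf \<Rightarrow> 'a \<Rightarrow> 'a" where
  "mDelta_P H \<Delta> \<epsilon> n P x =
     vector_infsum (\<lambda>D. (pmf P D / multinomial n D) *\<^sub>R mDelta H \<Delta> \<epsilon> D x) (weak_compositions n)"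

section \<open>Eigenvalues and multiplicities\<close>

definition partitions :: "nat \<Rightarrow> nat list set" where
  "partitions n = {lam. sorted_wrt (\<ge>) lam \<and> 0 \<notin> set lam \<and> sum_list lam = n}"

definition set_compositions :: "'b set \<Rightarrow> nat \<Rightarrow> 'b set list set" where
  "set_compositions X l =
     {Bs. length Bs = l \<and> \<Union>(set Bs) = X \<and> (\<forall>i<l. \<forall>j<l. i \<noteq> j \<longrightarrow> Bs ! i \<inter> Bs ! j = {})}"

text \<open>The positions of \<open>lam\<close> are numbered from \<open>0\<close>.\<close>

definition beta :: "nat list \<Rightarrow> nat list \<Rightarrow> nat" where
  "beta D lam = card {Bs \<in> set_compositions {..<length lam} (length D).
                       \<forall>i<length D. (\<Sum>j\<in>Bs ! i. lam ! j) = D ! i}"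

definition beta_P :: "nat \<Rightarrow> nat list pmf \<Rightarrow> nat list \<Rightarrow> real" where
  "beta_P n P lam =
     (\<Sum>\<^sub>\<infinity>D\<in>weak_compositions n. pmf P D / multinomial n D * real (beta D lam))"

text \<open>
  Formal power series in the commuting indeterminates \<open>x\<^sub>1, x\<^sub>2, \<dots>\<close>: the multiset
  \<open>{#i\<^sub>1, \<dots>, i\<^sub>k#}\<close> stands for the monomial \<open>x\<^bsub>i\<^sub>1\<^esub> \<cdots> x\<^bsub>i\<^sub>k\<^esub>\<close>, and a series is its family of
  coefficients.
\<close>

type_synonym mfps = "nat multiset \<Rightarrow> real"

definition mfps_times :: "mfps \<Rightarrow> mfps \<Rightarrow> mfps" where
  "mfps_times f g M = (\<Sum>A | A \<subseteq># M. f A * g (M - A))"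

text \<open>The substitution of \<open>x\<^sub>i\<close> into a univariate series.\<close>

definition mfps_of_fps :: "nat \<Rightarrow> real fps \<Rightarrow> mfps" where
  "mfps_of_fps i f M = (if set_mset M \<subseteq> {i} then fps_nth f (size M) else 0)"

primrec mfps_partial_prod :: "(nat \<Rightarrow> mfps) \<Rightarrow> nat \<Rightarrow> mfps" where
  "mfps_partial_prod F 0 = (\<lambda>M. if M = {#} then 1 else 0)"
| "mfps_partial_prod F (Suc N) = mfps_times (mfps_partial_prod F N) (F (Suc N))"

text \<open>Coefficientwise limit of the products of \<open>F 1, \<dots>, F N\<close> for \<open>N \<rightarrow> \<infinity>\<close>.\<close>

definition mfps_prod :: "(nat \<Rightarrow> mfps) \<Rightarrow> mfps" where
  "mfps_prod F M = lim (\<lambda>N. mfps_partial_prod F N M)"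

definition multiplicity_series :: "(nat \<Rightarrow> int) \<Rightarrow> mfps" where
  "multiplicity_series b = mfps_prod (\<lambda>i. mfps_of_fps i ((1 - fps_X) powi (- b i)))"

section \<open>Linear operators on a finite-dimensional subspace\<close>

definition ordered_basis :: "'a::real_vector set \<Rightarrow> 'a list \<Rightarrow> bool" where
  "ordered_basis V bs \<longleftrightarrow>
     distinct bs \<and> real_vector.independent (set bs) \<and> real_vector.span (set bs) = V"

definition operator_matrix :: "'a::real_vector list \<Rightarrow> ('a \<Rightarrow> 'a) \<Rightarrow> real mat" where
  "operator_matrix bs f = mat (length bs) (length bs)
     (\<lambda>(i, j). real_vector.representation (set bs) (f (bs ! j)) (bs ! i))"

definition diagonalisable_on :: "'a::real_vector set \<Rightarrow> ('a \<Rightarrow> 'a) \<Rightarrow> bool" where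
  "diagonalisable_on V f \<longleftrightarrow>
     (\<exists>B. real_vector.independent B \<and> real_vector.span B = V \<and> (\<forall>v\<in>B. \<exists>c. f v = c *\<^sub>R v))"

end

theory Submission
  imports Defs
begin

text \<open>
  The coradical filtration is described by convolution products of functionals that vanish on
  \<open>1\<close>: an element has weight at most \<open>k\<close> if all products of more than \<open>k\<close> of them vanish on it.
  Its associated graded algebra is commutative.  Choose homogeneous elements that form a basis of
  the indecomposables of the graded algebra, together with dual functionals.  Evaluating
  convolution products of these functionals on monomials gives permanents, so the monomials, in
  some chosen order of the factors, form a basis of \<open>H n\<close>, and counting them shows that there are
  \<open>b i\<close> generators of degree \<open>i\<close>.

  Expand \<open>\<Delta>\<close> of a product of letters.  If no letter is split, each letter goes to one tensor
  slot, and the terms of degree type \<open>D\<close> are permutations of the word, \<open>beta D lam\<close> in number; if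
  a letter is split, the word gets longer and the weight does not increase.  Hence the operators
  are triangular in the basis of monomials with the eigenvalues \<open>beta_P\<close> on the diagonal.

  If the multiplication is commutative, the remaining terms come from split letters only.  They
  refine \<open>lam\<close> and admit an assignment to the slots that does not come from \<open>lam\<close>, so their
  eigenvalue is strictly larger.  If the comultiplication is cocommutative, words in primitive
  elements span \<open>H n\<close>, and the remaining terms arise from commutators of letters in different slots; they
  coarsen \<open>lam\<close> and have a strictly smaller eigenvalue.  Triangularity with strictly monotone
  eigenvalues gives diagonalisability.
\<close>

section \<open>Sums over lists\<close>

text \<open>The associated graded algebra is never built: it appears only through congruences modulo
  \<open>E k n\<close>, and functionals with values in the reals take the place of its dual. The
  weight of a letter is a bound for its level, carried along as a number, so it adds up exactly
  under products and cuts. Cutting a letter keeps the weight, so weight alone does not order the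
  words; among words of equal weight the longer one counts as lower. Triangularity yields only the
  characteristic polynomial, since equal eigenvalues could still belong to a Jordan block.
  Diagonalisability needs a strict inequality for every new word that occurs, and for an arbitrary
  \<open>P\<close>. Such a word arises from an expansion for some composition \<open>C\<close> of
  positive weight, and the slots in that expansion are themselves an assignment for \<open>C\<close>
  that the one type has and the other lacks. Hence this \<open>C\<close> makes the inequality
  strict, while no composition reverses it. The infinite sum over weak-compositions is a finite one
  in disguise: a zero part contributes the projection to degree 0, which is the unit of
  convolution.\<close>

lemma sum_list_concat_map: "(\<Sum>x\<leftarrow>concat xss. f x) = (\<Sum>xs\<leftarrow>xss. \<Sum>x\<leftarrow>xs. f x)"
  by (induction xss) simp_all

lemma sum_list_cong: "(\<And>p. p \<in> set L \<Longrightarrow> f p = g p) \<Longrightarrow> (\<Sum>p\<leftarrow>L. f p) = (\<Sum>p\<leftarrow>L. g p)"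
  by (rule arg_cong[of _ _ sum_list]) auto

lemma sum_list_swap: "(\<Sum>p\<leftarrow>L. \<Sum>q\<leftarrow>L'. g p q :: 'c::comm_monoid_add) = (\<Sum>q\<leftarrow>L'. \<Sum>p\<leftarrow>L. g p q)"
  by (induction L) (simp_all add: sum_list_addf)

lemma sum_list_sum_swap: "(\<Sum>x\<leftarrow>xs. \<Sum>i\<in>A. g x i) = (\<Sum>i\<in>A. \<Sum>x\<leftarrow>xs. g x i)"
  by (induction xs) (simp_all add: sum.distrib)

lemma sum_list_pos_member:
  "(\<And>x. x \<in> set xs \<Longrightarrow> f x \<ge> (0::real)) \<Longrightarrow> y \<in> set xs \<Longrightarrow> f y > 0 \<Longrightarrow> (\<Sum>x\<leftarrow>xs. f x) > 0"
proof (induction xs)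
  case (Cons x xs)
  have "(\<Sum>x\<leftarrow>xs. f x) \<ge> 0" using Cons.prems(1) by (intro sum_list_nonneg) auto
  moreover have "f x \<ge> 0" using Cons.prems(1) by simp
  moreover have "f x > 0 \<or> (\<Sum>x\<leftarrow>xs. f x) > 0" using Cons by auto
  ultimately show ?case by auto
qed simp

section \<open>Linear and bilinear maps\<close>

lemma linear_mult_left: "linear f \<Longrightarrow> linear (\<lambda>x. c * f x :: 'b::real_algebra_1)"
  by (rule linearI) (simp_all add: linear_add linear_scale algebra_simps)

lemma linear_mult_right: "linear f \<Longrightarrow> linear (\<lambda>x. f x * c :: 'b::real_algebra_1)"
  by (rule linearI) (simp_all add: linear_add linear_scale algebra_simps)

lemma linear_scaleR_vec: "linear f \<Longrightarrow> linear (\<lambda>x. f x *\<^sub>R c)"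
  by (rule linearI) (simp_all add: linear_add linear_scale algebra_simps)

lemma linear_scaleR_real: "linear f \<Longrightarrow> linear (\<lambda>x. c *\<^sub>R f x)"
  by (rule linearI) (simp_all add: linear_add linear_scale algebra_simps)

lemma linear_compose': "linear f \<Longrightarrow> linear g \<Longrightarrow> linear (\<lambda>x. f (g x))"
  using linear_compose[of g f] by (simp add: o_def)

lemma linear_sum_list: "linear f \<Longrightarrow> f (\<Sum>x\<leftarrow>xs. g x) = (\<Sum>x\<leftarrow>xs. f (g x))"
  by (induction xs) (simp_all add: linear_add linear_0)

lemma linear_compose_sum_list:
  "(\<And>a. a \<in> set L \<Longrightarrow> linear (f a)) \<Longrightarrow> linear (\<lambda>x. \<Sum>a\<leftarrow>L. f a x)"
  by (induction L) (auto intro!: linear_zero linear_compose_add)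

lemma sum_list_in_subspace:
  "subspace Q \<Longrightarrow> (\<And>x. x \<in> set xs \<Longrightarrow> f x \<in> Q) \<Longrightarrow> (\<Sum>x\<leftarrow>xs. f x) \<in> Q"
  by (induction xs) (auto simp: subspace_0 subspace_add)

lemma bilinearI:
  "(\<And>x. linear (\<lambda>y. h x y)) \<Longrightarrow> (\<And>y. linear (\<lambda>x. h x y)) \<Longrightarrow> bilinear h"
  by (simp add: bilinear_def)

lemma bilinearD1: "bilinear h \<Longrightarrow> linear (\<lambda>y. h x y)"
  by (simp add: bilinear_def)

lemma bilinearD2: "bilinear h \<Longrightarrow> linear (\<lambda>x. h x y)"
  by (simp add: bilinear_def)

text \<open>Extending a basis of \<open>V\<close> by \<open>x\<close> leaves the values of the
  functional free to choose. Elements are later recognised as zero, and the limit in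
  \<open>vector_infsum\<close> as unique, through such functionals.\<close>

lemma linear_separation:
  fixes x :: "'a::real_vector"
  assumes "x \<notin> V" "subspace V"
  obtains f :: "'a \<Rightarrow> real" where "linear f" "f x = 1" "\<And>y. y \<in> V \<Longrightarrow> f y = 0"
proof -
  obtain B where B: "B \<subseteq> V" "independent B" "V \<subseteq> span B"
    using maximal_independent_subset[of V] by blast
  have sV: "span B = V" using B assms(2) by (metis span_eq_iff span_mono subset_antisym)
  have "x \<notin> span B" using sV assms by simp
  then have ind: "independent (insert x B)" using B(2) by (simp add: independent_insert)
  obtain f :: "'a \<Rightarrow> real" where f: "linear f" "\<forall>y\<in>insert x B. f y = (if y = x then 1 else 0)"
    using linear_independent_extend[OF ind, of "\<lambda>y. if y = x then 1 else 0"] by auto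
  have "x \<notin> B" using \<open>x \<notin> span B\<close> span_base by blast
  then have "\<And>y. y \<in> B \<Longrightarrow> f y = 0" using f(2) by auto
  then have "\<And>y. y \<in> span B \<Longrightarrow> f y = 0"
    by (rule linear_eq_0_on_span[OF f(1)])
  then show ?thesis using that[of f] f sV by auto
qed

section \<open>Tensors\<close>

lemma keys_sum_single: "p = (\<Sum>k\<in>Poly_Mapping.keys p. Poly_Mapping.single k (Poly_Mapping.lookup p k))"
  by (rule poly_mapping_eqI)
    (simp add: lookup_sum lookup_single when_def in_keys_iff)

lemma linear_abs_tensor: "linear abs_tensor"
  by (rule linearI) (simp_all add: plus_tensor.abs_eq scaleR_tensor.abs_eq)

lemma single_scaleR: "Poly_Mapping.single k (c::real) = c *\<^sub>R Poly_Mapping.single k 1"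
  by (rule poly_mapping_eqI) (simp add: scaleR_poly_mapping.rep_eq lookup_single when_def)

lemma abs_tensor_sum:
  "abs_tensor p = (\<Sum>k\<in>Poly_Mapping.keys p. Poly_Mapping.lookup p k *\<^sub>R pure_tensor k)"
proof -
  have "abs_tensor p = abs_tensor (\<Sum>k\<in>Poly_Mapping.keys p. Poly_Mapping.lookup p k *\<^sub>R Poly_Mapping.single k 1)"
    unfolding single_scaleR[symmetric] by (rule arg_cong[OF keys_sum_single])
  also have "\<dots> = (\<Sum>k\<in>Poly_Mapping.keys p. Poly_Mapping.lookup p k *\<^sub>R pure_tensor k)"
    by (simp add: linear_sum[OF linear_abs_tensor] linear_scale[OF linear_abs_tensor] pure_tensor.abs_eq)
  finally show ?thesis .
qed

text \<open>Classes are finite combinations of pure tensors. With this rule an identity between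
  linear maps on tensors is checked on lists only, without choosing representatives.\<close>

lemma linear_eq_on_pure:
  assumes "linear f" "linear g" "\<And>xs. f (pure_tensor xs) = g (pure_tensor xs)"
  shows "f t = g t"
proof (induction t rule: tensor.abs_induct)
  case (1 p)
  then show ?case
    by (simp add: abs_tensor_sum linear_sum[OF assms(1)] linear_scale[OF assms(1)]
        linear_sum[OF assms(2)] linear_scale[OF assms(2)] assms(3))
qed

lemma linear_pure_tensor: "linear (\<lambda>x. pure_tensor (xs @ x # ys))"
proof
  fix x y :: 'a and c :: real
  have *: "tensor_eq (Poly_Mapping.single (xs @ (a *\<^sub>R x + b *\<^sub>R y) # ys) 1)
     (a *\<^sub>R Poly_Mapping.single (xs @ x # ys) 1 + b *\<^sub>R Poly_Mapping.single (xs @ y # ys) 1)" for a b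
    unfolding tensor_eq_def multilinear_relations_def diff_diff_eq[symmetric]
    by (rule span_base) blast
  have **: "pure_tensor (xs @ (a *\<^sub>R x + b *\<^sub>R y) # ys) =
       a *\<^sub>R pure_tensor (xs @ x # ys) + b *\<^sub>R pure_tensor (xs @ y # ys)" for a b
    using *[of a b] unfolding pure_tensor.abs_eq scaleR_tensor.abs_eq plus_tensor.abs_eq
    by (simp add: tensor.abs_eq_iff)
  from **[of 1 1] show "pure_tensor (xs @ (x + y) # ys) = pure_tensor (xs @ x # ys) + pure_tensor (xs @ y # ys)"
    by simp
  from **[of c 0] show "pure_tensor (xs @ (c *\<^sub>R x) # ys) = c *\<^sub>R pure_tensor (xs @ x # ys)"
    by simp
qed

lemma multilinearI: "(\<And>xs ys. linear (\<lambda>x. f (xs @ x # ys))) \<Longrightarrow> multilinear f"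
  by (simp add: multilinear_def)

lemma multilinearD: "multilinear f \<Longrightarrow> linear (\<lambda>x. f (xs @ x # ys))"
  by (simp add: multilinear_def)

text \<open>Replacing an entry leaves the length alone, so extension by 0 to lists of other lengths
  stays linear in every entry. This is how a map on one fixed tensor power becomes a map on the
  direct sum of all of them.\<close>

lemma multilinear_length_pred:
  assumes "\<And>xs ys. P (length xs + length ys + 1) \<Longrightarrow> linear (\<lambda>x. f (xs @ x # ys))"
  shows "multilinear (\<lambda>xs. if P (length xs) then f xs else 0)"
proof (rule multilinearI)
  fix xs ys :: "'a list"
  show "linear (\<lambda>x. if P (length (xs @ x # ys)) then f (xs @ x # ys) else 0)"
    using assms[of xs ys] by (cases "P (length xs + length ys + 1)") (auto intro: linear_zero)
qed

definition lift2 :: "('a::real_vector \<Rightarrow> 'a \<Rightarrow> 'b::real_vector) \<Rightarrow> 'a tensor \<Rightarrow> 'b" where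
  "lift2 \<beta> = tensor_lift (\<lambda>xs. if length xs = 2 then \<beta> (xs ! 0) (xs ! 1) else 0)"

lemma multilinear_lift2:
  assumes "bilinear \<beta>"
  shows "multilinear (\<lambda>xs. if length xs = 2 then \<beta> (xs ! 0) (xs ! 1) else 0)"
proof (rule multilinear_length_pred)
  fix xs ys :: "'a list" assume "length xs + length ys + 1 = 2"
  then consider (a) y where "xs = []" "ys = [y]" | (b) x where "xs = [x]" "ys = []"
    by (cases xs; cases ys; cases "tl xs"; cases "tl ys") auto
  then show "linear (\<lambda>x. \<beta> ((xs @ x # ys) ! 0) ((xs @ x # ys) ! 1))"
    using assms by cases (auto simp: bilinear_def)
qed

lemma linear_lift2: "bilinear \<beta> \<Longrightarrow> linear (lift2 \<beta>)"
  unfolding lift2_def by (intro linear_tensor_lift multilinear_lift2)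

lemma lift2_pure [simp]: "bilinear \<beta> \<Longrightarrow> lift2 \<beta> (pure_tensor [a, b]) = \<beta> a b"
  unfolding lift2_def by (subst tensor_lift_pure) (auto intro: multilinear_lift2)

definition lift3 :: "('a::real_vector \<Rightarrow> 'a \<Rightarrow> 'a \<Rightarrow> 'b::real_vector) \<Rightarrow> 'a tensor \<Rightarrow> 'b" where
  "lift3 \<gamma> = tensor_lift (\<lambda>xs. if length xs = 3 then \<gamma> (xs ! 0) (xs ! 1) (xs ! 2) else 0)"

definition trilinear :: "('a::real_vector \<Rightarrow> 'a \<Rightarrow> 'a \<Rightarrow> 'b::real_vector) \<Rightarrow> bool" where
  "trilinear \<gamma> \<longleftrightarrow> (\<forall>x y. linear (\<lambda>z. \<gamma> x y z)) \<and> (\<forall>x z. linear (\<lambda>y. \<gamma> x y z)) \<and> (\<forall>y z. linear (\<lambda>x. \<gamma> x y z))"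

lemma multilinear_lift3:
  assumes "trilinear \<gamma>"
  shows "multilinear (\<lambda>xs. if length xs = 3 then \<gamma> (xs ! 0) (xs ! 1) (xs ! 2) else 0)"
proof (rule multilinear_length_pred)
  fix xs ys :: "'a list" assume *: "length xs + length ys + 1 = 3"
  then consider "xs = []" | a where "xs = [a]" | a b where "xs = [a, b]"
    by (cases xs; cases "tl xs"; cases "tl (tl xs)") auto
  then show "linear (\<lambda>x. \<gamma> ((xs @ x # ys) ! 0) ((xs @ x # ys) ! 1) ((xs @ x # ys) ! 2))"
    using assms by cases (auto simp: trilinear_def)
qed

lemma linear_lift3: "trilinear \<gamma> \<Longrightarrow> linear (lift3 \<gamma>)"
  unfolding lift3_def by (intro linear_tensor_lift multilinear_lift3)

lemma lift3_pure [simp]: "trilinear \<gamma> \<Longrightarrow> lift3 \<gamma> (pure_tensor [a, b, c]) = \<gamma> a b c"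
  unfolding lift3_def by (subst tensor_lift_pure) (auto intro: multilinear_lift3)

lemma multilinear_append: "multilinear (\<lambda>ys. pure_tensor (xs @ ys))"
  by (rule multilinearI) (simp add: linear_pure_tensor flip: append_assoc)

lemma tensor_lift_compose_add:
  assumes "multilinear f" "multilinear g"
  shows "tensor_lift (\<lambda>x. f x + g x) t = tensor_lift f t + tensor_lift g t"
proof (rule linear_eq_on_pure[where t = t])
  have m: "multilinear (\<lambda>x. f x + g x)"
    using assms by (auto simp: multilinear_def intro: linear_compose_add)
  show "linear (tensor_lift (\<lambda>x. f x + g x))" by (rule linear_tensor_lift[OF m])
  show "linear (\<lambda>a. tensor_lift f a + tensor_lift g a)"
    using assms by (intro linear_compose_add linear_tensor_lift)
  show "tensor_lift (\<lambda>x. f x + g x) (pure_tensor xs) =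
         tensor_lift f (pure_tensor xs) + tensor_lift g (pure_tensor xs)" for xs
    by (simp add: tensor_lift_pure m assms)
qed

lemma tensor_lift_compose_scale:
  assumes "multilinear f"
  shows "tensor_lift (\<lambda>x. c *\<^sub>R f x) t = c *\<^sub>R tensor_lift f t"
proof (rule linear_eq_on_pure[where t = t])
  have m: "multilinear (\<lambda>x. c *\<^sub>R f x)"
    using assms by (auto simp: multilinear_def intro: linear_scaleR_real)
  show "linear (tensor_lift (\<lambda>x. c *\<^sub>R f x))" by (rule linear_tensor_lift[OF m])
  show "linear (\<lambda>a. c *\<^sub>R tensor_lift f a)"
    using assms by (intro linear_scaleR_real linear_tensor_lift)
  show "tensor_lift (\<lambda>x. c *\<^sub>R f x) (pure_tensor xs) = c *\<^sub>R tensor_lift f (pure_tensor xs)" for xs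
    by (simp add: tensor_lift_pure m assms)
qed

lemma multilinear_tensor_lift:
  assumes "\<And>xs. multilinear (f xs)" "\<And>ys. multilinear (\<lambda>xs. f xs ys)"
  shows "multilinear (\<lambda>xs. tensor_lift (f xs) t)"
proof (rule multilinearI, rule linearI)
  fix xs ys :: "'a list" and x y :: 'a and c :: real
  have "f (xs @ (x + y) # ys) = (\<lambda>zs. f (xs @ x # ys) zs + f (xs @ y # ys) zs)"
    using linear_add[OF multilinearD[OF assms(2)]] by (auto simp: fun_eq_iff)
  then show "tensor_lift (f (xs @ (x + y) # ys)) t = tensor_lift (f (xs @ x # ys)) t + tensor_lift (f (xs @ y # ys)) t"
    by (simp add: tensor_lift_compose_add assms)
  have "f (xs @ (c *\<^sub>R x) # ys) = (\<lambda>zs. c *\<^sub>R f (xs @ x # ys) zs)"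
    using linear_scale[OF multilinearD[OF assms(2)]] by (auto simp: fun_eq_iff)
  then show "tensor_lift (f (xs @ (c *\<^sub>R x) # ys)) t = c *\<^sub>R tensor_lift (f (xs @ x # ys)) t"
    by (simp add: tensor_lift_compose_scale assms)
qed

lemma multilinear_append_left: "multilinear (\<lambda>xs. pure_tensor (xs @ ys))"
  by (rule multilinearI) (simp add: linear_pure_tensor)

lemma tensor_append_multilinear: "multilinear (\<lambda>xs. tensor_lift (\<lambda>ys. pure_tensor (xs @ ys)) t)"
  by (rule multilinear_tensor_lift) (rule multilinear_append multilinear_append_left)+

lemma tensor_append_pure_left:
  "tensor_append (pure_tensor xs) t = tensor_lift (\<lambda>ys. pure_tensor (xs @ ys)) t"
  unfolding tensor_append_def by (rule tensor_lift_pure[OF tensor_append_multilinear])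

lemma tensor_append_pure [simp]:
  "tensor_append (pure_tensor xs) (pure_tensor ys) = pure_tensor (xs @ ys)"
  by (simp add: tensor_append_pure_left tensor_lift_pure multilinear_append)

lemma linear_tensor_append_left: "linear (\<lambda>s. tensor_append s t)"
  unfolding tensor_append_def by (rule linear_tensor_lift[OF tensor_append_multilinear])

lemma linear_tensor_append_right: "linear (tensor_append s)"
proof (rule linearI)
  fix t u :: "'a tensor" and c :: real
  show "tensor_append s (t + u) = tensor_append s t + tensor_append s u"
    by (rule linear_eq_on_pure[of "\<lambda>s. tensor_append s (t + u)" "\<lambda>s. tensor_append s t + tensor_append s u"])
      (auto intro: linear_tensor_append_left linear_compose_add simp: tensor_append_pure_left
        linear_add[OF linear_tensor_lift[OF multilinear_append]])
  show "tensor_append s (c *\<^sub>R t) = c *\<^sub>R tensor_append s t"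
    by (rule linear_eq_on_pure[of "\<lambda>s. tensor_append s (c *\<^sub>R t)" "\<lambda>s. c *\<^sub>R tensor_append s t"])
      (auto intro: linear_tensor_append_left linear_scaleR_real simp: tensor_append_pure_left
        linear_scale[OF linear_tensor_lift[OF multilinear_append]])
qed

lemma linear_foldr_tensor_append:
  "linear (\<lambda>x. foldr tensor_append (ts @ x # us) v)"
proof (induction ts)
  case Nil
  show ?case by (simp add: linear_tensor_append_left)
next
  case (Cons t ts)
  then show ?case using linear_compose'[OF linear_tensor_append_right Cons] by simp
qed

lemma multilinear_tensor_map:
  assumes "\<forall>f\<in>set fs. linear f"
  shows "multilinear (\<lambda>xs. if length xs = length fs
     then foldr tensor_append (map2 (\<lambda>f x. f x) fs xs) (pure_tensor []) else 0)"
proof (rule multilinear_length_pred)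
  fix xs ys :: "'a list" assume *: "length xs + length ys + 1 = length fs"
  define gs hs f where "gs = take (length xs) fs" and "hs = drop (Suc (length xs)) fs" and "f = fs ! length xs"
  have fs: "fs = gs @ f # hs" using * by (simp add: gs_def hs_def f_def id_take_nth_drop)
  have len: "length gs = length xs" using * by (simp add: gs_def)
  have "linear f" using fs assms by auto
  have "linear (\<lambda>x. foldr tensor_append (map2 (\<lambda>f x. f x) gs xs @ f x # map2 (\<lambda>f x. f x) hs ys) (pure_tensor []))"
    using linear_foldr_tensor_append by (rule linear_compose'[OF _ \<open>linear f\<close>])
  then show "linear (\<lambda>x. foldr tensor_append (map2 (\<lambda>f x. f x) fs (xs @ x # ys)) (pure_tensor []))"
    by (simp add: fs len)
qed

lemma linear_tensor_map: "\<forall>f\<in>set fs. linear f \<Longrightarrow> linear (tensor_map fs)"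
  unfolding tensor_map_def by (intro linear_tensor_lift multilinear_tensor_map)

lemma tensor_map_pure:
  "\<forall>f\<in>set fs. linear f \<Longrightarrow> tensor_map fs (pure_tensor xs) = (if length xs = length fs
     then foldr tensor_append (map2 (\<lambda>f x. f x) fs xs) (pure_tensor []) else 0)"
  unfolding tensor_map_def by (rule tensor_lift_pure[OF multilinear_tensor_map])

lemma linear_embed: "linear embed"
  using linear_pure_tensor[of "[]" "[]"] by simp

lemma tensor_append_Nil_right [simp]: "tensor_append t (pure_tensor []) = t"
  by (rule linear_eq_on_pure[of "\<lambda>t. tensor_append t (pure_tensor [])" "\<lambda>t. t"])
    (auto intro: linear_tensor_append_left linear_ident)

lemma foldr_tensor_append_embed:
  "foldr tensor_append (map embed xs) t = tensor_append (pure_tensor xs) t"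
proof (induction xs)
  case Nil
  show ?case
    by (rule linear_eq_on_pure[of "\<lambda>t. foldr tensor_append (map embed []) t" "tensor_append (pure_tensor [])"])
      (auto intro: linear_tensor_append_right linear_ident)
next
  case (Cons x xs)
  have "tensor_append (embed x) (tensor_append (pure_tensor xs) t) = tensor_append (pure_tensor (x # xs)) t"
    by (rule linear_eq_on_pure[of "\<lambda>t. tensor_append (embed x) (tensor_append (pure_tensor xs) t)"])
      (simp_all add: linear_compose'[OF linear_tensor_append_right linear_tensor_append_right]
        linear_tensor_append_right)
  with Cons show ?case by simp
qed

lemma tensor_map_Cons_embeds:
  assumes "linear f" "length xs = l"
  shows "tensor_map (f # replicate l embed) (pure_tensor (x # xs)) = tensor_append (f x) (pure_tensor xs)"
proof -
  have "map2 (\<lambda>f x. f x) (replicate l embed) xs = map embed xs"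
    using assms(2) by (induction xs arbitrary: l) auto
  with assms show ?thesis
    by (subst tensor_map_pure) (auto simp: linear_embed foldr_tensor_append_embed)
qed

lemma tensor_map_embed_maps:
  assumes "\<forall>g\<in>set gs. linear g" "length xs = length gs"
  shows "tensor_map (map (\<lambda>g a. embed (g a)) gs) (pure_tensor xs) = pure_tensor (map2 (\<lambda>f x. f x) gs xs)"
proof -
  have "map2 (\<lambda>f x. f x) (map (\<lambda>g a. embed (g a)) gs) xs = map embed (map2 (\<lambda>f x. f x) gs xs)"
    using assms(2)[symmetric] by (induction gs xs rule: list_induct2) auto
  moreover have "\<forall>f\<in>set (map (\<lambda>g a. embed (g a)) gs). linear f"
    using assms(1) linear_compose'[OF linear_embed] by auto
  ultimately show ?thesis
    using assms(2) by (subst tensor_map_pure) (simp_all add: foldr_tensor_append_embed del: map_map)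
qed

lemma multilinear_prod_list: "multilinear (prod_list :: 'a::real_algebra_1 list \<Rightarrow> 'a)"
  by (rule multilinearI) (simp add: linear_mult_left[OF linear_mult_right[OF linear_ident]])

lemma linear_mult_all: "linear mult_all"
  unfolding mult_all_def by (rule linear_tensor_lift[OF multilinear_prod_list])

lemma mult_all_pure [simp]: "mult_all (pure_tensor xs) = prod_list xs"
  unfolding mult_all_def by (rule tensor_lift_pure[OF multilinear_prod_list])

lemma multilinear_map2_times_right:
  "multilinear (\<lambda>ys :: 'a::real_algebra_1 list. if length xs = length ys then pure_tensor (map2 (*) xs ys) else 0)"
proof (rule multilinear_length_pred[where P = "\<lambda>l. length xs = l" and f = "\<lambda>ys. pure_tensor (map2 (*) xs ys)"])
  fix us vs :: "'a list" assume *: "length xs = length us + length vs + 1"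
  define gs hs c where "gs = take (length us) xs" and "hs = drop (Suc (length us)) xs" and "c = xs ! length us"
  have xs: "xs = gs @ c # hs" using * by (simp add: gs_def hs_def c_def id_take_nth_drop)
  have len: "length gs = length us" using * by (simp add: gs_def)
  show "linear (\<lambda>x. pure_tensor (map2 (*) xs (us @ x # vs)))"
    by (simp add: xs len linear_compose'[OF linear_pure_tensor linear_mult_left[OF linear_ident]])
qed

lemma multilinear_map2_times_left:
  "multilinear (\<lambda>xs :: 'a::real_algebra_1 list. if length xs = length ys then pure_tensor (map2 (*) xs ys) else 0)"
proof (rule multilinear_length_pred[where P = "\<lambda>l. l = length ys" and f = "\<lambda>xs. pure_tensor (map2 (*) xs ys)"])
  fix us vs :: "'a list" assume *: "length us + length vs + 1 = length ys"
  define gs hs c where "gs = take (length us) ys" and "hs = drop (Suc (length us)) ys" and "c = ys ! length us"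
  have ys: "ys = gs @ c # hs" using * by (simp add: gs_def hs_def c_def id_take_nth_drop)
  have len: "length us = length gs" using * by (simp add: gs_def)
  show "linear (\<lambda>x. pure_tensor (map2 (*) (us @ x # vs) ys))"
    by (simp add: ys len linear_compose'[OF linear_pure_tensor linear_mult_right[OF linear_ident]])
qed

lemma multilinear_tensor_times: "multilinear (\<lambda>xs :: 'a::real_algebra_1 list. tensor_lift (\<lambda>ys.
     if length xs = length ys then pure_tensor (map2 (*) xs ys) else 0) t)"
  by (rule multilinear_tensor_lift) (rule multilinear_map2_times_right multilinear_map2_times_left)+

lemma linear_tensor_times_left: "linear (\<lambda>s. tensor_times s t)"
  unfolding tensor_times_def by (rule linear_tensor_lift[OF multilinear_tensor_times])

lemma tensor_times_pure_left: "tensor_times (pure_tensor xs) t =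
  tensor_lift (\<lambda>ys. if length xs = length ys then pure_tensor (map2 (*) xs ys) else 0) t"
  unfolding tensor_times_def by (rule tensor_lift_pure[OF multilinear_tensor_times])

lemma tensor_times_pure: "tensor_times (pure_tensor xs) (pure_tensor ys) =
  (if length xs = length ys then pure_tensor (map2 (*) xs ys) else 0)"
  unfolding tensor_times_pure_left by (rule tensor_lift_pure[OF multilinear_map2_times_right])

lemma linear_tensor_times_pure_left: "linear (tensor_times (pure_tensor xs))"
  unfolding tensor_times_pure_left[abs_def]
  by (rule linear_tensor_lift[OF multilinear_map2_times_right])

section \<open>Sweedler calculus\<close>

context graded_connected_hopf_algebra
begin

abbreviation pr :: "nat \<Rightarrow> 'a \<Rightarrow> 'a" where "pr \<equiv> component H"

lemma is_decompositionI:
  assumes "\<And>i. f i \<in> H i" "finite A" "\<And>i. i \<notin> A \<Longrightarrow> f i = 0" "x = (\<Sum>i\<in>A. f i)"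
  shows "is_decomposition H x f"
proof -
  have "{i. f i \<noteq> 0} \<subseteq> A" using assms(3) by blast
  moreover from this have "(\<Sum>i\<in>A. f i) = (\<Sum>i | f i \<noteq> 0. f i)"
    using assms(2) by (intro sum.mono_neutral_right) auto
  ultimately show ?thesis using assms by (auto simp: is_decomposition_def intro: finite_subset)
qed

lemma component_eqI: "is_decomposition H x f \<Longrightarrow> pr i x = f i"
  unfolding component_def using the1_equality[OF direct_sum_H] by metis

lemma is_decomposition_component: "is_decomposition H x (\<lambda>i. pr i x)"
  unfolding component_def using theI'[OF direct_sum_H] by simp

lemma pr_in_H [simp]: "pr i x \<in> H i"
  using is_decomposition_component[of x] by (simp add: is_decomposition_def)

lemma finite_pr: "finite {i. pr i x \<noteq> 0}"
  using is_decomposition_component[of x] by (simp add: is_decomposition_def)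

lemma sum_pr: "x = (\<Sum>i | pr i x \<noteq> 0. pr i x)"
  using is_decomposition_component[of x] by (simp add: is_decomposition_def)

lemma zero_in_H [simp]: "0 \<in> H i"
  using subspace_H subspace_0 by blast

lemma pr_H: "x \<in> H i \<Longrightarrow> pr j x = (if j = i then x else 0)"
  by (rule component_eqI[of x "\<lambda>j. if j = i then x else 0"], rule is_decompositionI[of _ "{i}"]) auto

lemma linear_pr: "linear (pr i)"
proof (rule linearI)
  fix x y :: 'a and c :: real
  let ?A = "{i. pr i x \<noteq> 0} \<union> {i. pr i y \<noteq> 0}"
  have sx: "(\<Sum>i\<in>?A. pr i x) = x"
    by (subst (2) sum_pr[of x], rule sum.mono_neutral_right) (auto simp: finite_pr)
  have sy: "(\<Sum>i\<in>?A. pr i y) = y"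
    by (subst (2) sum_pr[of y], rule sum.mono_neutral_right) (auto simp: finite_pr)
  show "pr i (x + y) = pr i x + pr i y"
    by (rule component_eqI[of "x + y" "\<lambda>i. pr i x + pr i y"], rule is_decompositionI[of _ ?A])
      (auto simp: finite_pr sum.distrib sx sy intro: subspace_add[OF subspace_H])
  show "pr i (c *\<^sub>R x) = c *\<^sub>R pr i x"
    by (rule component_eqI[of "c *\<^sub>R x" "\<lambda>i. c *\<^sub>R pr i x"], rule is_decompositionI[of _ ?A])
      (auto simp: finite_pr sx intro: subspace_scale[OF subspace_H] simp flip: scaleR_sum_right)
qed

lemma H_induct:
  assumes "linear f" "linear g" "\<And>i x. x \<in> H i \<Longrightarrow> f x = g x"
  shows "f x = g x"
proof -
  have "f (\<Sum>i | pr i x \<noteq> 0. pr i x) = g (\<Sum>i | pr i x \<noteq> 0. pr i x)"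
    by (simp add: linear_sum[OF assms(1)] linear_sum[OF assms(2)] assms(3)[OF pr_in_H])
  then show ?thesis by (simp flip: sum_pr)
qed

text \<open>Sweedler's sum of \<open>\<beta>\<close> over the two legs of the coproduct. Being
  defined through \<open>lift2\<close>, it does not depend on how \<open>\<Delta> x\<close> is
  written as a sum of pure tensors.\<close>

definition cop :: "('a \<Rightarrow> 'a \<Rightarrow> 'b::real_vector) \<Rightarrow> 'a \<Rightarrow> 'b" where
  "cop \<beta> x = lift2 \<beta> (\<Delta> x)"

lemma cop_eq:
  "bilinear \<beta> \<Longrightarrow> \<Delta> x = (\<Sum>(a, b)\<leftarrow>L. pure_tensor [a, b]) \<Longrightarrow> cop \<beta> x = (\<Sum>(a, b)\<leftarrow>L. \<beta> a b)"
  by (simp add: cop_def case_prod_unfold linear_sum_list[OF linear_lift2])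

lemma linear_cop: "bilinear \<beta> \<Longrightarrow> linear (cop \<beta>)"
  unfolding cop_def[abs_def] by (rule linear_compose'[OF linear_lift2 linear_coproduct])

lemma coproduct_repr_H:
  assumes "x \<in> H n"
  obtains L where "\<Delta> x = (\<Sum>(a, b)\<leftarrow>L. pure_tensor [a, b])"
    "\<And>a b. (a, b) \<in> set L \<Longrightarrow> \<exists>j\<le>n. a \<in> H j \<and> b \<in> H (n - j)"
proof -
  have "\<exists>L. t = (\<Sum>(a, b)\<leftarrow>L. pure_tensor [a, b]) \<and>
      (\<forall>(a, b)\<in>set L. \<exists>j\<le>n. a \<in> H j \<and> b \<in> H (n - j))"
    if "t \<in> span (\<Union>j\<le>n. {pure_tensor [a, b] | a b. a \<in> H j \<and> b \<in> H (n - j)})" for t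
    using that
  proof (induction rule: span_induct_alt)
    case base
    show ?case by (rule exI[of _ "[]"]) simp
  next
    case (step c s t)
    then obtain L where L: "t = (\<Sum>(a, b)\<leftarrow>L. pure_tensor [a, b])"
      "\<forall>(a, b)\<in>set L. \<exists>j\<le>n. a \<in> H j \<and> b \<in> H (n - j)" by blast
    from step obtain j a b where ab: "j \<le> n" "a \<in> H j" "b \<in> H (n - j)" "s = pure_tensor [a, b]" by blast
    have "c *\<^sub>R s = pure_tensor [c *\<^sub>R a, b]"
      using linear_scale[OF linear_pure_tensor[of "[]" "[b]"]] ab by simp
    moreover have "c *\<^sub>R a \<in> H j" using ab by (intro subspace_scale[OF subspace_H])
    ultimately show ?case using L ab by (intro exI[of _ "(c *\<^sub>R a, b) # L"]) auto
  qed
  from this[OF coproduct_in_H[OF assms]] that show ?thesis by blast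
qed

lemma coproduct_repr:
  obtains L where "\<Delta> x = (\<Sum>(a, b)\<leftarrow>L. pure_tensor [a, b])"
proof -
  have "\<forall>i. \<exists>L. \<Delta> (pr i x) = (\<Sum>(a, b)\<leftarrow>L. pure_tensor [a, b])"
    using coproduct_repr_H[OF pr_in_H] by metis
  then obtain L where L: "\<And>i. \<Delta> (pr i x) = (\<Sum>(a, b)\<leftarrow>L i. pure_tensor [a, b])" by metis
  have "\<exists>L. \<Delta> (\<Sum>i\<in>A. pr i x) = (\<Sum>(a, b)\<leftarrow>L. pure_tensor [a, b])" if "finite A" for A
    using that
  proof (induction A)
    case empty
    show ?case by (rule exI[of _ "[]"]) (simp add: linear_0[OF linear_coproduct])
  next
    case (insert i A)
    then obtain L' where "\<Delta> (\<Sum>i\<in>A. pr i x) = (\<Sum>(a, b)\<leftarrow>L'. pure_tensor [a, b])" by blast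
    then show ?case using insert.hyps
      by (intro exI[of _ "L i @ L'"]) (simp add: linear_add[OF linear_coproduct] L)
  qed
  from this[OF finite_pr[of x]] show ?thesis using that by (auto simp flip: sum_pr)
qed

text \<open>One list of legs of \<open>\<Delta> x\<close> serves all parameters \<open>z\<close> at
  once.\<close>

lemma linear_cop_parametric:
  assumes "\<And>z. bilinear (\<beta> z)" "\<And>a b. linear (\<lambda>z. \<beta> z a b)"
  shows "linear (\<lambda>z. cop (\<beta> z) x)"
proof -
  obtain L where "\<Delta> x = (\<Sum>(a, b)\<leftarrow>L. pure_tensor [a, b])" by (rule coproduct_repr)
  then have "cop (\<beta> z) x = (\<Sum>p\<leftarrow>L. \<beta> z (fst p) (snd p))" for z
    by (simp add: cop_eq[OF assms(1)] case_prod_unfold)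
  then show ?thesis by (simp add: linear_compose_sum_list assms(2))
qed

lemma bilinear_mult: "linear f \<Longrightarrow> linear g \<Longrightarrow> bilinear (\<lambda>a b. f a * g b :: 'b::real_algebra_1)"
  by (intro bilinearI linear_mult_left linear_mult_right)

lemma bilinear_cop_mult:
  assumes "bilinear \<beta>"
  shows "bilinear (\<lambda>a b. cop (\<lambda>a' b'. \<beta> (a * a') (b * b')) y)"
    and "bilinear (\<lambda>a' b'. \<beta> (a * a') (b * b'))"
proof -
  have 1: "linear (\<lambda>b. \<beta> x (b * b'))" "linear (\<lambda>b'. \<beta> x (b * b'))"
     "linear (\<lambda>b. \<beta> (b * b') y)" "linear (\<lambda>b'. \<beta> (b * b') y)" for x y b b'
    by (rule linear_compose'[OF bilinearD1[OF assms]] linear_compose'[OF bilinearD2[OF assms]],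
      (rule linear_mult_right linear_mult_left), rule linear_ident)+
  show *: "bilinear (\<lambda>a' b'. \<beta> (a * a') (b * b'))" for a b
    by (rule bilinearI) (rule 1)+
  show "bilinear (\<lambda>a b. cop (\<lambda>a' b'. \<beta> (a * a') (b * b')) y)"
    by (rule bilinearI; rule linear_cop_parametric) (rule * 1)+
qed

lemma cop_mult:
  assumes "bilinear \<beta>"
  shows "cop \<beta> (x * y) = cop (\<lambda>a b. cop (\<lambda>a' b'. \<beta> (a * a') (b * b')) y) x"
proof -
  obtain L where L: "\<Delta> x = (\<Sum>(a, b)\<leftarrow>L. pure_tensor [a, b])" by (rule coproduct_repr)
  obtain L' where L': "\<Delta> y = (\<Sum>(a, b)\<leftarrow>L'. pure_tensor [a, b])" by (rule coproduct_repr)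
  have "\<Delta> (x * y) = (\<Sum>p\<leftarrow>L. \<Sum>q\<leftarrow>L'. pure_tensor [fst p * fst q, snd p * snd q])"
    by (simp add: coproduct_mult L L' case_prod_unfold linear_sum_list[OF linear_tensor_times_left]
        linear_sum_list[OF linear_tensor_times_pure_left] tensor_times_pure)
  then have "cop \<beta> (x * y) = (\<Sum>p\<leftarrow>L. \<Sum>q\<leftarrow>L'. \<beta> (fst p * fst q) (snd p * snd q))"
    by (simp add: cop_def linear_sum_list[OF linear_lift2[OF assms]] assms)
  then show ?thesis
    by (subst cop_eq[OF bilinear_cop_mult(1)[OF assms] L])
      (simp add: cop_eq[OF bilinear_cop_mult(2)[OF assms] L'] case_prod_unfold)
qed

lemma trilinear_cop:
  assumes "trilinear \<gamma>"
  shows "bilinear (\<lambda>a b. cop (\<lambda>a1 a2. \<gamma> a1 a2 b) a)" "bilinear (\<lambda>a1 a2. \<gamma> a1 a2 b)"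
    "bilinear (\<lambda>a b. cop (\<lambda>b1 b2. \<gamma> a b1 b2) b)" "bilinear (\<lambda>b1 b2. \<gamma> a b1 b2)"
proof -
  show 1: "bilinear (\<lambda>a1 a2. \<gamma> a1 a2 b)" "bilinear (\<lambda>b1 b2. \<gamma> a b1 b2)" for a b
    using assms by (auto simp: trilinear_def intro!: bilinearI)
  show "bilinear (\<lambda>a b. cop (\<lambda>a1 a2. \<gamma> a1 a2 b) a)" "bilinear (\<lambda>a b. cop (\<lambda>b1 b2. \<gamma> a b1 b2) b)"
    using assms by (auto simp: trilinear_def intro!: bilinearI linear_cop_parametric linear_cop 1)
qed

text \<open>Coassociativity in Sweedler form: both bracketings of the twofold coproduct are written
  as sums of pure tensors of length 3, and \<open>\<gamma>\<close> is applied to them. Associativity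
  of convolution is the case where \<open>\<gamma>\<close> is a product of three linear
  maps.\<close>

lemma cop_assoc:
  assumes "trilinear \<gamma>"
  shows "cop (\<lambda>a b. cop (\<lambda>a1 a2. \<gamma> a1 a2 b) a) x = cop (\<lambda>a b. cop (\<lambda>b1 b2. \<gamma> a b1 b2) b) x"
proof -
  obtain L where L: "\<Delta> x = (\<Sum>(a, b)\<leftarrow>L. pure_tensor [a, b])" by (rule coproduct_repr)
  have "\<forall>y. \<exists>L. \<Delta> y = (\<Sum>(a, b)\<leftarrow>L. pure_tensor [a, b])" by (rule allI, rule coproduct_repr) (rule exI)
  then have "\<exists>M. \<forall>y. \<Delta> y = (\<Sum>(a, b)\<leftarrow>M y. pure_tensor [a, b])" by (rule choice)
  then obtain M where M: "\<And>y. \<Delta> y = (\<Sum>(a, b)\<leftarrow>M y. pure_tensor [a, b])" by blast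
  have lin: "\<forall>f\<in>set [\<Delta>, embed]. linear f"
    using linear_coproduct linear_embed by auto
  have lin': "\<forall>f\<in>set [embed, \<Delta>]. linear f"
    using linear_coproduct linear_embed by auto
  have "tensor_map [\<Delta>, embed] (\<Delta> x) = (\<Sum>p\<leftarrow>L. \<Sum>q\<leftarrow>M (fst p). pure_tensor [fst q, snd q, snd p])"
    by (simp add: L case_prod_unfold linear_sum_list[OF linear_tensor_map[OF lin]] tensor_map_pure[OF lin]
        M[of "fst _"] linear_sum_list[OF linear_tensor_append_left])
  moreover have "tensor_map [embed, \<Delta>] (\<Delta> x) = (\<Sum>p\<leftarrow>L. \<Sum>q\<leftarrow>M (snd p). pure_tensor [fst p, fst q, snd q])"
    by (simp add: L case_prod_unfold linear_sum_list[OF linear_tensor_map[OF lin']] tensor_map_pure[OF lin']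
        M[of "snd _"] linear_sum_list[OF linear_tensor_append_right])
  ultimately have "lift3 \<gamma> (\<Sum>p\<leftarrow>L. \<Sum>q\<leftarrow>M (fst p). pure_tensor [fst q, snd q, snd p]) =
    lift3 \<gamma> (\<Sum>p\<leftarrow>L. \<Sum>q\<leftarrow>M (snd p). pure_tensor [fst p, fst q, snd q])"
    using coassociative by metis
  then show ?thesis
    apply (subst cop_eq[OF trilinear_cop(1)[OF assms] L], subst cop_eq[OF trilinear_cop(3)[OF assms] L])
    by (simp add: linear_sum_list[OF linear_lift3[OF assms]] assms case_prod_unfold
      cop_eq[OF trilinear_cop(2)[OF assms] M] cop_eq[OF trilinear_cop(4)[OF assms] M])
qed

lemma cop_counit_left: "linear f \<Longrightarrow> cop (\<lambda>a b. \<epsilon> a *\<^sub>R f b) x = f x"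
proof -
  assume f: "linear f"
  obtain L where L: "\<Delta> x = (\<Sum>(a, b)\<leftarrow>L. pure_tensor [a, b])" by (rule coproduct_repr)
  have lin: "\<forall>f\<in>set [\<lambda>a. \<epsilon> a *\<^sub>R pure_tensor [], embed]. linear f"
    using linear_counit linear_embed by (auto intro: linear_scaleR_vec)
  have "embed x = (\<Sum>p\<leftarrow>L. \<epsilon> (fst p) *\<^sub>R embed (snd p))"
    by (subst counit_left[symmetric]) (simp add: L case_prod_unfold linear_sum_list[OF linear_tensor_map[OF lin]] tensor_map_pure[OF lin]
       linear_scale[OF linear_tensor_append_left])
  \<comment> \<open>\<open>mult_all\<close> is a left inverse of \<open>embed\<close>; applying it
    turns the counit axiom into an identity between elements.\<close>
  then have "mult_all (embed x) = mult_all (\<Sum>p\<leftarrow>L. \<epsilon> (fst p) *\<^sub>R embed (snd p))" by simp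
  then have x: "x = (\<Sum>p\<leftarrow>L. \<epsilon> (fst p) *\<^sub>R snd p)"
    by (simp add: linear_sum_list[OF linear_mult_all] linear_scale[OF linear_mult_all])
  have "cop (\<lambda>a b. \<epsilon> a *\<^sub>R f b) x = (\<Sum>(a, b)\<leftarrow>L. \<epsilon> a *\<^sub>R f b)"
    by (rule cop_eq[OF _ L]) (intro bilinearI linear_scaleR_vec linear_scaleR_real linear_counit f)
  also have "\<dots> = f (\<Sum>p\<leftarrow>L. \<epsilon> (fst p) *\<^sub>R snd p)"
    by (simp add: linear_sum_list[OF f] linear_scale[OF f] case_prod_unfold)
  finally show ?thesis by (simp flip: x)
qed

lemma cop_counit_right: "linear f \<Longrightarrow> cop (\<lambda>a b. \<epsilon> b *\<^sub>R f a) x = f x"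
proof -
  assume f: "linear f"
  obtain L where L: "\<Delta> x = (\<Sum>(a, b)\<leftarrow>L. pure_tensor [a, b])" by (rule coproduct_repr)
  have lin: "\<forall>f\<in>set [embed, \<lambda>a. \<epsilon> a *\<^sub>R pure_tensor []]. linear f"
    using linear_counit linear_embed by (auto intro: linear_scaleR_vec)
  have "embed x = (\<Sum>p\<leftarrow>L. \<epsilon> (snd p) *\<^sub>R embed (fst p))"
    by (subst counit_right[symmetric]) (simp add: L case_prod_unfold linear_sum_list[OF linear_tensor_map[OF lin]] tensor_map_pure[OF lin]
       linear_scale[OF linear_tensor_append_right])
  then have "mult_all (embed x) = mult_all (\<Sum>p\<leftarrow>L. \<epsilon> (snd p) *\<^sub>R embed (fst p))" by simp
  then have x: "x = (\<Sum>p\<leftarrow>L. \<epsilon> (snd p) *\<^sub>R fst p)"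
    by (simp add: linear_sum_list[OF linear_mult_all] linear_scale[OF linear_mult_all])
  have "cop (\<lambda>a b. \<epsilon> b *\<^sub>R f a) x = (\<Sum>(a, b)\<leftarrow>L. \<epsilon> b *\<^sub>R f a)"
    by (rule cop_eq[OF _ L]) (intro bilinearI linear_scaleR_vec linear_scaleR_real linear_counit f)
  also have "\<dots> = f (\<Sum>p\<leftarrow>L. \<epsilon> (snd p) *\<^sub>R fst p)"
    by (simp add: linear_sum_list[OF f] linear_scale[OF f] case_prod_unfold)
  finally show ?thesis by (simp flip: x)
qed

lemma cop_cocommutative:
  assumes "cocommutative \<Delta>" "bilinear \<beta>"
  shows "cop (\<lambda>a b. \<beta> b a) x = cop \<beta> x"
proof -
  obtain L where L: "\<Delta> x = (\<Sum>(a, b)\<leftarrow>L. pure_tensor [a, b])" by (rule coproduct_repr)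
  have m: "multilinear (\<lambda>xs. pure_tensor (rev xs))"
    by (rule multilinearI) (simp add: linear_pure_tensor)
  have "\<Delta> x = tensor_rev (\<Delta> x)" using assms(1) by (simp add: cocommutative_def)
  also have "\<dots> = (\<Sum>(a, b)\<leftarrow>map prod.swap L. pure_tensor [a, b])"
    unfolding tensor_rev_def
    by (simp add: L case_prod_unfold linear_sum_list[OF linear_tensor_lift[OF m]] tensor_lift_pure m o_def)
  finally have "cop \<beta> x = (\<Sum>(a, b)\<leftarrow>map prod.swap L. \<beta> a b)" by (rule cop_eq[OF assms(2)])
  also have "\<dots> = (\<Sum>(a, b)\<leftarrow>L. \<beta> b a)" by (simp add: case_prod_unfold o_def)
  also have "\<dots> = cop (\<lambda>a b. \<beta> b a) x"
    using assms(2) by (intro cop_eq[OF _ L, symmetric]) (auto simp: bilinear_def)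
  finally show ?thesis by simp
qed

subsection \<open>Convolution\<close>

definition conv :: "('a \<Rightarrow> 'b::real_algebra_1) \<Rightarrow> ('a \<Rightarrow> 'b) \<Rightarrow> 'a \<Rightarrow> 'b" where
  "conv f g x = cop (\<lambda>a b. f a * g b) x"

lemma linear_conv: "linear f \<Longrightarrow> linear g \<Longrightarrow> linear (conv f g)"
  unfolding conv_def[abs_def] by (intro linear_cop bilinear_mult)

lemma conv_assoc:
  assumes "linear f" "linear g" "linear h"
  shows "conv (conv f g) h = conv f (conv g h)"
proof (rule ext)
  fix x
  have t: "trilinear (\<lambda>a b c. f a * g b * h c)"
    unfolding trilinear_def by (intro conjI allI linear_mult_left linear_mult_right assms)
  obtain L where L: "\<Delta> x = (\<Sum>(a, b)\<leftarrow>L. pure_tensor [a, b])" by (rule coproduct_repr)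
  have "cop (\<lambda>a1 a2. f a1 * g a2 * h b) a = conv f g a * h b" for a b
  proof -
    obtain M where M: "\<Delta> a = (\<Sum>(a, b)\<leftarrow>M. pure_tensor [a, b])" by (rule coproduct_repr)
    show ?thesis unfolding conv_def cop_eq[OF trilinear_cop(2)[OF t] M] cop_eq[OF bilinear_mult[OF assms(1,2)] M]
      by (simp add: case_prod_unfold sum_list_mult_const)
  qed
  moreover have "cop (\<lambda>b1 b2. f a * g b1 * h b2) b = f a * conv g h b" for a b
  proof -
    obtain M where M: "\<Delta> b = (\<Sum>(a, b)\<leftarrow>M. pure_tensor [a, b])" by (rule coproduct_repr)
    show ?thesis unfolding conv_def cop_eq[OF trilinear_cop(4)[OF t] M] cop_eq[OF bilinear_mult[OF assms(2,3)] M]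
      by (simp add: case_prod_unfold sum_list_const_mult mult.assoc)
  qed
  ultimately show "conv (conv f g) h x = conv f (conv g h) x"
    using cop_assoc[OF t, of x] by (simp add: conv_def[of "conv f g"] conv_def[of f])
qed

lemma conv_unit_right: "linear f \<Longrightarrow> conv f (\<lambda>x. \<epsilon> x *\<^sub>R 1) = f"
  by (rule ext) (simp add: conv_def cop_counit_right)

lemma conv_unit_left: "linear f \<Longrightarrow> conv (\<lambda>x. \<epsilon> x *\<^sub>R 1) f = f"
  by (rule ext) (simp add: conv_def cop_counit_left)

definition convs :: "('a \<Rightarrow> 'b::real_algebra_1) list \<Rightarrow> 'a \<Rightarrow> 'b" where
  "convs gs = foldr conv gs (\<lambda>x. \<epsilon> x *\<^sub>R 1)"

lemma convs_Nil [simp]: "convs [] = (\<lambda>x. \<epsilon> x *\<^sub>R 1)"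
  and convs_Cons [simp]: "convs (g # gs) = conv g (convs gs)"
  by (simp_all add: convs_def)

lemma linear_convs: "\<forall>g\<in>set gs. linear g \<Longrightarrow> linear (convs gs)"
  by (induction gs) (auto intro: linear_conv linear_scaleR_vec linear_counit)

lemma convs_append:
  "\<forall>g\<in>set (gs @ hs). linear g \<Longrightarrow> convs (gs @ hs) = conv (convs gs) (convs hs)"
  by (induction gs) (simp_all add: conv_unit_left linear_convs conv_assoc)

definition mult_map :: "('a \<Rightarrow> 'b::real_algebra_1) list \<Rightarrow> 'a tensor \<Rightarrow> 'b" where
  "mult_map gs = tensor_lift (\<lambda>xs. if length xs = length gs then prod_list (map2 (\<lambda>f x. f x) gs xs) else 0)"

lemma multilinear_mult_map:
  fixes gs :: "('a \<Rightarrow> 'b::real_algebra_1) list"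
  assumes "\<forall>g\<in>set gs. linear g"
  shows "multilinear (\<lambda>xs. if length xs = length gs then prod_list (map2 (\<lambda>f x. f x) gs xs) else 0)"
proof (rule multilinear_length_pred)
  fix xs ys :: "'a list" assume *: "length xs + length ys + 1 = length gs"
  define gs1 gs2 f where "gs1 = take (length xs) gs" and "gs2 = drop (Suc (length xs)) gs" and "f = gs ! length xs"
  have gs: "gs = gs1 @ f # gs2" using * by (simp add: gs1_def gs2_def f_def id_take_nth_drop)
  have len: "length gs1 = length xs" using * by (simp add: gs1_def)
  have "linear f" using gs assms by auto
  then show "linear (\<lambda>x. prod_list (map2 (\<lambda>f x. f x) gs (xs @ x # ys)))"
    by (simp add: gs len linear_mult_left linear_mult_right)
qed

lemma linear_mult_map: "\<forall>g\<in>set gs. linear g \<Longrightarrow> linear (mult_map gs)"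
  unfolding mult_map_def by (intro linear_tensor_lift multilinear_mult_map)

lemma mult_map_pure: "\<forall>g\<in>set gs. linear g \<Longrightarrow> mult_map gs (pure_tensor xs) =
    (if length xs = length gs then prod_list (map2 (\<lambda>f x. f x) gs xs) else 0)"
  unfolding mult_map_def by (rule tensor_lift_pure[OF multilinear_mult_map])

text \<open>Comultiplying the first slot before applying \<open>g\<close> and \<open>h\<close>
  amounts to applying \<open>conv g h\<close> to that slot. Each step of
  \<open>iterated_coproduct\<close> thus removes one map from the list.\<close>

lemma mult_map_coproduct:
  assumes lin: "linear g" "linear h" "\<forall>g\<in>set gs. linear g"
  shows "mult_map (g # h # gs) (tensor_map (\<Delta> # replicate (length gs) embed) t) = mult_map (conv g h # gs) t"
proof (rule linear_eq_on_pure[where t = t])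
  have l1: "\<forall>k\<in>set (g # h # gs). linear k" using lin by auto
  have l2: "\<forall>k\<in>set (conv g h # gs). linear k" using lin by (auto intro: linear_conv)
  have l3: "\<forall>k\<in>set (\<Delta> # replicate (length gs) embed). linear k"
    using linear_coproduct linear_embed by auto
  show "linear (mult_map (conv g h # gs))" by (rule linear_mult_map[OF l2])
  show "linear (\<lambda>a. mult_map (g # h # gs) (tensor_map (\<Delta> # replicate (length gs) embed) a))"
    by (rule linear_compose'[OF linear_mult_map[OF l1] linear_tensor_map[OF l3]])
  fix xs :: "'a list"
  show "mult_map (g # h # gs) (tensor_map (\<Delta> # replicate (length gs) embed) (pure_tensor xs)) =
    mult_map (conv g h # gs) (pure_tensor xs)"
  proof (cases "length xs = Suc (length gs)")
    case False
    then show ?thesis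
      by (simp add: tensor_map_pure[OF l3] mult_map_pure[OF l2] linear_0[OF linear_mult_map[OF l1]])
  next
    case True
    then obtain x ys where xs: "xs = x # ys" and len: "length ys = length gs" by (cases xs) auto
    obtain L where L: "\<Delta> x = (\<Sum>(a, b)\<leftarrow>L. pure_tensor [a, b])" by (rule coproduct_repr)
    have "mult_map (g # h # gs) (tensor_append (\<Delta> x) (pure_tensor ys)) =
      (\<Sum>p\<leftarrow>L. g (fst p) * (h (snd p) * prod_list (map2 (\<lambda>f x. f x) gs ys)))"
      by (simp add: L case_prod_unfold linear_sum_list[OF linear_tensor_append_left]
        linear_sum_list[OF linear_mult_map[OF l1]] mult_map_pure[OF l1] len)
    also have "\<dots> = conv g h x * prod_list (map2 (\<lambda>f x. f x) gs ys)"
      by (simp add: conv_def cop_eq[OF bilinear_mult[OF lin(1,2)] L] case_prod_unfold mult.assoc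
        flip: sum_list_mult_const)
    also have "\<dots> = mult_map (conv g h # gs) (pure_tensor xs)"
      by (simp add: mult_map_pure[OF l2] xs len)
    finally show ?thesis by (simp add: xs tensor_map_Cons_embeds linear_coproduct len)
  qed
qed

text \<open>The outermost coproduct merges the first two maps into their convolution, which shortens
  the list; associativity then restores the nesting of \<open>convs\<close>.\<close>

lemma mult_map_iterated_coproduct:
  "\<forall>g\<in>set gs. linear g \<Longrightarrow> mult_map gs (iterated_coproduct \<Delta> \<epsilon> (length gs) x) = convs gs x"
proof (induction "length gs" arbitrary: gs rule: less_induct)
  case less
  consider "gs = []" | g where "gs = [g]" | g h hs where "gs = g # h # hs"
    by (metis list.exhaust)
  then show ?case
  proof cases
    case 1
    then show ?thesis
      by (simp add: linear_scale[OF linear_mult_map] mult_map_pure)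
  next
    case 2
    then show ?thesis using less.prems by (simp add: mult_map_pure conv_unit_right)
  next
    case 3
    have lin: "\<forall>k\<in>set (conv g h # hs). linear k"
      using less.prems by (auto simp: 3 intro: linear_conv)
    have "mult_map gs (iterated_coproduct \<Delta> \<epsilon> (length gs) x) =
        mult_map (conv g h # hs) (iterated_coproduct \<Delta> \<epsilon> (length (conv g h # hs)) x)"
      using less.prems by (simp add: 3 mult_map_coproduct)
    also have "\<dots> = convs (conv g h # hs) x"
      by (rule less.hyps) (use lin in \<open>auto simp: 3\<close>)
    also have "\<dots> = convs gs x"
      using less.prems by (simp add: 3 conv_assoc linear_convs)
    finally show ?thesis .
  qed
qed

text \<open>The operators become convolution products of the projections \<open>pr d\<close>, so
  that from here on tensors of length above 2 need not be handled.\<close>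

lemma mDelta_eq_convs: "mDelta H \<Delta> \<epsilon> D x = convs (map pr D) x"
proof -
  have l: "\<forall>g\<in>set (map pr D). linear g" using linear_pr by auto
  have l': "\<forall>g\<in>set (map (\<lambda>d a. embed (pr d a)) D). linear g"
    using linear_compose'[OF linear_embed linear_pr] by auto
  have "mult_all (tensor_map (map (\<lambda>d a. embed (pr d a)) D) t) = mult_map (map pr D) t" for t
  proof (rule linear_eq_on_pure[where t = t])
    show "linear (mult_map (map pr D))" by (rule linear_mult_map[OF l])
    show "linear (\<lambda>a. mult_all (tensor_map (map (\<lambda>d a. embed (pr d a)) D) a))"
      by (rule linear_compose'[OF linear_mult_all linear_tensor_map[OF l']])
    fix xs :: "'a list"
    show "mult_all (tensor_map (map (\<lambda>d a. embed (pr d a)) D) (pure_tensor xs)) = mult_map (map pr D) (pure_tensor xs)"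
    proof (cases "length xs = length D")
      case True
      then show ?thesis
        using tensor_map_embed_maps[of "map pr D" xs] by (simp add: mult_map_pure[OF l] o_def l)
    next
      case False
      then show ?thesis
        by (simp add: tensor_map_pure[OF l'] mult_map_pure[OF l] linear_0[OF linear_mult_all])
    qed
  qed
  then show ?thesis
    unfolding mDelta_def refined_coproduct_def
    using mult_map_iterated_coproduct[of "map pr D"] l by simp
qed

end

section \<open>The coradical filtration\<close>

text \<open>A basis of one subspace is extended to the next. The earlier parts keep spanning,
  because an extension only adds vectors.\<close>

lemma adapted_basis:
  assumes "\<And>i. subspace (V i :: 'v::real_vector set)" "\<And>i. V i \<subseteq> V (Suc i)"
  obtains B where "independent B" "B \<subseteq> V r" "\<And>i. i \<le> r \<Longrightarrow> span (B \<inter> V i) = V i"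
proof -
  have "\<exists>B. independent B \<and> B \<subseteq> V r \<and> (\<forall>i\<le>r. span (B \<inter> V i) = V i)"
  proof (induction r)
    case 0
    obtain B where "B \<subseteq> V 0" "independent B" "V 0 \<subseteq> span B"
      using maximal_independent_subset[of "V 0"] by blast
    moreover from this have "span (B \<inter> V 0) = V 0"
      using assms(1) by (metis Int_absorb2 span_eq_iff span_mono subset_antisym)
    ultimately show ?case by blast
  next
    case (Suc r)
    then obtain B where B: "independent B" "B \<subseteq> V r" "\<And>i. i \<le> r \<Longrightarrow> span (B \<inter> V i) = V i" by blast
    have "B \<subseteq> V (Suc r)" using B(2) assms(2) by (rule subset_trans)
    then obtain C where C: "B \<subseteq> C" "C \<subseteq> V (Suc r)" "independent C" "V (Suc r) \<subseteq> span C"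
      by (rule maximal_independent_subset_extend[OF _ B(1)])
    have "span (C \<inter> V i) = V i" if "i \<le> Suc r" for i
    proof (cases "i = Suc r")
      case True
      then show ?thesis
        using C assms(1) by (metis Int_absorb2 span_eq_iff span_mono subset_antisym)
    next
      case False
      then have "V i = span (B \<inter> V i)" using that B(3) by simp
      also have "\<dots> \<subseteq> span (C \<inter> V i)" using C(1) by (intro span_mono) blast
      finally have "V i \<subseteq> span (C \<inter> V i)" .
      moreover have "span (C \<inter> V i) \<subseteq> V i" using assms(1) by (metis inf_le2 span_minimal)
      ultimately show ?thesis by blast
    qed
    with C show ?case by blast
  qed
  then show ?thesis using that by blast
qed

lemma dual_basis:
  fixes B :: "'v::real_vector set"
  assumes "finite B" "independent B"
  obtains \<phi> :: "'v::real_vector \<Rightarrow> 'v \<Rightarrow> real" where "\<And>e. linear (\<phi> e)"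
    "\<And>e e'. e \<in> B \<Longrightarrow> e' \<in> B \<Longrightarrow> \<phi> e e' = (if e' = e then 1 else 0)"
    "\<And>v. v \<in> span B \<Longrightarrow> v = (\<Sum>e\<in>B. \<phi> e v *\<^sub>R e)"
proof -
  have "\<forall>e. \<exists>f. linear f \<and> (\<forall>e'\<in>B. f e' = (if e' = e then 1 else 0 :: real))"
    by (intro allI linear_independent_extend[OF assms(2)])
  then have "\<exists>\<phi>. \<forall>e. linear (\<phi> e) \<and> (\<forall>e'\<in>B. \<phi> e e' = (if e' = e then 1 else 0 :: real))"
    by (rule choice)
  then obtain \<phi> where \<phi>: "\<And>e. linear (\<phi> e)" "\<And>e e'. e' \<in> B \<Longrightarrow> \<phi> e e' = (if e' = e then 1 else 0 :: real)"
    by blast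
  have "v = (\<Sum>e\<in>B. \<phi> e v *\<^sub>R e)" if "v \<in> span B" for v
  proof (rule linear_eq_on_span[OF linear_ident _ _ that])
    show "linear (\<lambda>v. \<Sum>e\<in>B. \<phi> e v *\<^sub>R e)"
      by (intro linear_compose_sum ballI linear_scaleR_vec \<phi>(1))
    show "x = (\<Sum>e\<in>B. \<phi> e x *\<^sub>R e)" if "x \<in> B" for x
    proof -
      have "(\<Sum>e\<in>B. \<phi> e x *\<^sub>R e) = (\<Sum>e\<in>B. if x = e then e else 0)"
        by (rule sum.cong) (auto simp: \<phi>(2)[OF that])
      also have "\<dots> = x" using assms(1) that by simp
      finally show ?thesis by simp
    qed
  qed
  then show ?thesis using that[of \<phi>] \<phi> by blast
qed

context graded_connected_hopf_algebra
begin

lemma cop_in_subspace: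
  assumes "bilinear \<beta>" "subspace Q" "\<Delta> x = (\<Sum>(a, b)\<leftarrow>L. pure_tensor [a, b])"
    "\<And>a b. (a, b) \<in> set L \<Longrightarrow> \<beta> a b \<in> Q"
  shows "cop \<beta> x \<in> Q"
  unfolding cop_eq[OF assms(1,3)] by (rule sum_list_in_subspace[OF assms(2)]) (use assms(4) in auto)

lemma cop_H_zero:
  assumes "bilinear \<beta>" "x \<in> H n" "\<And>i a b. i \<le> n \<Longrightarrow> a \<in> H i \<Longrightarrow> b \<in> H (n - i) \<Longrightarrow> \<beta> a b = 0"
  shows "cop \<beta> x = 0"
proof -
  obtain L where "\<Delta> x = (\<Sum>(a, b)\<leftarrow>L. pure_tensor [a, b])"
    "\<And>a b. (a, b) \<in> set L \<Longrightarrow> \<exists>j\<le>n. a \<in> H j \<and> b \<in> H (n - j)"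
    using coproduct_repr_H[OF assms(2)] by metis
  then have "cop \<beta> x \<in> {0}" using assms(3)
    by (intro cop_in_subspace[OF assms(1) subspace_single_0]) blast+
  then show ?thesis by simp
qed

definition hom_functional :: "nat \<Rightarrow> ('a \<Rightarrow> real) \<Rightarrow> bool" where
  "hom_functional c f \<longleftrightarrow> linear f \<and> (\<forall>j x. x \<in> H j \<longrightarrow> j \<noteq> c \<longrightarrow> f x = 0)"

text \<open>The homogeneous elements of positive degree in the graded dual. Homogeneity is kept
  under convolution, so a product of such functionals can be tested on a single graded
  component.\<close>

definition J :: "('a \<Rightarrow> real) set" where
  "J = {f. \<exists>c>0. hom_functional c f}"

lemma linear_J: "f \<in> J \<Longrightarrow> linear f"
  by (auto simp: J_def hom_functional_def)

lemma H_0_eq: "x \<in> H 0 \<Longrightarrow> x = \<epsilon> x *\<^sub>R 1"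
  using linear_scale[OF linear_counit] by (auto simp: connected span_singleton counit_one)

lemma J_H_0: "f \<in> J \<Longrightarrow> x \<in> H 0 \<Longrightarrow> f x = 0"
  by (auto simp: J_def hom_functional_def)

lemma hom_functional_counit: "hom_functional 0 \<epsilon>"
  by (auto simp: hom_functional_def linear_counit counit_in_H)

lemma hom_functional_conv:
  assumes "hom_functional c f" "hom_functional d g"
  shows "hom_functional (c + d) (conv f g)"
proof -
  have lin: "linear f" "linear g" using assms by (auto simp: hom_functional_def)
  have "conv f g x = 0" if "x \<in> H j" "j \<noteq> c + d" for x j
    unfolding conv_def
  proof (rule cop_H_zero[OF bilinear_mult[OF lin] that(1)])
    fix i a b assume *: "i \<le> j" "a \<in> H i" "b \<in> H (j - i)"
    then have "i \<noteq> c \<or> j - i \<noteq> d" using that(2) by auto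
    then show "f a * g b = 0" using assms * by (auto simp: hom_functional_def)
  qed
  then show ?thesis using linear_conv[OF lin] by (auto simp: hom_functional_def)
qed

lemma hom_functional_pr: "hom_functional c f \<Longrightarrow> f (pr c x) = f x"
proof (rule H_induct)
  assume c: "hom_functional c f"
  then have f: "linear f" by (simp add: hom_functional_def)
  then show "linear (\<lambda>x. f (pr c x))" "linear f" by (auto intro: linear_compose'[OF _ linear_pr])
  show "f (pr c x) = f x" if "x \<in> H i" for x i
    using c that linear_0[OF f] by (auto simp: pr_H hom_functional_def)
qed

lemma convs_J:
  "set w \<subseteq> J \<Longrightarrow> \<exists>c. hom_functional c (convs w)"
proof (induction w)
  case Nil
  show ?case using hom_functional_counit by auto
next
  case (Cons f w)
  then obtain c d where "hom_functional c f" "hom_functional d (convs w)" by (auto simp: J_def)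
  from hom_functional_conv[OF this] show ?case by auto
qed

lemma linear_convs_J: "set w \<subseteq> J \<Longrightarrow> linear (convs w)"
  using linear_J by (intro linear_convs) blast

lemma bilinear_convs: "f \<in> J \<Longrightarrow> set w \<subseteq> J \<Longrightarrow> bilinear (\<lambda>a b. f a * convs w b)"
  by (intro bilinear_mult linear_J linear_convs_J)

text \<open>A functional in \<open>J\<close> kills \<open>H 0\<close>, so every factor uses up at
  least one unit of degree. Hence elements of degree \<open>n\<close> have weight at most
  \<open>n\<close>.\<close>

lemma convs_vanish: "set w \<subseteq> J \<Longrightarrow> x \<in> H n \<Longrightarrow> n < length w \<Longrightarrow> convs w x = 0"
proof (induction w arbitrary: n x)
  case (Cons f w)
  have "bilinear (\<lambda>a b. f a * convs w b)" using Cons.prems by (intro bilinear_convs) auto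
  then show ?case unfolding convs_Cons conv_def
  proof (rule cop_H_zero[OF _ Cons.prems(2)])
    fix i a b assume *: "i \<le> n" "a \<in> H i" "b \<in> H (n - i)"
    show "f a * convs w b = 0"
    proof (cases "i = 0")
      case True
      then show ?thesis using J_H_0 * Cons.prems(1) by auto
    next
      case False
      then have "n - i < length w" using * Cons.prems(3) by auto
      then show ?thesis using Cons.IH[OF _ *(3)] Cons.prems(1) by auto
    qed
  qed
qed simp

text \<open>\<open>E (Suc k) n\<close> is the degree \<open>n\<close> part of the \<open>k\<close>-th term of the coradical filtration; the
  shift of the index makes \<open>E 0 n\<close> the zero space.\<close>

definition E :: "nat \<Rightarrow> nat \<Rightarrow> 'a set" where
  "E k n = {x \<in> H n. \<forall>w. set w \<subseteq> J \<longrightarrow> k \<le> length w \<longrightarrow> convs w x = 0}"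

abbreviation F :: "nat \<Rightarrow> nat \<Rightarrow> 'a set" where "F k \<equiv> E (Suc k)"

lemma E_H: "x \<in> E k n \<Longrightarrow> x \<in> H n"
  by (simp add: E_def)

lemma subspace_E: "subspace (E k n)"
  unfolding subspace_def
  using subspace_0[OF subspace_H] subspace_add[OF subspace_H] subspace_scale[OF subspace_H]
  by (auto simp: E_def linear_0[OF linear_convs_J] linear_add[OF linear_convs_J] linear_scale[OF linear_convs_J])

lemma E_mono: "k \<le> l \<Longrightarrow> E k n \<subseteq> E l n"
  by (auto simp: E_def)

lemma F_mono: "x \<in> F k n \<Longrightarrow> k \<le> l \<Longrightarrow> x \<in> F l n"
  using E_mono[of "Suc k" "Suc l"] by auto

lemma H_subset_F: "x \<in> H n \<Longrightarrow> x \<in> F n n"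
  by (auto simp: E_def intro: convs_vanish)

lemma F_0_eq:
  assumes "x \<in> F 0 n" "n > 0"
  shows "x = 0"
proof (rule ccontr)
  assume "x \<noteq> 0"
  then obtain f :: "'a \<Rightarrow> real" where f: "linear f" "f x = 1"
    using linear_separation[of x "{0}"] by auto
  \<comment> \<open>Precomposing with the projection makes the separating functional homogeneous of
    positive degree.\<close>
  have "hom_functional n (\<lambda>x. f (pr n x))"
    by (auto simp: hom_functional_def pr_H linear_0[OF f(1)] intro: linear_compose'[OF f(1) linear_pr])
  then have J: "(\<lambda>x. f (pr n x)) \<in> J" using assms(2) by (auto simp: J_def)
  moreover have "\<forall>w. set w \<subseteq> J \<longrightarrow> Suc 0 \<le> length w \<longrightarrow> convs w x = 0" using assms(1) by (simp add: E_def)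
  ultimately have "convs [\<lambda>x. f (pr n x)] x = 0" by (auto dest: spec[of _ "[\<lambda>x. f (pr n x)]"])
  then have "f (pr n x) = 0" using conv_unit_right[OF linear_J[OF J]] by simp
  then show False using f pr_H E_H[OF assms(1)] by simp
qed

lemma E_0_eq:
  assumes "x \<in> E 0 n"
  shows "x = 0"
proof (cases "n = 0")
  case True
  \<comment> \<open>The empty word acts as the counit, and \<open>H 0\<close> is spanned by
    1.\<close>
  have "\<epsilon> x = 0" using assms unfolding E_def by (auto dest: spec[of _ "[]"])
  with True show ?thesis using H_0_eq[of x] E_H[OF assms] by simp
next
  case False
  then show ?thesis using assms F_0_eq E_mono[of 0 1] by force
qed

lemma one_in_F [simp]: "1 \<in> F k 0"
  using H_subset_F[OF one_in_H] F_mono by blast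

end

section \<open>Compatibility of the coradical filtration with coproduct and product\<close>

locale graded_connected_hopf_algebra_fd = graded_connected_hopf_algebra +
  assumes findim: "\<And>i. finite_dimensional (H i)"
begin

lemma finite_independent_H: "independent B \<Longrightarrow> B \<subseteq> H n \<Longrightarrow> finite B"
  using findim[of n] by (auto simp: finite_dimensional_def dest: independent_span_bound)

text \<open>The left legs are expanded in a basis adapted to the filtration of each degree, so that
  \<Delta> x is the sum of e \<otimes> y_e. If e lies outside E i, its dual functional vanishes on E
  i. Contracting the right legs with a word w' of length more than k - i leaves an element z whose
  component in the degree of e is killed by all words of length at least i, since the concatenated
  word has length more than k. So this component lies in E i and the functional kills it, which says
  that w' vanishes on y_e. The level of y_e is therefore at most k minus the level of e.\<close>

lemma coproduct_F:
  assumes x: "x \<in> F k n"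
  obtains L where "\<Delta> x = (\<Sum>(a, b)\<leftarrow>L. pure_tensor [a, b])"
    "\<And>a b. (a, b) \<in> set L \<Longrightarrow> \<exists>i\<le>k. \<exists>m\<le>n. a \<in> F i m \<and> b \<in> F (k - i) (n - m)"
proof -
  have xH: "x \<in> H n" using x by (rule E_H)
  obtain L0 where L0: "\<Delta> x = (\<Sum>(a, b)\<leftarrow>L0. pure_tensor [a, b])"
    "\<And>a b. (a, b) \<in> set L0 \<Longrightarrow> \<exists>j\<le>n. a \<in> H j \<and> b \<in> H (n - j)"
    using coproduct_repr_H[OF xH] by metis
  have "\<exists>B. independent B \<and> B \<subseteq> E (Suc m) m \<and> (\<forall>i\<le>Suc m. span (B \<inter> E i m) = E i m)" for m
    by (rule adapted_basis[of "\<lambda>i. E i m" "Suc m"]) (use subspace_E E_mono in auto)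
  then obtain B where B: "\<And>m. independent (B m)" "\<And>m. B m \<subseteq> E (Suc m) m"
    "\<And>m i. i \<le> Suc m \<Longrightarrow> span (B m \<inter> E i m) = E i m" by metis
  have BH: "B m \<subseteq> H m" for m using B(2) E_H by blast
  have fin: "finite (B m)" for m using finite_independent_H[OF B(1) BH] .
  have spanB: "H m = span (B m)" for m
    using B(3)[of "Suc m" m] B(2)[of m] H_subset_F[of _ m] E_H by (auto simp: Int_absorb2)
  have "\<exists>\<phi>. (\<forall>e. linear (\<phi> e)) \<and> (\<forall>e e'. e \<in> B m \<longrightarrow> e' \<in> B m \<longrightarrow> \<phi> e e' = (if e' = e then 1 else 0 :: real)) \<and>
      (\<forall>v\<in>H m. v = (\<Sum>e\<in>B m. \<phi> e v *\<^sub>R e))" for m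
  proof (rule dual_basis[OF fin[of m] B(1)[of m]])
    fix \<phi> :: "'a \<Rightarrow> 'a \<Rightarrow> real"
    assume "\<And>e. linear (\<phi> e)" "\<And>e e'. e \<in> B m \<Longrightarrow> e' \<in> B m \<Longrightarrow> \<phi> e e' = (if e' = e then 1 else 0)"
      "\<And>v. v \<in> span (B m) \<Longrightarrow> v = (\<Sum>e\<in>B m. \<phi> e v *\<^sub>R e)"
    then show ?thesis unfolding spanB by (intro exI[of _ \<phi>]) blast
  qed
  then obtain \<phi> where \<phi>: "\<And>m e. linear (\<phi> m e)"
    "\<And>m e e'. e \<in> B m \<Longrightarrow> e' \<in> B m \<Longrightarrow> \<phi> m e e' = (if e' = e then 1 else 0 :: real)"
    "\<And>m v. v \<in> H m \<Longrightarrow> v = (\<Sum>e\<in>B m. \<phi> m e v *\<^sub>R e)" by metis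
  define \<psi> where "\<psi> m e a = \<phi> m e (pr m a)" for m e a
  have \<psi>: "linear (\<psi> m e)" for m e unfolding \<psi>_def[abs_def] by (rule linear_compose'[OF \<phi>(1) linear_pr])
  \<comment> \<open>The right leg that belongs to the basis element \<open>e\<close> of degree
    \<open>m\<close> on the left.\<close>
  define y where "y m e = cop (\<lambda>a b. \<psi> m e a *\<^sub>R b) x" for m e
  have bil: "bilinear (\<lambda>a b. \<psi> m e a *\<^sub>R b)" for m e
    by (intro bilinearI linear_scaleR_vec linear_scaleR_real linear_ident \<psi>)
  have y_eq: "y m e = (\<Sum>(a, b)\<leftarrow>L0. \<psi> m e a *\<^sub>R b)" for m e
    unfolding y_def by (rule cop_eq[OF bil L0(1)])
  have yH: "y m e \<in> H (n - m)" if "m \<le> n" for m e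
    unfolding y_def
  proof (rule cop_in_subspace[OF bil subspace_H L0(1)])
    fix a b assume "(a, b) \<in> set L0"
    then obtain j where j: "j \<le> n" "a \<in> H j" "b \<in> H (n - j)" using L0(2) by blast
    show "\<psi> m e a *\<^sub>R b \<in> H (n - m)"
      using j subspace_scale[OF subspace_H j(3)] linear_0[OF \<phi>(1)]
      by (cases "j = m") (auto simp: \<psi>_def pr_H)
  qed
  have pure: "pure_tensor [a, b] = (\<Sum>m\<le>n. \<Sum>e\<in>B m. pure_tensor [e, \<psi> m e a *\<^sub>R b])" if ab: "(a, b) \<in> set L0" for a b
  proof -
    obtain j where j: "j \<le> n" "a \<in> H j" "b \<in> H (n - j)" using L0(2)[OF ab] by blast
    have l1: "linear (\<lambda>b. pure_tensor [e, b])" and l2: "linear (\<lambda>a. pure_tensor [a, b])" for e b :: 'a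
      using linear_pure_tensor[of "[e]" "[]"] linear_pure_tensor[of "[]" "[b]"] by auto
    have "(\<Sum>m\<le>n. \<Sum>e\<in>B m. pure_tensor [e, \<psi> m e a *\<^sub>R b]) = (\<Sum>m\<le>n. if m = j then pure_tensor [a, b] else 0)"
    proof (rule sum.cong[OF refl])
      fix m
      show "(\<Sum>e\<in>B m. pure_tensor [e, \<psi> m e a *\<^sub>R b]) = (if m = j then pure_tensor [a, b] else 0)"
      proof (cases "m = j")
        case True
        have "pure_tensor [a, b] = pure_tensor [\<Sum>e\<in>B j. \<phi> j e a *\<^sub>R e, b]" 
          by (rule arg_cong[OF \<phi>(3)[OF j(2)], of "\<lambda>a. pure_tensor [a, b]"])
        also have "\<dots> = (\<Sum>e\<in>B j. pure_tensor [e, \<phi> j e a *\<^sub>R b])"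
          by (simp add: linear_sum[OF l2] linear_scale[OF l2] linear_scale[OF l1])
        finally show ?thesis using True j(2) by (simp add: \<psi>_def pr_H)
      next
        case False
        then show ?thesis using j(2) linear_0[OF \<phi>(1)] linear_0[OF l1] by (simp add: \<psi>_def pr_H)
      qed
    qed
    also have "\<dots> = pure_tensor [a, b]" using j(1) by simp
    finally show ?thesis by simp
  qed
  have lin2: "linear (\<lambda>b. pure_tensor [e, b])" for e :: 'a
    using linear_pure_tensor[of "[e]" "[]"] by simp
  have "\<Delta> x = (\<Sum>p\<leftarrow>L0. \<Sum>m\<le>n. \<Sum>e\<in>B m. pure_tensor [e, \<psi> m e (fst p) *\<^sub>R snd p])"
    unfolding L0(1) by (rule arg_cong[of _ _ sum_list], rule map_cong) (auto simp: pure)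
  also have "\<dots> = (\<Sum>m\<le>n. \<Sum>e\<in>B m. \<Sum>p\<leftarrow>L0. pure_tensor [e, \<psi> m e (fst p) *\<^sub>R snd p])"
    by (simp add: sum_list_sum_swap)
  also have "\<dots> = (\<Sum>m\<le>n. \<Sum>e\<in>B m. pure_tensor [e, y m e])"
    by (simp add: y_eq case_prod_unfold linear_sum_list[OF lin2])
  finally have \<Delta>x: "\<Delta> x = (\<Sum>m\<le>n. \<Sum>e\<in>B m. pure_tensor [e, y m e])" .

  have vanish: "convs w' (y m e) = 0"
    if m: "m \<le> n" "e \<in> B m" and e: "e \<notin> E i m" "i \<le> Suc m" and w': "set w' \<subseteq> J" "length w' + i > k" for m e i w'
  proof -
    \<comment> \<open>The other contraction: \<open>w'\<close> on the right leg leaves an element on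
      the left. Both orders of contraction agree, so
      \<open>convs w' (y m e) = \<psi> m e z\<close>.\<close>
    define z where "z = cop (\<lambda>a b. convs w' b *\<^sub>R a) x"
    have bil': "bilinear (\<lambda>a b. convs w' b *\<^sub>R a)"
      by (intro bilinearI linear_scaleR_vec linear_scaleR_real linear_ident linear_convs_J[OF w'(1)])
    have z_eq: "z = (\<Sum>(a, b)\<leftarrow>L0. convs w' b *\<^sub>R a)" unfolding z_def by (rule cop_eq[OF bil' L0(1)])
    have "convs w' (y m e) = \<psi> m e z"
      by (simp add: y_eq z_eq case_prod_unfold linear_sum_list[OF linear_convs_J[OF w'(1)]]
          linear_scale[OF linear_convs_J[OF w'(1)]] linear_sum_list[OF \<psi>] linear_scale[OF \<psi>] mult.commute)
    moreover have "convs w (pr m z) = 0" if w: "set w \<subseteq> J" "i \<le> length w" for w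
    proof -
      obtain c where c: "hom_functional c (convs w)" using convs_J[OF w(1)] by blast
      show ?thesis
      proof (cases "c = m")
        case True
        have lw: "\<forall>g\<in>set (w @ w'). linear g" using w w' linear_J by auto
        have "convs w (pr m z) = convs w z" using hom_functional_pr c True by blast
        also have "\<dots> = conv (convs w) (convs w') x"
          unfolding conv_def cop_eq[OF bilinear_mult[OF linear_convs_J[OF w(1)] linear_convs_J[OF w'(1)]] L0(1)]
          by (simp add: z_eq case_prod_unfold linear_sum_list[OF linear_convs_J[OF w(1)]]
              linear_scale[OF linear_convs_J[OF w(1)]] mult.commute)
        also have "\<dots> = convs (w @ w') x" by (simp add: convs_append[OF lw])
        also have "\<dots> = 0" using x w w' by (auto simp: E_def)
        finally show ?thesis .
      next
        case False
        then show ?thesis using c pr_in_H[of m z] unfolding hom_functional_def by blast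
      qed
    qed
    then have "pr m z \<in> E i m" by (auto simp: E_def)
    then have "pr m z \<in> span (B m \<inter> E i m)" using B(3) e(2) by blast
    then have "\<phi> m e (pr m z) = 0"
      by (rule linear_eq_0_on_span[OF \<phi>(1), rotated]) (use e(1) \<phi>(2) m in auto)
    ultimately show ?thesis by (simp add: \<psi>_def)
  qed

  have lev: "\<exists>i\<le>k. e \<in> F i m \<and> y m e \<in> F (k - i) (n - m)" if m: "m \<le> n" "e \<in> B m" "y m e \<noteq> 0" for m e
  proof -
    \<comment> \<open>\<open>i\<close> is the exact level of \<open>e\<close>. Hence
      \<open>e\<close> is outside \<open>E i m\<close>; for \<open>i = 0\<close> this says that
      \<open>e\<close> is nonzero.\<close>
    define i where "i = (LEAST i. e \<in> F i m)"
    have eF: "e \<in> F m m" using B(2) m by blast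
    then have i: "e \<in> F i m" "i \<le> m" unfolding i_def by (rule LeastI, rule Least_le)
    have "e \<noteq> 0" using B(1) m(2) dependent_zero by blast
    have ne: "e \<notin> E i m"
    proof (cases i)
      case 0
      then show ?thesis using E_0_eq \<open>e \<noteq> 0\<close> by blast
    next
      case (Suc i')
      then show ?thesis using not_less_Least[of i' "\<lambda>i. e \<in> F i m"] by (simp add: i_def)
    qed
    have v: "convs w' (y m e) = 0" if "set w' \<subseteq> J" "length w' + i > k" for w'
      by (rule vanish[OF m(1,2) ne]) (use i that in auto)
    have "i \<le> k"
    proof (rule ccontr)
      assume "\<not> i \<le> k"
      then have "y m e \<in> E 0 (n - m)" using v yH[OF m(1)] by (auto simp: E_def)
      then show False using E_0_eq m(3) by blast
    qed
    moreover have "y m e \<in> F (k - i) (n - m)" using v yH[OF m(1)] \<open>i \<le> k\<close> by (auto simp: E_def)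
    ultimately show ?thesis using i by blast
  qed
  obtain Bl where Bl: "\<And>m. set (Bl m) = B m" "\<And>m. distinct (Bl m)"
    using finite_distinct_list[OF fin] by metis
  \<comment> \<open>Pairs with right leg 0 are dropped, as there the level of the left leg may
    exceed \<open>k\<close>.\<close>
  define L where "L = filter (\<lambda>p. snd p \<noteq> 0) (concat (map (\<lambda>m. map (\<lambda>e. (e, y m e)) (Bl m)) [0..<Suc n]))"
  have filt: "(\<Sum>p\<leftarrow>filter (\<lambda>p. snd p \<noteq> 0) M. pure_tensor [fst p, snd p]) = (\<Sum>p\<leftarrow>M. pure_tensor [fst p, snd p])"
    for M :: "('a \<times> 'a) list"
    by (induction M) (auto simp: linear_0[OF lin2])
  have "(\<Sum>(a, b)\<leftarrow>L. pure_tensor [a, b]) = (\<Sum>p\<leftarrow>L. pure_tensor [fst p, snd p])"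
    by (simp add: case_prod_unfold)
  also have "\<dots> = (\<Sum>m\<leftarrow>[0..<Suc n]. \<Sum>e\<leftarrow>Bl m. pure_tensor [e, y m e])"
    unfolding L_def filt by (simp add: sum_list_concat_map o_def del: upt_Suc)
  also have "\<dots> = \<Delta> x"
    unfolding \<Delta>x by (simp add: sum_list_distinct_conv_sum_set Bl atLeast0LessThan lessThan_Suc_atMost del: upt_Suc)
  finally show ?thesis using that[of L] lev Bl
    by (fastforce simp: L_def less_Suc_eq_le simp del: upt_Suc)
qed

lemma cop_mult_repr:
  assumes "bilinear \<beta>" "\<Delta> x = (\<Sum>(a, b)\<leftarrow>L. pure_tensor [a, b])" "\<Delta> y = (\<Sum>(a, b)\<leftarrow>L'. pure_tensor [a, b])"
  shows "cop \<beta> (x * y) = (\<Sum>p\<leftarrow>L. \<Sum>q\<leftarrow>L'. \<beta> (fst p * fst q) (snd p * snd q))"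
  unfolding cop_mult[OF assms(1)]
  by (subst cop_eq[OF bilinear_cop_mult(1)[OF assms(1)] assms(2)])
    (simp add: cop_eq[OF bilinear_cop_mult(2)[OF assms(1)] assms(3)] case_prod_unfold)

lemma F_0_subset_H_0: "x \<in> F 0 m \<Longrightarrow> x \<in> H 0"
  using F_0_eq[of x m] E_H[of x 1 m] by (cases "m = 0") auto

text \<open>If the first legs have total level 0, they are scalars and \<open>f\<close> kills their
  product. Otherwise the second legs have total level at most \<open>k + l - 1\<close>, still below
  the number of remaining functionals.\<close>

lemma convs_mult_vanish:
  "set w \<subseteq> J \<Longrightarrow> k + l < length w \<Longrightarrow> x \<in> F k n \<Longrightarrow> y \<in> F l m \<Longrightarrow> convs w (x * y) = 0"
proof (induction w arbitrary: k l n m x y)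
  case (Cons f w)
  obtain L where L: "\<Delta> x = (\<Sum>(a, b)\<leftarrow>L. pure_tensor [a, b])"
    "\<And>a b. (a, b) \<in> set L \<Longrightarrow> \<exists>i\<le>k. \<exists>m\<le>n. a \<in> F i m \<and> b \<in> F (k - i) (n - m)"
    using coproduct_F[OF Cons.prems(3)] by metis
  obtain L' where L': "\<Delta> y = (\<Sum>(a, b)\<leftarrow>L'. pure_tensor [a, b])"
    "\<And>a b. (a, b) \<in> set L' \<Longrightarrow> \<exists>i\<le>l. \<exists>m'\<le>m. a \<in> F i m' \<and> b \<in> F (l - i) (m - m')"
    using coproduct_F[OF Cons.prems(4)] by metis
  have fJ: "f \<in> J" "set w \<subseteq> J" using Cons.prems by auto
  have "f (a * a') * convs w (b * b') = 0" if p: "(a, b) \<in> set L" and q: "(a', b') \<in> set L'" for a b a' b'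
  proof -
    obtain i j where i: "i \<le> k" "a \<in> F i j" "b \<in> F (k - i) (n - j)" using L(2)[OF p] by blast
    obtain i' j' where i': "i' \<le> l" "a' \<in> F i' j'" "b' \<in> F (l - i') (m - j')" using L'(2)[OF q] by blast
    show ?thesis
    proof (cases "i + i' = 0")
      case True
      then have "a * a' \<in> H (0 + 0)" using i i' F_0_subset_H_0 by (intro mult_in_H) auto
      then show ?thesis using J_H_0[OF fJ(1)] by simp
    next
      case False
      then have "convs w (b * b') = 0"
        using i i' Cons.prems(2) by (intro Cons.IH[OF fJ(2) _ i(3) i'(3)]) auto
      then show ?thesis by simp
    qed
  qed
  then have "(\<Sum>p\<leftarrow>L. \<Sum>q\<leftarrow>L'. f (fst p * fst q) * convs w (snd p * snd q)) = (\<Sum>p\<leftarrow>L. \<Sum>q\<leftarrow>L'. 0)"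
    by (intro sum_list_cong) auto
  then show ?case
    unfolding convs_Cons conv_def cop_mult_repr[OF bilinear_convs[OF fJ] L(1) L'(1)] by simp
qed simp

lemma F_mult:
  assumes "x \<in> F k n" "y \<in> F l m"
  shows "x * y \<in> F (k + l) (n + m)"
  using mult_in_H[OF E_H[OF assms(1)] E_H[OF assms(2)]] convs_mult_vanish[OF _ _ assms]
  by (simp add: E_def[of "Suc (k + l)"] Suc_le_eq)

text \<open>For \<open>k > 0\<close> the space \<open>E k n\<close> is \<open>F (k - 1) n\<close>;
  for \<open>k = 0\<close> the factor \<open>x\<close> is 0.\<close>

lemma E_F_mult: "x \<in> E k n \<Longrightarrow> y \<in> F l m \<Longrightarrow> x * y \<in> E (k + l) (n + m)"
  using F_mult[of x "k - 1" n y l m] E_0_eq[of x n] subspace_0[OF subspace_E] by (cases k) auto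

lemma F_E_mult: "x \<in> F k n \<Longrightarrow> y \<in> E l m \<Longrightarrow> x * y \<in> E (k + l) (n + m)"
  using F_mult[of x k n y "l - 1" m] E_0_eq[of y m] subspace_0[OF subspace_E] by (cases l) auto

text \<open>With exactly \<open>k + l\<close> functionals, \<open>f\<close> singles out first legs
  of total level 1: at level 0 it vanishes, and from level 2 on the remaining functionals outnumber
  the level that is left. At level 1 one of the two first legs is a scalar, so they commute, and
  induction handles the second legs.\<close>

lemma convs_mult_commute:
  "set w \<subseteq> J \<Longrightarrow> length w = k + l \<Longrightarrow> x \<in> F k n \<Longrightarrow> y \<in> F l m \<Longrightarrow> convs w (x * y) = convs w (y * x)"
proof (induction w arbitrary: k l n m x y)
  case Nil
  show ?case by (simp add: counit_mult mult.commute)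
next
  case (Cons f w)
  obtain L where L: "\<Delta> x = (\<Sum>(a, b)\<leftarrow>L. pure_tensor [a, b])"
    "\<And>a b. (a, b) \<in> set L \<Longrightarrow> \<exists>i\<le>k. \<exists>m\<le>n. a \<in> F i m \<and> b \<in> F (k - i) (n - m)"
    using coproduct_F[OF Cons.prems(3)] by metis
  obtain L' where L': "\<Delta> y = (\<Sum>(a, b)\<leftarrow>L'. pure_tensor [a, b])"
    "\<And>a b. (a, b) \<in> set L' \<Longrightarrow> \<exists>i\<le>l. \<exists>m'\<le>m. a \<in> F i m' \<and> b \<in> F (l - i) (m - m')"
    using coproduct_F[OF Cons.prems(4)] by metis
  have fJ: "f \<in> J" "set w \<subseteq> J" using Cons.prems by auto
  have "f (a * a') * convs w (b * b') = f (a' * a) * convs w (b' * b)"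
    if p: "(a, b) \<in> set L" and q: "(a', b') \<in> set L'" for a b a' b'
  proof -
    obtain i j where i: "i \<le> k" "a \<in> F i j" "b \<in> F (k - i) (n - j)" using L(2)[OF p] by blast
    obtain i' j' where i': "i' \<le> l" "a' \<in> F i' j'" "b' \<in> F (l - i') (m - j')" using L'(2)[OF q] by blast
    consider "i + i' = 0" | "i + i' \<ge> 2" | "i + i' = 1" by linarith
    then show ?thesis
    proof cases
      case 1
      then have "a \<in> H 0" "a' \<in> H 0" using i i' F_0_subset_H_0 by auto
      then have "a * a' \<in> H (0 + 0)" "a' * a \<in> H (0 + 0)" by (simp_all only: mult_in_H)
      then show ?thesis using J_H_0[OF fJ(1)] by simp
    next
      case 2
      then have "convs w (b * b') = 0" "convs w (b' * b) = 0"
        using i i' Cons.prems(2)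
        by (auto intro!: convs_mult_vanish[OF fJ(2) _ i(3) i'(3)] convs_mult_vanish[OF fJ(2) _ i'(3) i(3)])
      then show ?thesis by simp
    next
      case 3
      then have "a \<in> H 0 \<or> a' \<in> H 0" using i(2) i'(2) F_0_subset_H_0 by (cases i) auto
      then have "(\<exists>c. a = c *\<^sub>R 1) \<or> (\<exists>c. a' = c *\<^sub>R 1)" using H_0_eq by blast
      then have "a * a' = a' * a" by auto
      moreover have "convs w (b * b') = convs w (b' * b)"
        using i i' 3 Cons.prems(2) by (intro Cons.IH[OF fJ(2) _ i(3) i'(3)]) auto
      ultimately show ?thesis by simp
    qed
  qed
  then show ?case
    unfolding convs_Cons conv_def cop_mult_repr[OF bilinear_convs[OF fJ] L(1) L'(1)]
      cop_mult_repr[OF bilinear_convs[OF fJ] L'(1) L(1)] sum_list_swap[of _ L' L]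
    by (intro sum_list_cong) auto
qed

lemma E_commutator:
  assumes "x \<in> F k n" "y \<in> F l m"
  shows "x * y - y * x \<in> E (k + l) (n + m)"
proof -
  have "x * y \<in> F (k + l) (n + m)" "y * x \<in> F (k + l) (n + m)"
    using F_mult[OF assms] F_mult[OF assms(2,1)] by (simp_all add: add.commute)
  then have "x * y - y * x \<in> F (k + l) (n + m)" by (rule subspace_diff[OF subspace_E])
  moreover have "convs w (x * y - y * x) = 0" if "set w \<subseteq> J" "length w = k + l" for w
    using convs_mult_commute[OF that assms] linear_diff[OF linear_convs_J[OF that(1)]] by simp
  ultimately show ?thesis by (auto simp: E_def le_less)
qed

text \<open>The terms of the filtered coproduct are sorted by whether the first leg, only the second
  leg, or neither lies in \<open>H 0\<close>. The counit axioms add up the first two groups to 1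
  \<otimes> x and x \<otimes> 1. In the third group all levels and degrees are positive, because
  elements of level 0 or degree 0 lie in \<open>H 0\<close>.\<close>

lemma coproduct_reduced:
  assumes x: "x \<in> F k n" and n: "n > 0"
  obtains L where "\<Delta> x = pure_tensor [x, 1] + pure_tensor [1, x] + (\<Sum>(a, b)\<leftarrow>L. pure_tensor [a, b])"
    "\<And>a b. (a, b) \<in> set L \<Longrightarrow> \<exists>i j. 0 < i \<and> i < k \<and> 0 < j \<and> j < n \<and> a \<in> F i j \<and> b \<in> F (k - i) (n - j)"
proof -
  obtain L where L: "\<Delta> x = (\<Sum>(a, b)\<leftarrow>L. pure_tensor [a, b])"
    "\<And>a b. (a, b) \<in> set L \<Longrightarrow> \<exists>i\<le>k. \<exists>m\<le>n. a \<in> F i m \<and> b \<in> F (k - i) (n - m)"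
    using coproduct_F[OF x] by metis
  define L1 where "L1 = filter (\<lambda>p. fst p \<in> H 0) L"
  define L2 where "L2 = filter (\<lambda>p. fst p \<notin> H 0 \<and> snd p \<in> H 0) L"
  define L3 where "L3 = filter (\<lambda>p. fst p \<notin> H 0 \<and> snd p \<notin> H 0) L"
  have split: "(\<Sum>p\<leftarrow>L. g p) = (\<Sum>p\<leftarrow>L1. g p) + (\<Sum>p\<leftarrow>L2. g p) + (\<Sum>p\<leftarrow>L3. g p)" for g :: "'a \<times> 'a \<Rightarrow> 'c::comm_monoid_add"
    unfolding L1_def L2_def L3_def by (induction L) (auto simp: ac_simps)
  have deg: "\<exists>m\<le>n. a \<in> H m \<and> b \<in> H (n - m)" if "(a, b) \<in> set L" for a b
    using L(2)[OF that] E_H by blast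
  have l1: "linear (\<lambda>b. pure_tensor [e, b])" and l2: "linear (\<lambda>a. pure_tensor [a, b])" for e b :: 'a
    using linear_pure_tensor[of "[e]" "[]"] linear_pure_tensor[of "[]" "[b]"] by auto
  have bil1: "bilinear (\<lambda>a b. \<epsilon> a *\<^sub>R b)" and bil2: "bilinear (\<lambda>a b. \<epsilon> b *\<^sub>R a)"
    by (intro bilinearI linear_scaleR_vec linear_scaleR_real linear_counit linear_ident)+
  have eps: "\<epsilon> a = 0" if "a \<in> H m" "m > 0" for a m using counit_in_H that by blast
  have "x = (\<Sum>p\<leftarrow>L. \<epsilon> (fst p) *\<^sub>R snd p)"
    using cop_counit_left[OF linear_ident, of x] unfolding cop_eq[OF bil1 L(1)] by (simp add: case_prod_unfold)
  also have "\<dots> = (\<Sum>p\<leftarrow>L1. \<epsilon> (fst p) *\<^sub>R snd p)"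
  proof -
    have z: "\<epsilon> (fst p) = 0" if p: "p \<in> set L2 \<or> p \<in> set L3" for p
    proof -
      have "(fst p, snd p) \<in> set L" "fst p \<notin> H 0" using p by (auto simp: L2_def L3_def)
      then obtain m where "fst p \<in> H m" "m \<noteq> 0" using deg by metis
      then show ?thesis using eps by blast
    qed
    show ?thesis
      unfolding split by (simp add: z cong: map_cong)
  qed
  finally have x1: "x = (\<Sum>p\<leftarrow>L1. \<epsilon> (fst p) *\<^sub>R snd p)" .
  have "x = (\<Sum>p\<leftarrow>L. \<epsilon> (snd p) *\<^sub>R fst p)"
    using cop_counit_right[OF linear_ident, of x] unfolding cop_eq[OF bil2 L(1)] by (simp add: case_prod_unfold)
  also have "\<dots> = (\<Sum>p\<leftarrow>L2. \<epsilon> (snd p) *\<^sub>R fst p)"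
  proof -
    \<comment> \<open>If the first leg is a scalar, either the second leg has degree
      \<open>n > 0\<close> and counit 0, or the first leg also lies in a positive degree and is
      0.\<close>
    have z1: "\<epsilon> (snd p) *\<^sub>R fst p = 0" if p: "p \<in> set L1" for p
    proof -
      have p: "(fst p, snd p) \<in> set L" "fst p \<in> H 0" using p by (auto simp: L1_def)
      then obtain m where m: "m \<le> n" "fst p \<in> H m" "snd p \<in> H (n - m)" using deg by blast
      show ?thesis
      proof (cases "m = 0")
        case True
        then show ?thesis using eps[OF m(3)] n by simp
      next
        case False
        then have "pr m (fst p) = 0" using pr_H[OF p(2)] by simp
        then show ?thesis using pr_H[OF m(2)] by simp
      qed
    qed
    have z3: "\<epsilon> (snd p) = 0" if p: "p \<in> set L3" for p
    proof -
      have "(fst p, snd p) \<in> set L" "snd p \<notin> H 0" using p by (auto simp: L3_def)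
      then obtain m where "snd p \<in> H m" "m \<noteq> 0" using deg by metis
      then show ?thesis using eps by blast
    qed
    show ?thesis
      unfolding split by (simp add: z1 z3 cong: map_cong)
  qed
  finally have x2: "x = (\<Sum>p\<leftarrow>L2. \<epsilon> (snd p) *\<^sub>R fst p)" .
  have "(\<Sum>p\<leftarrow>L1. pure_tensor [fst p, snd p]) = (\<Sum>p\<leftarrow>L1. pure_tensor [1, \<epsilon> (fst p) *\<^sub>R snd p])"
  proof (rule sum_list_cong)
    fix p assume "p \<in> set L1"
    then have "fst p = \<epsilon> (fst p) *\<^sub>R 1" by (intro H_0_eq) (auto simp: L1_def)
    then have "pure_tensor [fst p, snd p] = pure_tensor [\<epsilon> (fst p) *\<^sub>R 1, snd p]" by simp
    then show "pure_tensor [fst p, snd p] = pure_tensor [1, \<epsilon> (fst p) *\<^sub>R snd p]"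
      by (simp add: linear_scale[OF l1] linear_scale[OF l2])
  qed
  also have "\<dots> = pure_tensor [1, x]" by (simp only: linear_sum_list[OF l1, symmetric] x1[symmetric])
  finally have s1: "(\<Sum>p\<leftarrow>L1. pure_tensor [fst p, snd p]) = pure_tensor [1, x]" .
  have "(\<Sum>p\<leftarrow>L2. pure_tensor [fst p, snd p]) = (\<Sum>p\<leftarrow>L2. pure_tensor [\<epsilon> (snd p) *\<^sub>R fst p, 1])"
  proof (rule sum_list_cong)
    fix p assume "p \<in> set L2"
    then have "snd p = \<epsilon> (snd p) *\<^sub>R 1" by (intro H_0_eq) (auto simp: L2_def)
    then have "pure_tensor [fst p, snd p] = pure_tensor [fst p, \<epsilon> (snd p) *\<^sub>R 1]" by simp
    then show "pure_tensor [fst p, snd p] = pure_tensor [\<epsilon> (snd p) *\<^sub>R fst p, 1]"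
      by (simp add: linear_scale[OF l1] linear_scale[OF l2])
  qed
  also have "\<dots> = pure_tensor [x, 1]" by (simp only: linear_sum_list[OF l2, symmetric] x2[symmetric])
  finally have s2: "(\<Sum>p\<leftarrow>L2. pure_tensor [fst p, snd p]) = pure_tensor [x, 1]" .
  have "\<Delta> x = pure_tensor [x, 1] + pure_tensor [1, x] + (\<Sum>(a, b)\<leftarrow>L3. pure_tensor [a, b])"
    unfolding L(1) by (simp add: case_prod_unfold split s1 s2 add.commute)
  moreover have "\<exists>i j. 0 < i \<and> i < k \<and> 0 < j \<and> j < n \<and> a \<in> F i j \<and> b \<in> F (k - i) (n - j)"
    if ab: "(a, b) \<in> set L3" for a b
  proof -
    have ab: "(a, b) \<in> set L" "a \<notin> H 0" "b \<notin> H 0" using ab by (auto simp: L3_def)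
    then obtain i j where ij: "i \<le> k" "j \<le> n" "a \<in> F i j" "b \<in> F (k - i) (n - j)" using L(2) by blast
    have "i \<noteq> 0" "k - i \<noteq> 0" using F_0_subset_H_0 ij ab by metis+
    moreover have "j \<noteq> 0" "n - j \<noteq> 0" using E_H ij ab by metis+
    ultimately have "0 < i \<and> i < k \<and> 0 < j \<and> j < n" by auto
    with ij show ?thesis by blast
  qed
  ultimately show ?thesis using that by blast
qed

end

section \<open>Expanding the coproduct of a product\<close>

text \<open>A letter is an element together with its weight (its level in the coradical filtration), its
  degree and a label, which records the factor it originates from when the coproduct splits factors.\<close>

datatype 'b letter = Letter (val: 'b) (wt: nat) (dg: nat) (lb: nat)

abbreviation lwt :: "'b letter list \<Rightarrow> nat" where "lwt ls \<equiv> (\<Sum>l\<leftarrow>ls. wt l)"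
abbreviation ldg :: "'b letter list \<Rightarrow> nat" where "ldg ls \<equiv> (\<Sum>l\<leftarrow>ls. dg l)"
abbreviation lpr :: "'b::monoid_mult letter list \<Rightarrow> 'b" where "lpr ls \<equiv> (\<Prod>l\<leftarrow>ls. val l)"

text \<open>Each letter goes to the left, goes to the right, or is cut by a term of
  \<open>R\<close>, which plays the role of the reduced coproduct. With the empty \<open>R\<close>
  only the distributions of uncut letters remain; in this form it is also applied to plain lists of
  degrees.\<close>

primrec splits :: "('l \<Rightarrow> ('l \<times> 'l) list) \<Rightarrow> 'l list \<Rightarrow> ('l list \<times> 'l list) list" where
  "splits R [] = [([], [])]"
| "splits R (y # ys) = concat (map (\<lambda>A. map (\<lambda>B. (fst A @ fst B, snd A @ snd B)) (splits R ys))
     (([y], []) # ([], [y]) # map (\<lambda>(a, b). ([a], [b])) (R y)))"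

lemma splits_extract: "([l], us @ vs) \<in> set (splits R (us @ l # vs))"
proof (induction us)
  case Nil
  have "([], vs) \<in> set (splits R vs)" by (induction vs) force+
  then show ?case by force
qed force

text \<open>The words into which the iterated coproduct for the weak-composition \<open>D\<close>, followed by
  multiplication, expands a word; each letter carries its tensor slot, counted from \<open>i\<close>.\<close>

primrec expansions :: "('b letter \<Rightarrow> ('b letter \<times> 'b letter) list) \<Rightarrow> nat list \<Rightarrow> nat \<Rightarrow> 'b letter list \<Rightarrow>
    ('b letter \<times> nat) list list" where
  "expansions R [] i ys = (if ys = [] then [[]] else [])"
| "expansions R (d # D) i ys = concat (map (\<lambda>A. if ldg (fst A) = d
     then map (\<lambda>zs. map (\<lambda>l. (l, i)) (fst A) @ zs) (expansions R D (Suc i) (snd A)) else []) (splits R ys))"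

text \<open>The recursion of \<open>expansions\<close>, restricted to uncut letters and to their
  degrees. It mediates between the expansion of the coproduct and \<open>beta\<close>.\<close>

primrec count_assignments :: "nat list \<Rightarrow> nat list \<Rightarrow> nat" where
  "count_assignments [] ns = (if ns = [] then 1 else 0)"
| "count_assignments (d # D) ns =
     (\<Sum>A\<leftarrow>splits (\<lambda>_. []) ns. if sum_list (fst A) = d then count_assignments D (snd A) else 0)"

context
  fixes R :: "'b letter \<Rightarrow> ('b letter \<times> 'b letter) list"
  assumes R_dg: "(a, b) \<in> set (R y) \<Longrightarrow> dg a + dg b = dg y"
    and R_wt: "(a, b) \<in> set (R y) \<Longrightarrow> wt a + wt b = wt y"
    and R_lb: "(a, b) \<in> set (R y) \<Longrightarrow> lb a = lb y \<and> lb b = lb y"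
begin

text \<open>Triangularity rests on the dichotomy in the fifth claim: a cut lengthens the word and
  leaves a trace, two letters of equal label on opposite sides.\<close>

lemma splits_props:
  assumes "A \<in> set (splits R ys)"
  shows "ldg (fst A) + ldg (snd A) = ldg ys" "lwt (fst A) + lwt (snd A) = lwt ys"
    "(\<Sum>l\<leftarrow>fst A. if lb l = j then dg l else 0) + (\<Sum>l\<leftarrow>snd A. if lb l = j then dg l else 0) =
      (\<Sum>l\<leftarrow>ys. if lb l = j then dg l else 0)"
    "lb ` set (fst A) \<union> lb ` set (snd A) = lb ` set ys"
    "mset (fst A) + mset (snd A) = mset ys \<or>
      length (fst A) + length (snd A) > length ys \<and> (\<exists>a\<in>set (fst A). \<exists>b\<in>set (snd A). lb a = lb b)"
    "length (fst A) + length (snd A) \<ge> length ys"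
proof -
  have "ldg (fst A) + ldg (snd A) = ldg ys \<and> lwt (fst A) + lwt (snd A) = lwt ys \<and>
    (\<Sum>l\<leftarrow>fst A. if lb l = j then dg l else 0) + (\<Sum>l\<leftarrow>snd A. if lb l = j then dg l else 0) =
      (\<Sum>l\<leftarrow>ys. if lb l = j then dg l else 0) \<and>
    lb ` set (fst A) \<union> lb ` set (snd A) = lb ` set ys \<and>
    (mset (fst A) + mset (snd A) = mset ys \<or>
      length (fst A) + length (snd A) > length ys \<and> (\<exists>a\<in>set (fst A). \<exists>b\<in>set (snd A). lb a = lb b)) \<and>
    length (fst A) + length (snd A) \<ge> length ys"
    using assms
  proof (induction ys arbitrary: A)
    case (Cons y ys)
    then obtain B where B: "B \<in> set (splits R ys)" "A = (y # fst B, snd B) \<or> A = (fst B, y # snd B) \<or>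
      (\<exists>a b. (a, b) \<in> set (R y) \<and> A = (a # fst B, b # snd B))" by fastforce
    consider "A = (y # fst B, snd B)" | "A = (fst B, y # snd B)"
      | a b where "(a, b) \<in> set (R y)" "A = (a # fst B, b # snd B)" using B(2) by blast
    then show ?case
    proof cases
      case 3
      show ?thesis using Cons.IH[OF B(1)] R_dg[OF 3(1)] R_wt[OF 3(1)] R_lb[OF 3(1)] unfolding 3(2)
        by auto
    qed (use Cons.IH[OF B(1)] in auto)
  qed simp
  then show "ldg (fst A) + ldg (snd A) = ldg ys" "lwt (fst A) + lwt (snd A) = lwt ys"
    "(\<Sum>l\<leftarrow>fst A. if lb l = j then dg l else 0) + (\<Sum>l\<leftarrow>snd A. if lb l = j then dg l else 0) =
      (\<Sum>l\<leftarrow>ys. if lb l = j then dg l else 0)"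
    "lb ` set (fst A) \<union> lb ` set (snd A) = lb ` set ys"
    "mset (fst A) + mset (snd A) = mset ys \<or>
      length (fst A) + length (snd A) > length ys \<and> (\<exists>a\<in>set (fst A). \<exists>b\<in>set (snd A). lb a = lb b)"
    "length (fst A) + length (snd A) \<ge> length ys"
    by blast+
qed

text \<open>Slots increase along the recursion: the left part stays in slot \<open>i\<close>, and
  all that comes from the right part gets a later slot. So the halves of a cut letter end up in
  different slots, whatever happens to the right half afterwards.\<close>

lemma expansions_props:
  assumes "zs \<in> set (expansions R D i ys)"
  shows "(\<Sum>z\<leftarrow>zs. wt (fst z)) = lwt ys"
    "(\<Sum>z\<leftarrow>zs. if lb (fst z) = j then dg (fst z) else 0) = (\<Sum>l\<leftarrow>ys. if lb l = j then dg l else 0)"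
    "(\<lambda>z. lb (fst z)) ` set zs = lb ` set ys"
    "snd ` set zs \<subseteq> {i..<i + length D}"
    "\<forall>s<length D. (\<Sum>z\<leftarrow>zs. if snd z = i + s then dg (fst z) else 0) = D ! s"
    "length zs \<ge> length ys"
    "mset (map fst zs) = mset ys \<or> length zs > length ys \<and>
      (\<exists>z\<in>set zs. \<exists>z'\<in>set zs. lb (fst z) = lb (fst z') \<and> snd z \<noteq> snd z')"
    "ldg ys = sum_list D"
proof -
  have "(\<Sum>z\<leftarrow>zs. wt (fst z)) = lwt ys \<and>
    (\<Sum>z\<leftarrow>zs. if lb (fst z) = j then dg (fst z) else 0) = (\<Sum>l\<leftarrow>ys. if lb l = j then dg l else 0) \<and>
    (\<lambda>z. lb (fst z)) ` set zs = lb ` set ys \<and>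
    snd ` set zs \<subseteq> {i..<i + length D} \<and>
    (\<forall>s<length D. (\<Sum>z\<leftarrow>zs. if snd z = i + s then dg (fst z) else 0) = D ! s) \<and>
    length zs \<ge> length ys \<and>
    (mset (map fst zs) = mset ys \<or> length zs > length ys \<and>
      (\<exists>z\<in>set zs. \<exists>z'\<in>set zs. lb (fst z) = lb (fst z') \<and> snd z \<noteq> snd z')) \<and> ldg ys = sum_list D"
    using assms
  proof (induction D arbitrary: i ys zs)
    case Nil
    then show ?case by (auto split: if_splits)
  next
    case (Cons d D)
    then obtain A zs' where A: "A \<in> set (splits R ys)" "ldg (fst A) = d"
      and zs': "zs' \<in> set (expansions R D (Suc i) (snd A))" and zs: "zs = map (\<lambda>l. (l, i)) (fst A) @ zs'"
      by (auto split: if_splits)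
    note IH = Cons.IH[OF zs']
    have slot_zs': "snd z \<noteq> i" "snd z \<ge> Suc i" if "z \<in> set zs'" for z
      using IH that by force+
    have s: "(\<Sum>z\<leftarrow>zs. if snd z = i + s then dg (fst z) else 0) = (d # D) ! s" if "s < length (d # D)" for s
    proof (cases s)
      case 0
      have "(\<Sum>z\<leftarrow>zs'. if snd z = i then dg (fst z) else 0) = (\<Sum>z\<leftarrow>zs'. 0)"
        by (rule arg_cong[of _ _ sum_list], rule map_cong) (use slot_zs' in auto)
      then show ?thesis using 0 A(2) by (simp add: zs o_def)
    next
      case (Suc s')
      have "(\<Sum>l\<leftarrow>fst A. if i = i + s then dg l else 0) = 0" using Suc by (induction "fst A") auto
      moreover have "(\<Sum>z\<leftarrow>zs'. if snd z = Suc i + s' then dg (fst z) else 0) = D ! s'"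
        using IH that Suc by simp
      ultimately show ?thesis using Suc by (simp add: zs o_def)
    qed
    have m: "mset (map fst zs) = mset ys \<or> length zs > length ys \<and>
      (\<exists>z\<in>set zs. \<exists>z'\<in>set zs. lb (fst z) = lb (fst z') \<and> snd z \<noteq> snd z')"
    proof -
      consider (pure) "mset (fst A) + mset (snd A) = mset ys" "mset (map fst zs') = mset (snd A)"
        | (later) "length zs' > length (snd A)"
          "\<exists>z\<in>set zs'. \<exists>z'\<in>set zs'. lb (fst z) = lb (fst z') \<and> snd z \<noteq> snd z'"
        | (now) "length (fst A) + length (snd A) > length ys" "\<exists>a\<in>set (fst A). \<exists>b\<in>set (snd A). lb a = lb b"
        using IH splits_props(5)[OF A(1)] by blast
      then show ?thesis
      proof cases
        case pure
        then show ?thesis by (simp add: zs o_def)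
      next
        case later
        then show ?thesis using splits_props(6)[OF A(1)] unfolding zs by fastforce
      next
        case now
        then obtain a b where ab: "a \<in> set (fst A)" "b \<in> set (snd A)" "lb a = lb b" by blast
        \<comment> \<open>\<open>b\<close> itself may be cut later on; a descendant of it is found
          through the label.\<close>
        then have "lb a \<in> (\<lambda>z. lb (fst z)) ` set zs'" using IH by auto
        then obtain z where z: "z \<in> set zs'" "lb (fst z) = lb a" by auto
        have "(a, i) \<in> set zs" "z \<in> set zs" using ab(1) z(1) by (auto simp: zs)
        moreover have "length zs > length ys" using now(1) IH by (simp add: zs)
        moreover have "snd (a, i) \<noteq> snd z" using slot_zs'(1)[OF z(1)] by simp
        ultimately show ?thesis using z(2) by (metis fst_conv)
      qed
    qed
    have "(\<lambda>z. lb (fst z)) ` set zs = lb ` set ys"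
      using IH splits_props(4)[OF A(1)] by (auto simp: zs image_Un image_image)
    moreover have "snd ` set zs \<subseteq> {i..<i + length (d # D)}"
      using IH by (fastforce simp: zs)
    ultimately show ?case
      using IH s m splits_props[OF A(1)] A(2) by (simp add: zs o_def cong: if_cong)
  qed
  then show "(\<Sum>z\<leftarrow>zs. wt (fst z)) = lwt ys"
    "(\<Sum>z\<leftarrow>zs. if lb (fst z) = j then dg (fst z) else 0) = (\<Sum>l\<leftarrow>ys. if lb l = j then dg l else 0)"
    "(\<lambda>z. lb (fst z)) ` set zs = lb ` set ys"
    "snd ` set zs \<subseteq> {i..<i + length D}"
    "\<forall>s<length D. (\<Sum>z\<leftarrow>zs. if snd z = i + s then dg (fst z) else 0) = D ! s"
    "length zs \<ge> length ys"
    "mset (map fst zs) = mset ys \<or> length zs > length ys \<and>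
      (\<exists>z\<in>set zs. \<exists>z'\<in>set zs. lb (fst z) = lb (fst z') \<and> snd z \<noteq> snd z')"
    "ldg ys = sum_list D"
    by blast+
qed

text \<open>A cut adds a letter, so the terms of unchanged length are the pure distributions, and
  these depend on the degrees alone once only degrees are recorded.\<close>

lemma splits_pure:
  "map (\<lambda>A. (map dg (fst A), map dg (snd A))) (filter (\<lambda>A. length (fst A) + length (snd A) = length ys) (splits R ys)) =
    splits (\<lambda>_. []) (map dg ys)"
proof (induction ys)
  case (Cons y ys)
  let ?P = "\<lambda>ys A. length (fst A) + length (snd A) = length ys"
  have 1: "filter (?P (y # ys)) (map (\<lambda>B. (y # fst B, snd B)) (splits R ys)) =
      map (\<lambda>B. (y # fst B, snd B)) (filter (?P ys) (splits R ys))"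
    by (simp add: filter_map o_def)
  have 2: "filter (?P (y # ys)) (map (\<lambda>B. (fst B, y # snd B)) (splits R ys)) =
      map (\<lambda>B. (fst B, y # snd B)) (filter (?P ys) (splits R ys))"
    by (simp add: filter_map o_def)
  have 3: "filter (?P (y # ys)) (concat (map (\<lambda>A. map (\<lambda>B. (fst A @ fst B, snd A @ snd B)) (splits R ys))
     (map (\<lambda>(a, b). ([a], [b])) (R y)))) = []"
    using splits_props(6)[of _ ys] by (fastforce simp: filter_empty_conv)
  show ?case
    using 3 by (simp add: 1[simplified] 2[simplified] o_def flip: Cons.IH)
qed simp

lemma count_expansions:
  "length (filter (\<lambda>zs. length zs = length ys) (expansions R D i ys)) = count_assignments D (map dg ys)"
proof (induction D arbitrary: i ys)
  case (Cons d D)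
  let ?g = "\<lambda>A. if ldg (fst A) = d then map (\<lambda>zs. map (\<lambda>l. (l, i)) (fst A) @ zs) (expansions R D (Suc i) (snd A)) else []"
  let ?P = "\<lambda>A. length (fst A) + length (snd A) = length ys"
  let ?h = "\<lambda>A. if sum_list (fst A) = d then count_assignments D (snd A) else 0"
  have "length (filter (\<lambda>zs. length zs = length ys) (?g A)) = (if ?P A then ?h (map dg (fst A), map dg (snd A)) else 0)"
    if A: "A \<in> set (splits R ys)" for A
  proof (cases "?P A")
    case True
    then have "length (fst A) + length zs = length ys \<longleftrightarrow> length zs = length (snd A)" for zs :: "('b letter \<times> nat) list" by auto
    then show ?thesis using True Cons.IH[of "snd A" "Suc i"] by (simp add: filter_map o_def)
  next
    case False
    then have *: "length (fst A) + length (snd A) > length ys" using splits_props(6)[OF A] by simp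
    have "length (fst A) + length zs \<noteq> length ys" if "zs \<in> set (expansions R D (Suc i) (snd A))" for zs
      using expansions_props(6)[OF that] * by simp
    then have "filter (\<lambda>zs. length zs = length ys) (?g A) = []" by (auto simp: filter_empty_conv)
    then show ?thesis using False by simp
  qed
  then have "length (filter (\<lambda>zs. length zs = length ys) (expansions R (d # D) i ys)) =
      (\<Sum>A\<leftarrow>splits R ys. if ?P A then ?h (map dg (fst A), map dg (snd A)) else 0)"
    by (simp only: expansions.simps filter_concat length_concat map_map o_def cong: map_cong)
  also have "\<dots> = (\<Sum>A\<leftarrow>filter ?P (splits R ys). ?h (map dg (fst A), map dg (snd A)))"
    by (simp only: sum_list_map_filter')
  also have "\<dots> = sum_list (map ?h (map (\<lambda>A. (map dg (fst A), map dg (snd A))) (filter ?P (splits R ys))))"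
    by (simp add: o_def)
  also have "\<dots> = count_assignments (d # D) (map dg ys)"
    unfolding splits_pure by simp
  finally show ?case .
qed simp

end

section \<open>Words in the Hopf algebra and the expansion of their coproducts\<close>

context graded_connected_hopf_algebra_fd
begin

definition valid :: "'a letter \<Rightarrow> bool" where
  "valid l \<longleftrightarrow> val l \<in> F (wt l) (dg l) \<and> wt l > 0 \<and> dg l > 0"

text \<open>The conditions on the two parts are asked for every letter, valid or not, so that the
  facts about \<open>splits\<close>, which concern all letters, apply to \<open>red\<close>. For an
  invalid letter the empty list is a possible choice.\<close>

definition red :: "'a letter \<Rightarrow> ('a letter \<times> 'a letter) list" where
  "red l = (SOME L. (valid l \<longrightarrow> \<Delta> (val l) = pure_tensor [val l, 1] + pure_tensor [1, val l] +
      (\<Sum>(a, b)\<leftarrow>L. pure_tensor [val a, val b])) \<and>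
    (\<forall>(a, b)\<in>set L. valid a \<and> valid b \<and> wt a + wt b = wt l \<and> dg a + dg b = dg l \<and> lb a = lb l \<and> lb b = lb l))"

lemma red_props:
  "valid l \<Longrightarrow> \<Delta> (val l) = pure_tensor [val l, 1] + pure_tensor [1, val l] +
      (\<Sum>(a, b)\<leftarrow>red l. pure_tensor [val a, val b])"
  "(a, b) \<in> set (red l) \<Longrightarrow>
     valid a \<and> valid b \<and> wt a + wt b = wt l \<and> dg a + dg b = dg l \<and> lb a = lb l \<and> lb b = lb l"
proof -
  have "\<exists>L. (valid l \<longrightarrow> \<Delta> (val l) = pure_tensor [val l, 1] + pure_tensor [1, val l] +
      (\<Sum>(a, b)\<leftarrow>L. pure_tensor [val a, val b])) \<and>
    (\<forall>(a, b)\<in>set L. valid a \<and> valid b \<and> wt a + wt b = wt l \<and> dg a + dg b = dg l \<and> lb a = lb l \<and> lb b = lb l)"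
  proof (cases "valid l")
    case True
    then obtain L where L: "\<Delta> (val l) = pure_tensor [val l, 1] + pure_tensor [1, val l] + (\<Sum>(a, b)\<leftarrow>L. pure_tensor [a, b])"
      "\<And>a b. (a, b) \<in> set L \<Longrightarrow> \<exists>i j. 0 < i \<and> i < wt l \<and> 0 < j \<and> j < dg l \<and> a \<in> F i j \<and> b \<in> F (wt l - i) (dg l - j)"
      using coproduct_reduced[of "val l" "wt l" "dg l"] by (metis valid_def)
    then have "\<forall>p\<in>set L. \<exists>i j. 0 < i \<and> i < wt l \<and> 0 < j \<and> j < dg l \<and> fst p \<in> F i j \<and> snd p \<in> F (wt l - i) (dg l - j)"
      by auto
    then obtain i j where ij: "\<And>p. p \<in> set L \<Longrightarrow>
       0 < i p \<and> i p < wt l \<and> 0 < j p \<and> j p < dg l \<and> fst p \<in> F (i p) (j p) \<and> snd p \<in> F (wt l - i p) (dg l - j p)"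
      by metis
    define L' where "L' = map (\<lambda>p. (Letter (fst p) (i p) (j p) (lb l), Letter (snd p) (wt l - i p) (dg l - j p) (lb l))) L"
    show ?thesis using L(1) ij
      by (intro exI[of _ L']) (force simp: L'_def o_def case_prod_unfold valid_def)
  next
    case False
    then show ?thesis by (intro exI[of _ "[]"]) simp
  qed
  from someI_ex[OF this, folded red_def]
  show "valid l \<Longrightarrow> \<Delta> (val l) = pure_tensor [val l, 1] + pure_tensor [1, val l] +
      (\<Sum>(a, b)\<leftarrow>red l. pure_tensor [val a, val b])"
    "(a, b) \<in> set (red l) \<Longrightarrow>
     valid a \<and> valid b \<and> wt a + wt b = wt l \<and> dg a + dg b = dg l \<and> lb a = lb l \<and> lb b = lb l"
    by auto
qed

text \<open>Two positive weights cannot add up to 1, so a letter of weight 1 is never cut.\<close>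

lemma red_primitive: "wt l = 1 \<Longrightarrow> red l = []"
proof (rule ccontr)
  assume "wt l = 1" "red l \<noteq> []"
  then obtain a b where "(a, b) \<in> set (red l)" by (metis list.set_sel(1) surj_pair)
  from red_props(2)[OF this] \<open>wt l = 1\<close> show False by (auto simp: valid_def)
qed

lemmas splits_red = splits_props[of red, OF conjunct1[OF conjunct2[OF conjunct2[OF conjunct2[OF red_props(2)]]]]
    conjunct1[OF conjunct2[OF conjunct2[OF red_props(2)]]]
    conjunct2[OF conjunct2[OF conjunct2[OF conjunct2[OF red_props(2)]]]]]

lemmas expansions_red = expansions_props[of red, OF conjunct1[OF conjunct2[OF conjunct2[OF conjunct2[OF red_props(2)]]]]
    conjunct1[OF conjunct2[OF conjunct2[OF red_props(2)]]]
    conjunct2[OF conjunct2[OF conjunct2[OF conjunct2[OF red_props(2)]]]]]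

lemmas count_expansions_red = count_expansions[of red, OF conjunct1[OF conjunct2[OF conjunct2[OF conjunct2[OF red_props(2)]]]]
    conjunct1[OF conjunct2[OF conjunct2[OF red_props(2)]]]
    conjunct2[OF conjunct2[OF conjunct2[OF conjunct2[OF red_props(2)]]]]]

abbreviation valids :: "'a letter list \<Rightarrow> bool" where "valids ys \<equiv> \<forall>l\<in>set ys. valid l"

lemma valids_splits: "valids ys \<Longrightarrow> A \<in> set (splits red ys) \<Longrightarrow> valids (fst A) \<and> valids (snd A)"
proof (induction ys arbitrary: A)
  case (Cons y ys)
  then obtain B where B: "B \<in> set (splits red ys)" "A = (y # fst B, snd B) \<or> A = (fst B, y # snd B) \<or>
      (\<exists>a b. (a, b) \<in> set (red y) \<and> A = (a # fst B, b # snd B))" by fastforce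
  show ?case using Cons.IH[OF _ B(1)] Cons.prems(1) B(2) red_props(2) by fastforce
qed simp

lemma valids_expansions: "valids ys \<Longrightarrow> zs \<in> set (expansions red D i ys) \<Longrightarrow> valids (map fst zs)"
proof (induction D arbitrary: i ys zs)
  case (Cons d D)
  then obtain A zs' where "A \<in> set (splits red ys)"
      "zs' \<in> set (expansions red D (Suc i) (snd A))" "zs = map (\<lambda>l. (l, i)) (fst A) @ zs'"
    by (auto split: if_splits)
  with Cons.IH valids_splits[OF Cons.prems(1)] show ?case by fastforce
qed (auto split: if_splits)

lemma lpr_in_F: "valids ys \<Longrightarrow> lpr ys \<in> F (lwt ys) (ldg ys)"
  by (induction ys) (auto simp: valid_def intro: F_mult)

lemma lpr_in_H: "valids ys \<Longrightarrow> lpr ys \<in> H (ldg ys)"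
  using lpr_in_F E_H by blast

lemma coproduct_lpr:
  "valids ys \<Longrightarrow> \<Delta> (lpr ys) = (\<Sum>A\<leftarrow>splits red ys. pure_tensor [lpr (fst A), lpr (snd A)])"
proof (induction ys)
  case Nil
  show ?case by (simp add: coproduct_one)
next
  case (Cons y ys)
  define opts where "opts = ([y], []) # ([], [y]) # map (\<lambda>(a, b). ([a], [b])) (red y)"
  have "\<Delta> (val y) = (\<Sum>A\<leftarrow>opts. pure_tensor [lpr (fst A), lpr (snd A)])"
    using red_props(1)[of y] Cons.prems by (simp add: opts_def case_prod_unfold o_def)
  moreover have "\<Delta> (lpr ys) = (\<Sum>A\<leftarrow>splits red ys. pure_tensor [lpr (fst A), lpr (snd A)])"
    using Cons by simp
  ultimately have "\<Delta> (lpr (y # ys)) = (\<Sum>A\<leftarrow>opts. \<Sum>B\<leftarrow>splits red ys. pure_tensor [lpr (fst A) * lpr (fst B), lpr (snd A) * lpr (snd B)])"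
    by (simp add: coproduct_mult linear_sum_list[OF linear_tensor_times_left]
        linear_sum_list[OF linear_tensor_times_pure_left] tensor_times_pure)
  also have "\<dots> = (\<Sum>A\<leftarrow>splits red (y # ys). pure_tensor [lpr (fst A), lpr (snd A)])"
    by (simp add: sum_list_concat_map o_def opts_def)
  finally show ?case .
qed

lemma convs_pr_lpr:
  "valids ys \<Longrightarrow> convs (map pr D) (lpr ys) = (\<Sum>zs\<leftarrow>expansions red D i ys. lpr (map fst zs))"
proof (induction D arbitrary: i ys)
  case Nil
  show ?case
  proof (cases ys)
    case (Cons y ys')
    then have "ldg ys > 0" using Nil by (auto simp: valid_def)
    then show ?thesis using counit_in_H[OF lpr_in_H[OF Nil]] Cons by simp
  qed (simp add: counit_one)
next
  case (Cons d D)
  have lin: "linear (convs (map pr D))" by (rule linear_convs) (simp add: linear_pr)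
  have "\<Delta> (lpr ys) = (\<Sum>(a, b)\<leftarrow>map (\<lambda>A. (lpr (fst A), lpr (snd A))) (splits red ys). pure_tensor [a, b])"
    by (simp add: coproduct_lpr[OF Cons.prems] o_def)
  from cop_eq[OF bilinear_mult[OF linear_pr lin] this]
  have "convs (map pr (d # D)) (lpr ys) =
      (\<Sum>A\<leftarrow>splits red ys. pr d (lpr (fst A)) * convs (map pr D) (lpr (snd A)))"
    by (simp add: conv_def o_def)
  also have "\<dots> = (\<Sum>A\<leftarrow>splits red ys. \<Sum>zs\<leftarrow>(if ldg (fst A) = d
     then map (\<lambda>zs. map (\<lambda>l. (l, i)) (fst A) @ zs) (expansions red D (Suc i) (snd A)) else []). lpr (map fst zs))"
  proof (rule sum_list_cong)
    fix A assume A: "A \<in> set (splits red ys)"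
    note v = valids_splits[OF Cons.prems A]
    have "pr d (lpr (fst A)) = (if d = ldg (fst A) then lpr (fst A) else 0)"
      using v by (intro pr_H lpr_in_H) auto
    moreover have "convs (map pr D) (lpr (snd A)) = (\<Sum>zs\<leftarrow>expansions red D (Suc i) (snd A). lpr (map fst zs))"
      using Cons.IH v by blast
    ultimately show "pr d (lpr (fst A)) * convs (map pr D) (lpr (snd A)) = (\<Sum>zs\<leftarrow>(if ldg (fst A) = d
     then map (\<lambda>zs. map (\<lambda>l. (l, i)) (fst A) @ zs) (expansions red D (Suc i) (snd A)) else []). lpr (map fst zs))"
      by (simp add: o_def sum_list_const_mult)
  qed
  also have "\<dots> = (\<Sum>zs\<leftarrow>expansions red (d # D) i ys. lpr (map fst zs))"
    by (simp add: sum_list_concat_map o_def)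
  finally show ?case .
qed

text \<open>The head of \<open>xs\<close> is moved past the prefix \<open>us\<close> that precedes
  its copy in \<open>ys\<close>. This costs one commutator, which lies one step lower in the
  filtration and stays there after multiplication by the other letters.\<close>

lemma lpr_perm:
  "valids xs \<Longrightarrow> mset xs = mset ys \<Longrightarrow> lpr xs - lpr ys \<in> E (lwt xs) (ldg xs)"
proof (induction xs arbitrary: ys)
  case Nil
  then show ?case using subspace_0[OF subspace_E] by simp
next
  case (Cons x xs)
  then have "x \<in> set ys" by (metis list.set_intros(1) set_mset_mset)
  then obtain us vs where ys: "ys = us @ x # vs" by (meson split_list)
  then have m: "mset xs = mset (us @ vs)" using Cons.prems by simp
  have set: "set xs = set us \<union> set vs" using arg_cong[OF m, of set_mset] by simp
  have sums: "lwt xs = lwt us + lwt vs" "ldg xs = ldg us + ldg vs"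
    using arg_cong[OF m, of "image_mset wt"] arg_cong[OF m, of "image_mset dg"]
    by (simp_all flip: mset_map sum_mset_sum_list add: sum_mset_sum_list[symmetric])
  have v: "valid x" "valids us" "valids vs" using Cons.prems set by auto
  have "val x * (lpr xs - lpr (us @ vs)) \<in> E (wt x + lwt xs) (dg x + ldg xs)"
    using Cons.IH[OF _ m] Cons.prems v(1) by (intro F_E_mult) (auto simp: valid_def)
  moreover have "(val x * lpr us - lpr us * val x) * lpr vs \<in> E (wt x + lwt us + lwt vs) (dg x + ldg us + ldg vs)"
    using v by (intro E_F_mult E_commutator lpr_in_F) (auto simp: valid_def)
  ultimately have "val x * (lpr xs - lpr (us @ vs)) + (val x * lpr us - lpr us * val x) * lpr vs \<in> E (lwt (x # xs)) (ldg (x # xs))"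
    by (simp add: sums add.assoc subspace_add[OF subspace_E])
  then show ?case by (simp add: ys algebra_simps)
qed

end

section \<open>Counting assignments of parts to slots\<close>

text \<open>Set compositions in coded form: \<open>cs ! j\<close> is the block of part
  \<open>j\<close>. Such a list of slots is what the expansion of a coproduct delivers.\<close>

definition assigns :: "nat list \<Rightarrow> nat list \<Rightarrow> nat list set" where
  "assigns D ns = {cs. length cs = length ns \<and> set cs \<subseteq> {..<length D} \<and>
     (\<forall>s<length D. (\<Sum>j<length ns. if cs ! j = s then ns ! j else 0) = D ! s)}"

lemma finite_assigns: "finite (assigns D ns)"
  by (rule finite_subset[OF _ finite_lists_length_eq[of "{..<length D}" "length ns"]])
    (auto simp: assigns_def)

lemma assigns_nth:
  assumes "cs \<in> assigns D ns" "j < length ns"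
  shows "cs ! j < length D"
proof -
  have "set cs \<subseteq> {..<length D}" "cs ! j \<in> set cs" using assms by (simp_all add: assigns_def)
  then show ?thesis by blast
qed

lemma assigns_length: "cs \<in> assigns D ns \<Longrightarrow> length cs = length ns"
  by (simp add: assigns_def)

lemma beta_eq_card_assigns: "beta D ns = card (assigns D ns)"
proof -
  let ?p = "length ns" and ?l = "length D"
  let ?B = "{Bs \<in> set_compositions {..<?p} ?l. \<forall>i<?l. (\<Sum>j\<in>Bs ! i. ns ! j) = D ! i}"
  let ?f = "\<lambda>cs. map (\<lambda>i. {j. j < ?p \<and> cs ! j = i}) [0..<?l]"
  have sum_eq: "(\<Sum>j\<in>{j. j < ?p \<and> cs ! j = i}. ns ! j) = (\<Sum>j<?p. if cs ! j = i then ns ! j else 0)" for cs :: "nat list" and i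
    using sum.inter_filter[of "{..<?p}" "\<lambda>j. ns ! j" "\<lambda>j. cs ! j = i"] by simp
  have "bij_betw ?f (assigns D ns) ?B"
  proof (rule bij_betw_imageI)
    show "inj_on ?f (assigns D ns)"
    proof (rule inj_onI)
      fix cs cs' assume *: "cs \<in> assigns D ns" "cs' \<in> assigns D ns" "?f cs = ?f cs'"
      show "cs = cs'"
      proof (rule nth_equalityI)
        show "length cs = length cs'" using * by (simp add: assigns_def)
        fix j assume j: "j < length cs"
        then have "cs ! j < ?l" using assigns_nth[OF *(1)] assigns_length[OF *(1)] by simp
        then have "?f cs ! (cs ! j) = ?f cs' ! (cs ! j)" using *(3) by simp
        then have "{j'. j' < ?p \<and> cs ! j' = cs ! j} = {j'. j' < ?p \<and> cs' ! j' = cs ! j}"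
          using \<open>cs ! j < ?l\<close> by simp
        moreover have "j \<in> {j'. j' < ?p \<and> cs ! j' = cs ! j}" using assigns_length[OF *(1)] j by simp
        ultimately have "j \<in> {j'. j' < ?p \<and> cs' ! j' = cs ! j}" by (rule subst)
        then show "cs ! j = cs' ! j" by simp
      qed
    qed
    show "?f ` assigns D ns = ?B"
    proof (intro equalityI subsetI)
      fix Bs assume "Bs \<in> ?f ` assigns D ns"
      then obtain cs where cs: "cs \<in> assigns D ns" "Bs = ?f cs" by blast
      have "j \<in> \<Union>(set Bs)" if "j < ?p" for j
      proof -
        have "cs ! j < ?l" by (rule assigns_nth[OF cs(1) that])
        then show ?thesis using that cs(2) by auto
      qed
      then have "\<Union>(set Bs) = {..<?p}" using cs(2) by auto
      then show "Bs \<in> ?B" using cs by (auto simp: set_compositions_def assigns_def sum_eq)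
    next
      fix Bs assume Bs: "Bs \<in> ?B"
      then have len: "length Bs = ?l" and un: "\<Union>(set Bs) = {..<?p}"
        and disj: "\<And>i j. i < ?l \<Longrightarrow> j < ?l \<Longrightarrow> i \<noteq> j \<Longrightarrow> Bs ! i \<inter> Bs ! j = {}"
        and sums: "\<And>i. i < ?l \<Longrightarrow> (\<Sum>j\<in>Bs ! i. ns ! j) = D ! i"
        by (auto simp: set_compositions_def)
      have "\<exists>i. i < ?l \<and> j \<in> Bs ! i" if "j < ?p" for j
      proof -
        have "j \<in> \<Union>(set Bs)" using un that by simp
        then show ?thesis using len by (auto simp: in_set_conv_nth)
      qed
      then obtain c where c: "\<And>j. j < ?p \<Longrightarrow> c j < ?l \<and> j \<in> Bs ! c j" by metis
      define cs where "cs = map c [0..<?p]"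
      have B: "{j. j < ?p \<and> cs ! j = i} = Bs ! i" if i: "i < ?l" for i
      proof (intro equalityI subsetI)
        fix j assume "j \<in> {j. j < ?p \<and> cs ! j = i}"
        then show "j \<in> Bs ! i" using c by (auto simp: cs_def)
      next
        fix j assume j: "j \<in> Bs ! i"
        then have "j \<in> \<Union>(set Bs)" using i len by auto
        then have "j < ?p" using un by simp
        moreover have "c j = i" using disj[of "c j" i] c[OF \<open>j < ?p\<close>] i j by blast
        ultimately show "j \<in> {j. j < ?p \<and> cs ! j = i}" by (simp add: cs_def)
      qed
      have "?f cs = Bs" using B len by (intro nth_equalityI) simp_all
      moreover have "cs \<in> assigns D ns"
        using c sums by (auto simp: assigns_def B simp flip: sum_eq) (auto simp: cs_def)
      ultimately show "Bs \<in> ?f ` assigns D ns" by blast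
    qed
  qed
  then show ?thesis by (simp add: beta_def bij_betw_same_card)
qed

text \<open>Placing the first part in slot \<open>i\<close> lowers the room left in that slot; the
  bound \<open>n \<le> D ! i\<close> guards the truncated subtraction.\<close>

lemma assigns_Cons: "i # cs \<in> assigns D (n # ns) \<longleftrightarrow> i < length D \<and> n \<le> D ! i \<and> cs \<in> assigns (D[i := D ! i - n]) ns"
proof -
  have "(\<Sum>j<length (n # ns). if (i # cs) ! j = s then (n # ns) ! j else 0) =
    (if i = s then n else 0) + (\<Sum>j<length ns. if cs ! j = s then ns ! j else 0)" for s
    by (simp add: sum.lessThan_Suc_shift del: sum.lessThan_Suc cong: if_cong)
  then show ?thesis
    by (auto simp: assigns_def nth_list_update)
qed

lemma card_assigns_Cons:
  "card (assigns D (n # ns)) = (\<Sum>i<length D. if n \<le> D ! i then card (assigns (D[i := D ! i - n]) ns) else 0)"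
proof -
  have "assigns D (n # ns) = (\<Union>i<length D. (#) i ` (if n \<le> D ! i then assigns (D[i := D ! i - n]) ns else {}))"
  proof (intro equalityI subsetI)
    fix cs assume "cs \<in> assigns D (n # ns)"
    moreover from this obtain i cs' where "cs = i # cs'" by (cases cs) (auto simp: assigns_def)
    ultimately show "cs \<in> (\<Union>i<length D. (#) i ` (if n \<le> D ! i then assigns (D[i := D ! i - n]) ns else {}))"
      by (auto simp: assigns_Cons)
  qed (auto simp: assigns_Cons split: if_splits)
  also have "card \<dots> = (\<Sum>i<length D. card ((#) i ` (if n \<le> D ! i then assigns (D[i := D ! i - n]) ns else {})))"
    by (rule card_UN_disjoint) (auto simp: finite_assigns)
  also have "\<dots> = (\<Sum>i<length D. if n \<le> D ! i then card (assigns (D[i := D ! i - n]) ns) else 0)"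
    by (rule sum.cong) (auto simp: card_image)
  finally show ?thesis .
qed

text \<open>\<open>count_assignments\<close> recurses over the slots, while \<open>assigns\<close>
  is taken apart part by part. This gives the former the recursion of the latter.\<close>

lemma count_assignments_Cons:
  "count_assignments D (n # ns) = (\<Sum>i<length D. if n \<le> D ! i then count_assignments (D[i := D ! i - n]) ns else 0)"
proof (induction D arbitrary: ns)
  case (Cons d D)
  let ?S = "splits (\<lambda>_. []) ns"
  have 1: "(\<Sum>A\<leftarrow>?S. if n + sum_list (fst A) = d then count_assignments D (snd A) else 0) =
    (if n \<le> d then count_assignments ((d - n) # D) ns else 0)"
  proof (cases "n \<le> d")
    case True
    then have "n + m = d \<longleftrightarrow> m = d - n" for m by auto
    then show ?thesis using True by simp
  next
    case False
    then have "n + m \<noteq> d" for m by auto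
    then show ?thesis using False by simp
  qed
  have "(\<Sum>A\<leftarrow>?S. if sum_list (fst A) = d then count_assignments D (n # snd A) else 0) =
      (\<Sum>A\<leftarrow>?S. \<Sum>i<length D. if sum_list (fst A) = d \<and> n \<le> D ! i then count_assignments (D[i := D ! i - n]) (snd A) else 0)"
    by (rule arg_cong[of _ _ sum_list], rule map_cong) (auto simp: Cons.IH intro!: sum.cong)
  also have "\<dots> = (\<Sum>i<length D. \<Sum>A\<leftarrow>?S. if sum_list (fst A) = d \<and> n \<le> D ! i then count_assignments (D[i := D ! i - n]) (snd A) else 0)"
    by (rule sum_list_sum_swap)
  also have "\<dots> = (\<Sum>i<length D. if n \<le> D ! i then count_assignments (d # D[i := D ! i - n]) ns else 0)"
    by (rule sum.cong) (auto cong: if_cong)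
  finally have 2: "(\<Sum>A\<leftarrow>?S. if sum_list (fst A) = d then count_assignments D (n # snd A) else 0) =
    (\<Sum>i<length D. if n \<le> D ! i then count_assignments (d # D[i := D ! i - n]) ns else 0)" .
  have "count_assignments (d # D) (n # ns) = (\<Sum>A\<leftarrow>?S. if n + sum_list (fst A) = d then count_assignments D (snd A) else 0) +
     (\<Sum>A\<leftarrow>?S. if sum_list (fst A) = d then count_assignments D (n # snd A) else 0)"
    by (simp add: o_def cong: if_cong)
  also have "\<dots> = (\<Sum>i<length (d # D). if n \<le> (d # D) ! i then count_assignments ((d # D)[i := (d # D) ! i - n]) ns else 0)"
    unfolding 1 2 by (simp add: sum.lessThan_Suc_shift del: sum.lessThan_Suc cong: if_cong)
  finally show ?case .
qed simp

lemma count_assignments_eq_beta: "count_assignments D ns = beta D ns"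
  unfolding beta_eq_card_assigns
proof (induction ns arbitrary: D)
  case Nil
  have "count_assignments D [] = (if \<forall>d\<in>set D. d = 0 then 1 else 0)" by (induction D) auto
  moreover have "assigns D [] = (if \<forall>d\<in>set D. d = 0 then {[]} else {})"
    by (auto simp: assigns_def all_set_conv_all_nth)
  ultimately show ?case by simp
next
  case (Cons n ns)
  show ?case by (simp only: card_assigns_Cons count_assignments_Cons Cons.IH)
qed

text \<open>Positive parts sum to 0 only if there are none, so a slot of size 0 takes nothing and
  passes all parts on.\<close>

lemma splits_zero:
  fixes ns :: "nat list"
  assumes "0 \<notin> set ns"
  shows "(\<Sum>A\<leftarrow>splits (\<lambda>_. []) ns. if sum_list (fst A) = 0 then g (snd A) else 0) = (g ns :: nat)"
  using assms
proof (induction ns arbitrary: g)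
  case (Cons n ns)
  have "(\<Sum>A\<leftarrow>splits (\<lambda>_. []) ns. if sum_list (fst A) = 0 then g (n # snd A) else 0) = g (n # ns)"
    using Cons.IH[of "\<lambda>ns. g (n # ns)"] Cons.prems by simp
  moreover have "(\<Sum>A\<leftarrow>splits (\<lambda>_. []) (n # ns). if sum_list (fst A) = 0 then g (snd A) else 0) =
    (\<Sum>A\<leftarrow>splits (\<lambda>_. []) ns. if n + sum_list (fst A) = 0 then g (snd A) else 0) +
    (\<Sum>A\<leftarrow>splits (\<lambda>_. []) ns. if sum_list (fst A) = 0 then g (n # snd A) else 0)"
    by (simp add: o_def cong: if_cong)
  moreover have "(\<Sum>A\<leftarrow>splits (\<lambda>_. []) ns. if n + sum_list (fst A) = 0 then g (snd A) else 0) = 0"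
    using Cons.prems by (subst sum_list_eq_0_iff) auto
  ultimately show ?case by (simp only: add_0)
qed simp

lemma beta_remove_zeros:
  assumes "0 \<notin> set ns"
  shows "beta (filter (\<lambda>d. d \<noteq> 0) D) ns = beta D ns"
  using assms
proof (induction D arbitrary: ns)
  case (Cons d D)
  show ?case
  proof (cases "d = 0")
    case True
    then show ?thesis
      using splits_zero[OF Cons.prems, of "count_assignments D"] Cons.IH[OF Cons.prems]
      by (simp flip: count_assignments_eq_beta)
  next
    case False
    have "0 \<notin> set (snd A)" if "A \<in> set (splits (\<lambda>_. []) ns)" for A
      using that Cons.prems by (induction ns arbitrary: A) fastforce+
    then show ?thesis
      using False Cons.IH by (auto simp flip: count_assignments_eq_beta intro!: arg_cong[of _ _ sum_list])
  qed
qed simp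

text \<open>An assignment of the merged parts \<open>ms\<close> pulls back along \<open>r\<close> to one of the finer parts \<open>ns\<close>; the
  image misses every assignment that separates two parts merged by \<open>r\<close>.\<close>

lemma beta_refine:
  assumes r: "\<And>s. s < length ns \<Longrightarrow> r s < length ms"
    and surj: "\<And>j. j < length ms \<Longrightarrow> \<exists>s<length ns. r s = j"
    and sums: "\<And>j. j < length ms \<Longrightarrow> ms ! j = (\<Sum>s<length ns. if r s = j then ns ! s else 0)"
  shows "beta D ms \<le> beta D ns"
    and "c \<in> assigns D ns \<Longrightarrow> s < length ns \<Longrightarrow> s' < length ns \<Longrightarrow> r s = r s' \<Longrightarrow> c ! s \<noteq> c ! s' \<Longrightarrow>
      beta D ms < beta D ns"
proof -
  let ?f = "\<lambda>cs. map (\<lambda>s. cs ! r s) [0..<length ns]"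
  have inj: "inj_on ?f (assigns D ms)"
  proof (rule inj_onI)
    fix cs cs' assume *: "cs \<in> assigns D ms" "cs' \<in> assigns D ms" "?f cs = ?f cs'"
    show "cs = cs'"
    proof (rule nth_equalityI)
      show "length cs = length cs'" using * by (simp add: assigns_def)
      fix j assume "j < length cs"
      then obtain s where "s < length ns" "r s = j" using surj * by (auto simp: assigns_def)
      then show "cs ! j = cs' ! j" using *(3) by auto
    qed
  qed
  have sub: "?f ` assigns D ms \<subseteq> assigns D ns"
  proof
    fix cs' assume "cs' \<in> ?f ` assigns D ms"
    then obtain cs where cs: "cs \<in> assigns D ms" "cs' = ?f cs" by blast
    have "(\<Sum>s<length ns. if cs' ! s = t then ns ! s else 0) = D ! t" if "t < length D" for t
    proof -
      have "(\<Sum>s<length ns. if cs' ! s = t then ns ! s else 0) = (\<Sum>s<length ns. if cs ! r s = t then ns ! s else 0)"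
        by (rule sum.cong) (auto simp: cs)
      \<comment> \<open>Each position \<open>s\<close> is counted at its one block
        \<open>r s\<close>; after the sums are exchanged, the hypothesis \<open>sums\<close> applies
        block by block.\<close>
      also have "\<dots> = (\<Sum>s<length ns. \<Sum>j<length ms. if r s = j then (if cs ! j = t then ns ! s else 0) else 0)"
        by (rule sum.cong) (auto simp: r)
      also have "\<dots> = (\<Sum>j<length ms. \<Sum>s<length ns. if r s = j then (if cs ! j = t then ns ! s else 0) else 0)"
        by (rule sum.swap)
      also have "\<dots> = (\<Sum>j<length ms. if cs ! j = t then ms ! j else 0)"
        by (rule sum.cong) (auto simp: sums intro!: sum.cong)
      also have "\<dots> = D ! t" using cs that by (simp add: assigns_def)
      finally show ?thesis .
    qed
    moreover have "set cs' \<subseteq> {..<length D}" using assigns_nth[OF cs(1) r] unfolding cs(2) by auto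
    ultimately show "cs' \<in> assigns D ns" by (simp add: assigns_def cs)
  qed
  show "beta D ms \<le> beta D ns"
    unfolding beta_eq_card_assigns using card_mono[OF finite_assigns sub] by (simp add: card_image inj)
  assume c: "c \<in> assigns D ns" "s < length ns" "s' < length ns" "r s = r s'" "c ! s \<noteq> c ! s'"
  then have "c \<notin> ?f ` assigns D ms" by auto
  then have "?f ` assigns D ms \<subset> assigns D ns" using sub c(1) by blast
  then show "beta D ms < beta D ns"
    unfolding beta_eq_card_assigns using psubset_card_mono[OF finite_assigns] by (metis card_image inj)
qed

text \<open>A reordering is a refinement along a permutation, so \<open>beta_refine\<close> applies
  with \<open>r\<close> bijective.\<close>

lemma beta_mset_le:
  assumes "mset ns = mset ms"
  shows "beta D ms \<le> beta D ns"
proof -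
  obtain p where p: "p permutes {..<length ms}" "permute_list p ms = ns"
    using mset_eq_permutation[OF assms] .
  have len: "length ns = length ms" using p(2) by auto
  have nth: "ns ! s = ms ! p s" if "s < length ms" for s
    using permute_list_nth[OF p(1) that] p(2) by simp
  have lt: "p s < length ms \<longleftrightarrow> s < length ms" for s using permutes_in_image[OF p(1), of s] by simp
  show ?thesis
  proof (rule beta_refine(1)[where r = p])
    show "p s < length ms" if "s < length ns" for s using that lt len by simp
    fix j assume j: "j < length ms"
    obtain s where s: "s < length ms" "p s = j"
      using permutes_surj[OF p(1)] lt j by (metis surjD)
    then show "\<exists>s<length ns. p s = j" using len by auto
    have "p t = j \<longleftrightarrow> t = s" for t using s permutes_inj[OF p(1)] by (auto dest: injD)
    then show "ms ! j = (\<Sum>s<length ns. if p s = j then ns ! s else 0)"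
      using s(1) nth[OF s(1)] s(2) len by simp
  qed
qed

lemma beta_mset_eq: "mset ns = mset ms \<Longrightarrow> beta D ms = beta D ns"
  using beta_mset_le[of ns ms] beta_mset_le[of ms ns] by (simp add: antisym)

lemma beta_merge:
  shows "beta D ((a + b) # ns) \<le> beta D (a # b # ns)"
    and "i # j # cs \<in> assigns D (a # b # ns) \<Longrightarrow> i \<noteq> j \<Longrightarrow> beta D ((a + b) # ns) < beta D (a # b # ns)"
proof -
  let ?ns = "a # b # ns" and ?ms = "(a + b) # ns"
  \<comment> \<open>By truncated subtraction \<open>s - 1\<close> sends the positions 0 and 1 both
    to 0 and shifts all others, which describes the merging of the first two parts.\<close>
  have 1: "s - 1 < length ?ms" if "s < length ?ns" for s using that by auto
  have 2: "\<exists>s<length ?ns. s - 1 = t" if "t < length ?ms" for t using that by (intro exI[of _ "Suc t"]) auto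
  have 3: "?ms ! t = (\<Sum>s<length ?ns. if s - 1 = t then ?ns ! s else 0)" if "t < length ?ms" for t
    using that by (cases t) (simp_all add: sum.lessThan_Suc_shift del: sum.lessThan_Suc cong: if_cong)
  show "beta D ?ms \<le> beta D ?ns" by (rule beta_refine(1)[OF 1 2 3])
  assume c: "i # j # cs \<in> assigns D ?ns" "i \<noteq> j"
  show "beta D ?ms < beta D ?ns"
    by (rule beta_refine(2)[OF 1 2 3 c(1), of 0 1]) (use c(2) in auto)
qed

lemma sum_list_if_nth:
  "(\<Sum>z\<leftarrow>zs. if P z then f z else (0::nat)) = (\<Sum>j<length zs. if P (zs ! j) then f (zs ! j) else 0)"
  by (simp add: sum_list_sum_nth atLeast0LessThan)

lemma assigns_of_pairs:
  assumes "snd ` set zs \<subseteq> {..<length D}"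
    "\<And>s. s < length D \<Longrightarrow> (\<Sum>z\<leftarrow>zs. if snd z = s then f (fst z) else 0) = D ! s"
  shows "map snd zs \<in> assigns D (map (\<lambda>z. f (fst z)) zs)"
  using assms by (auto simp: assigns_def sum_list_if_nth intro!: sum.cong cong: if_cong)

section \<open>Diagonalisation by strictly monotone triangularity\<close>

text \<open>The two sides are different constants; definitions stated with \<open>real_vector.independent\<close> use the first.\<close>

lemma module_dependent_eq: "module.dependent (*\<^sub>R) = dependent"
  by (simp add: dependent_raw_def)

text \<open>The families \<open>U i\<close> may overlap and be dependent. By induction from the
  largest eigenvalue down, the \<open>U j\<close> with larger eigenvalue lie in the span of
  eigenvectors for eigenvalues above \<open>b i\<close>. On that span \<open>T - b i\<close> is
  surjective, so \<open>u\<close> can be corrected by an element \<open>u'\<close> of it to a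
  solution \<open>v\<close> of \<open>T v = b i *\<^sub>R v\<close>.\<close>

lemma diagonalisable_filtered:
  fixes V :: "'v::real_vector set"
  assumes T: "linear T" and fin: "finite I" and V: "span (\<Union>i\<in>I. U i) = V"
    and tri: "\<And>i u. i \<in> I \<Longrightarrow> u \<in> U i \<Longrightarrow> T u - b i *\<^sub>R u \<in> span (\<Union>j\<in>{j\<in>I. b j > (b i :: real)}. U j)"
  shows "diagonalisable_on V T"
proof -
  let ?E = "\<lambda>P. {v \<in> V. \<exists>c. P c \<and> T v = c *\<^sub>R v}"
  have UV: "U i \<subseteq> V" if "i \<in> I" for i using span_superset[of "\<Union>i\<in>I. U i"] that unfolding V by blast
  have sV: "subspace V" unfolding V[symmetric] by simp
  have main: "U i \<subseteq> span (?E (\<lambda>c. c \<ge> b i))" if "i \<in> I" for i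
    using that
  proof (induction "card {j\<in>I. b j > b i}" arbitrary: i rule: less_induct)
    case less
    have IH: "U j \<subseteq> span (?E (\<lambda>c. c > b i))" if j: "j \<in> I" "b j > b i" for j
    proof -
      have "{k\<in>I. b k > b j} \<subset> {k\<in>I. b k > b i}" using j by auto
      then have "card {k\<in>I. b k > b j} < card {k\<in>I. b k > b i}" using fin by (intro psubset_card_mono) auto
      then have "U j \<subseteq> span (?E (\<lambda>c. c \<ge> b j))" using less.hyps j(1) by blast
      also have "\<dots> \<subseteq> span (?E (\<lambda>c. c > b i))" by (intro span_mono) (use j(2) in \<open>blast intro: less_le_trans\<close>)
      finally show ?thesis .
    qed
    show ?case
    proof
      fix u assume u: "u \<in> U i"
      have "span (\<Union>j\<in>{j\<in>I. b j > b i}. U j) \<subseteq> span (?E (\<lambda>c. c > b i))"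
        by (rule span_minimal) (use IH in auto)
      then have w: "T u - b i *\<^sub>R u \<in> span (?E (\<lambda>c. c > b i))" using tri[OF less.prems u] by blast
      have "\<exists>u'\<in>span (?E (\<lambda>c. c > b i)). T u' - b i *\<^sub>R u' = w" if "w \<in> span (?E (\<lambda>c. c > b i))" for w
        using that
      proof (induction rule: span_induct_alt)
        case base
        show ?case by (rule bexI[of _ 0]) (simp_all add: linear_0[OF T] span_zero)
      next
        case (step a v w)
        then obtain u' c where u': "u' \<in> span (?E (\<lambda>c. c > b i))" "T u' - b i *\<^sub>R u' = w"
          and c: "c > b i" "T v = c *\<^sub>R v" by blast
        \<comment> \<open>\<open>T - b i\<close> multiplies the eigenvector \<open>v\<close> by
          \<open>c - b i\<close>, which is nonzero.\<close>
        let ?v = "(a / (c - b i)) *\<^sub>R v"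
        have "T ?v - b i *\<^sub>R ?v = ((c - b i) * (a / (c - b i))) *\<^sub>R v"
          by (simp add: linear_scale[OF T] c(2) diff_divide_distrib algebra_simps)
        also have "\<dots> = a *\<^sub>R v" using c(1) by simp
        finally have "T (?v + u') - b i *\<^sub>R (?v + u') = a *\<^sub>R v + w"
          using u'(2) by (simp add: linear_add[OF T] algebra_simps)
        moreover have "?v + u' \<in> span (?E (\<lambda>c. c > b i))"
          by (rule span_add[OF span_scale[OF span_base[OF step.hyps(1)]] u'(1)])
        ultimately show ?case by blast
      qed
      from this[OF w] obtain u' where u': "u' \<in> span (?E (\<lambda>c. c > b i))" "T u' - b i *\<^sub>R u' = T u - b i *\<^sub>R u" by blast
      have u'V: "u' \<in> V" using u'(1) span_minimal[OF _ sV, of "?E (\<lambda>c. c > b i)"] by blast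
      have "T (u - u') = b i *\<^sub>R (u - u')" using u'(2) by (simp add: linear_diff[OF T] algebra_simps)
      moreover have "u - u' \<in> V" using u UV less.prems u'V subspace_diff[OF sV] by blast
      ultimately have "u - u' \<in> span (?E (\<lambda>c. c \<ge> b i))" by (intro span_base) auto
      moreover have "u' \<in> span (?E (\<lambda>c. c \<ge> b i))"
        by (rule subsetD[OF span_mono u'(1)]) (blast intro: less_imp_le)
      ultimately have "(u - u') + u' \<in> span (?E (\<lambda>c. c \<ge> b i))" by (rule span_add)
      then show "u \<in> span (?E (\<lambda>c. c \<ge> b i))" by simp
    qed
  qed
  have "span (\<Union>i\<in>I. U i) \<subseteq> span (?E (\<lambda>c. True))"
  proof (rule span_minimal)
    show "(\<Union>i\<in>I. U i) \<subseteq> span (?E (\<lambda>c. True))"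
    proof
      fix u assume "u \<in> (\<Union>i\<in>I. U i)"
      then obtain i where "i \<in> I" "u \<in> U i" by blast
      then have "u \<in> span (?E (\<lambda>c. c \<ge> b i))" using main by blast
      also have "\<dots> \<subseteq> span (?E (\<lambda>c. True))" by (rule span_mono) auto
      finally show "u \<in> span (?E (\<lambda>c. True))" .
    qed
  qed simp
  then have "V \<subseteq> span (?E (\<lambda>c. True))" by (simp only: V)
  moreover obtain B where B: "B \<subseteq> ?E (\<lambda>c. True)" "independent B" "?E (\<lambda>c. True) \<subseteq> span B"
    using maximal_independent_subset[of "?E (\<lambda>c. True)"] by blast
  moreover have "span (?E (\<lambda>c. True)) \<subseteq> span B" by (rule span_minimal[OF B(3) subspace_span])
  moreover have "span B \<subseteq> V" using B(1) sV by (intro span_minimal) auto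
  ultimately have "span B = V" by blast
  then show ?thesis using B unfolding diagonalisable_on_def module_dependent_eq by (intro exI[of _ B]) auto
qed

text \<open>Negating the operator turns strictly decreasing eigenvalues into strictly increasing
  ones, the form that \<open>diagonalisable_filtered\<close> expects.\<close>

lemma diagonalisable_on_uminus:
  assumes "diagonalisable_on V (\<lambda>x. - T x)"
  shows "diagonalisable_on V T"
proof -
  have "\<exists>c. T v = c *\<^sub>R v" if "- T v = c *\<^sub>R v" for v c
    using that by (intro exI[of _ "- c"]) (metis minus_minus scaleR_minus_left)
  then show ?thesis using assms unfolding diagonalisable_on_def by blast
qed

section \<open>The operator as a finite sum over compositions\<close>

abbreviation nz :: "nat list \<Rightarrow> nat list" where "nz \<equiv> filter (\<lambda>d. d \<noteq> 0)"

definition comps :: "nat \<Rightarrow> nat list set" where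
  "comps n = {C. sum_list C = n \<and> 0 \<notin> set C}"

text \<open>The total coefficient of all weak-compositions that become \<open>C\<close> when zero
  parts are dropped. There are infinitely many of them for each \<open>C\<close>, but only finitely
  many \<open>C\<close>.\<close>

definition comp_weight :: "nat \<Rightarrow> nat list pmf \<Rightarrow> nat list \<Rightarrow> real" where
  "comp_weight n P C = (\<Sum>\<^sub>\<infinity>D\<in>weak_compositions n. if nz D = C then pmf P D / multinomial n D else 0)"

lemma length_le_sum_list: "0 \<notin> set C \<Longrightarrow> length C \<le> sum_list (C :: nat list)"
  by (induction C) (auto simp: Suc_le_eq intro: add_less_le_mono)

lemma finite_comps: "finite (comps n)"
proof (rule finite_subset)
  show "comps n \<subseteq> {C. set C \<subseteq> {..n} \<and> length C \<le> n}"
    using member_le_sum_list length_le_sum_list by (fastforce simp: comps_def)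
qed (simp add: finite_lists_length_le)

lemma nz_comps: "D \<in> weak_compositions n \<Longrightarrow> nz D \<in> comps n"
proof -
  have "sum_list (nz D) = sum_list D" by (induction D) auto
  then show "D \<in> weak_compositions n \<Longrightarrow> nz D \<in> comps n"
    by (auto simp: comps_def weak_compositions_def)
qed

text \<open>The product of the factorials divides \<open>fact n\<close>. The bound keeps each
  coefficient below the probability \<open>pmf P D\<close>, from which summability follows.\<close>

lemma multinomial_ge_1:
  assumes "D \<in> weak_compositions n"
  shows "multinomial n D \<ge> 1"
proof -
  have "prod_list (map fact D) dvd (fact (sum_list D) :: nat)"
  proof (induction D)
    case (Cons d D)
    then have "fact d * prod_list (map fact D) dvd (fact d * fact (sum_list D) :: nat)"
      by (intro mult_dvd_mono) auto
    also have "\<dots> dvd fact (d + sum_list D)" by (rule fact_fact_dvd_fact)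
    finally show ?case by simp
  qed simp
  then have "prod_list (map fact D) \<le> (fact n :: nat)"
    using assms by (intro dvd_imp_le) (auto simp: weak_compositions_def)
  moreover have "real (prod_list (map fact D)) = prod_list (map fact D)" by (induction D) simp_all
  moreover have "prod_list (map fact D) > (0::real)" by (induction D) simp_all
  ultimately show ?thesis unfolding multinomial_def
    by (metis (mono_tags) le_divide_eq_1_pos of_nat_fact of_nat_le_iff)
qed

lemma comp_weight_has_sum:
  "((\<lambda>D. if nz D = C then pmf P D / multinomial n D else 0) has_sum comp_weight n P C) (weak_compositions n)"
  "comp_weight n P C \<ge> 0"
proof -
  let ?f = "\<lambda>D. if nz D = C then pmf P D / multinomial n D else 0"
  have f: "0 \<le> ?f D" "?f D \<le> pmf P D" if D: "D \<in> weak_compositions n" for D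
  proof -
    have "pmf P D / multinomial n D \<le> pmf P D / 1"
      using multinomial_ge_1[OF D] by (intro divide_left_mono) auto
    then show "0 \<le> ?f D" "?f D \<le> pmf P D" using multinomial_ge_1[OF D] by auto
  qed
  have "?f summable_on weak_compositions n"
  proof (rule nonneg_bdd_above_summable_on)
    show "bdd_above (sum ?f ` {F. F \<subseteq> weak_compositions n \<and> finite F})"
    proof (rule bdd_aboveI2)
      fix F assume F: "F \<in> {F. F \<subseteq> weak_compositions n \<and> finite F}"
      then have "sum ?f F \<le> sum (pmf P) F" by (intro sum_mono f(2)) auto
      also have "\<dots> = measure (measure_pmf P) F" using F by (simp add: measure_measure_pmf_finite)
      also have "\<dots> \<le> 1" by (rule measure_pmf.prob_le_1)
      finally show "sum ?f F \<le> 1" .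
    qed
  qed (rule f(1))
  then show "(?f has_sum comp_weight n P C) (weak_compositions n)"
    unfolding comp_weight_def by (rule has_sum_infsum)
  show "comp_weight n P C \<ge> 0" unfolding comp_weight_def by (intro infsum_nonneg f(1))
qed

lemma has_sum_sum:
  fixes f :: "'i \<Rightarrow> 'j \<Rightarrow> real"
  assumes "finite I" "\<And>i. i \<in> I \<Longrightarrow> (f i has_sum s i) A"
  shows "((\<lambda>x. \<Sum>i\<in>I. f i x) has_sum (\<Sum>i\<in>I. s i)) A"
  using assms by (induction I rule: finite_induct) (auto intro: has_sum_add)

text \<open>A quantity that ignores zero parts is summed by grouping weak-compositions with the same
  nonzero parts. Applied to \<open>beta\<close> and to the operators alike, it gives eigenvalue and
  operator the same coefficients.\<close>

lemma has_sum_by_composition: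
  "((\<lambda>D. pmf P D / multinomial n D * h (nz D)) has_sum (\<Sum>C\<in>comps n. comp_weight n P C * h C)) (weak_compositions n)"
proof -
  have "((\<lambda>D. \<Sum>C\<in>comps n. (if nz D = C then pmf P D / multinomial n D else 0) * h C) has_sum
    (\<Sum>C\<in>comps n. comp_weight n P C * h C)) (weak_compositions n)"
    by (intro has_sum_sum finite_comps has_sum_cmult_left comp_weight_has_sum)
  moreover have "(\<Sum>C\<in>comps n. (if nz D = C then pmf P D / multinomial n D else 0) * h C) =
     pmf P D / multinomial n D * h (nz D)" if "D \<in> weak_compositions n" for D
    using nz_comps[OF that] finite_comps by (simp add: if_distrib[of "\<lambda>x. x * _"] cong: if_cong)
  ultimately show ?thesis by (simp cong: has_sum_cong)
qed

lemma beta_P_eq: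
  assumes "0 \<notin> set lam"
  shows "beta_P n P lam = (\<Sum>C\<in>comps n. comp_weight n P C * beta C lam)"
  unfolding beta_P_def using has_sum_by_composition[of P n "\<lambda>C. real (beta C lam)"]
  unfolding beta_remove_zeros[OF assms] by (rule infsumI)

lemma vector_infsum_eqI:
  assumes "\<And>\<phi> :: 'v::real_vector \<Rightarrow> real. linear \<phi> \<Longrightarrow> ((\<lambda>i. \<phi> (f i)) has_sum \<phi> y) A"
  shows "vector_infsum f A = y"
  unfolding vector_infsum_def
proof (rule the_equality)
  show "\<forall>\<phi> :: 'v \<Rightarrow> real. linear \<phi> \<longrightarrow> ((\<lambda>i. \<phi> (f i)) has_sum \<phi> y) A" by (intro allI impI assms)
  fix z assume z: "\<forall>\<phi> :: 'v \<Rightarrow> real. linear \<phi> \<longrightarrow> ((\<lambda>i. \<phi> (f i)) has_sum \<phi> z) A"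
  show "z = y"
  proof (rule ccontr)
    assume "z \<noteq> y"
    then have "z - y \<notin> {0}" by simp
    then obtain \<phi> :: "'v \<Rightarrow> real" where \<phi>: "linear \<phi>" "\<phi> (z - y) = 1"
      by (rule linear_separation[OF _ subspace_single_0])
    have "\<phi> z = \<phi> y" using has_sum_unique[OF z[rule_format, OF \<phi>(1)] assms[OF \<phi>(1)]] .
    with \<phi> show False by (simp add: linear_diff)
  qed
qed

lemma beta_P_less:
  assumes "0 \<notin> set lam" "0 \<notin> set mu" "\<And>C. beta C lam \<le> beta C mu"
    "beta C lam < beta C mu" "C \<in> comps n" "comp_weight n P C > 0"
  shows "beta_P n P lam < beta_P n P mu"
  unfolding beta_P_eq[OF assms(1)] beta_P_eq[OF assms(2)]
proof (rule sum_strict_mono_ex1[OF finite_comps])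
  show "\<forall>C\<in>comps n. comp_weight n P C * beta C lam \<le> comp_weight n P C * beta C mu"
    using assms(3) comp_weight_has_sum(2) by (auto intro: mult_left_mono)
  show "\<exists>C\<in>comps n. comp_weight n P C * beta C lam < comp_weight n P C * beta C mu"
    using assms(4-6) by (intro bexI[of _ C]) auto
qed

section \<open>The operators on words, and the commutative case\<close>

context graded_connected_hopf_algebra_fd
begin

text \<open>By connectedness the projection to degree 0 is the unit of convolution; this is why zero
  parts may be dropped from \<open>op\<close>.\<close>

lemma pr_0: "pr 0 = (\<lambda>x. \<epsilon> x *\<^sub>R 1)"
proof (rule ext, rule H_induct[of "pr 0" "\<lambda>x. \<epsilon> x *\<^sub>R 1"])
  show "linear (pr 0)" "linear (\<lambda>x. \<epsilon> x *\<^sub>R 1 :: 'a)" by (intro linear_pr linear_scaleR_vec linear_counit)+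
  show "pr 0 x = \<epsilon> x *\<^sub>R 1" if "x \<in> H i" for i x
    using that H_0_eq[of x] counit_in_H[of x i] by (cases "i = 0") (auto simp: pr_H)
qed

abbreviation op :: "nat list \<Rightarrow> 'a \<Rightarrow> 'a" where "op D \<equiv> convs (map pr D)"

lemma linear_op: "linear (op D)"
  by (rule linear_convs) (simp add: linear_pr)

lemma op_nz: "op (nz D) = op D"
  by (induction D) (simp_all add: pr_0 conv_unit_left linear_op)

definition opP :: "nat \<Rightarrow> nat list pmf \<Rightarrow> 'a \<Rightarrow> 'a" where
  "opP n P x = (\<Sum>C\<in>comps n. comp_weight n P C *\<^sub>R op C x)"

lemma linear_opP: "linear (opP n P)"
  unfolding opP_def[abs_def] by (intro linear_compose_sum ballI linear_scaleR_real linear_op)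

lemma mDelta_P_eq: "mDelta_P H \<Delta> \<epsilon> n P = opP n P"
proof
  fix x
  show "mDelta_P H \<Delta> \<epsilon> n P x = opP n P x"
    unfolding mDelta_P_def
  proof (rule vector_infsum_eqI)
    fix \<phi> :: "'a \<Rightarrow> real" assume \<phi>: "linear \<phi>"
    show "((\<lambda>D. \<phi> ((pmf P D / multinomial n D) *\<^sub>R mDelta H \<Delta> \<epsilon> D x)) has_sum \<phi> (opP n P x)) (weak_compositions n)"
      using has_sum_by_composition[of P n "\<lambda>C. \<phi> (op C x)"] unfolding op_nz
      by (simp add: linear_scale[OF \<phi>] linear_sum[OF \<phi>] opP_def mDelta_eq_convs)
  qed
qed

text \<open>Arbitrary valid letters subject to \<open>Q\<close> are allowed, not only generators,
  and the order of \<open>lam\<close> counts. These sets may overlap, which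
  \<open>diagonalisable_filtered\<close> permits.\<close>

definition words :: "('a letter \<Rightarrow> bool) \<Rightarrow> nat list \<Rightarrow> 'a set" where
  "words Q lam = {lpr ys | ys. valids ys \<and> (\<forall>l\<in>set ys. Q l) \<and> map dg ys = lam}"

text \<open>The number of expansions of unchanged length is \<open>beta\<close>, so subtracting one
  copy of the word for each of them removes the diagonal term. What remains is to place the
  difference for each single expansion; the three triangularity arguments differ only in
  this.\<close>

lemma opP_diff_in_span:
  assumes ys: "valids ys" and lab: "\<And>j. j < length ys \<Longrightarrow> lb (ys ! j) = j" and n: "ldg ys = n"
    and step: "\<And>C zs. C \<in> comps n \<Longrightarrow> comp_weight n P C > 0 \<Longrightarrow> zs \<in> set (expansions red C 0 ys) \<Longrightarrow>
      lpr (map fst zs) - (if length zs = length ys then lpr ys else 0) \<in> span W"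
  shows "opP n P (lpr ys) - beta_P n P (map dg ys) *\<^sub>R lpr ys \<in> span W"
proof -
  have z: "0 \<notin> set (map dg ys)" using ys by (auto simp: valid_def)
  have "op C (lpr ys) - real (beta C (map dg ys)) *\<^sub>R lpr ys \<in> span W" if C: "C \<in> comps n" "comp_weight n P C > 0" for C
  proof -
    let ?Z = "expansions red C 0 ys"
    have "(\<Sum>zs\<leftarrow>Z. if length zs = length ys then lpr ys else 0) = real (length (filter (\<lambda>zs. length zs = length ys) Z)) *\<^sub>R lpr ys"
      for Z :: "('a letter \<times> nat) list list"
      by (induction Z) (auto simp: algebra_simps)
    then have "op C (lpr ys) - real (beta C (map dg ys)) *\<^sub>R lpr ys =
      (\<Sum>zs\<leftarrow>?Z. lpr (map fst zs)) - (\<Sum>zs\<leftarrow>?Z. if length zs = length ys then lpr ys else 0)"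
      by (simp add: convs_pr_lpr[OF ys, of C 0] count_expansions_red count_assignments_eq_beta)
    also have "\<dots> = (\<Sum>zs\<leftarrow>?Z. lpr (map fst zs) - (if length zs = length ys then lpr ys else 0))"
      by (rule sum_list_subtractf[symmetric])
    also have "\<dots> \<in> span W"
      by (rule sum_list_in_subspace[OF subspace_span]) (use step C in auto)
    finally show ?thesis .
  qed
  then have "comp_weight n P C *\<^sub>R (op C (lpr ys) - real (beta C (map dg ys)) *\<^sub>R lpr ys) \<in> span W" if "C \<in> comps n" for C
    using that comp_weight_has_sum(2)[of n P C] by (cases "comp_weight n P C = 0") (auto intro: span_scale simp: span_zero)
  then have "(\<Sum>C\<in>comps n. comp_weight n P C *\<^sub>R (op C (lpr ys) - real (beta C (map dg ys)) *\<^sub>R lpr ys)) \<in> span W"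
    by (rule span_sum)
  then show ?thesis
    by (simp add: opP_def beta_P_eq[OF z] scaleR_diff_right sum_subtractf scaleR_sum_left)
qed

text \<open>Labels become positions, so that after the expansion the label of a letter tells which
  original letter it comes from.\<close>

definition relabel :: "'a letter list \<Rightarrow> 'a letter list" where
  "relabel ys = map (\<lambda>j. Letter (val (ys ! j)) (wt (ys ! j)) (dg (ys ! j)) j) [0..<length ys]"

lemma relabel_props:
  "length (relabel ys) = length ys"
  "j < length ys \<Longrightarrow> lb (relabel ys ! j) = j"
  "map val (relabel ys) = map val ys" "map dg (relabel ys) = map dg ys" "map wt (relabel ys) = map wt ys"
  "valids ys \<Longrightarrow> valids (relabel ys)"
  by (auto simp: relabel_def valid_def intro: nth_equalityI)

text \<open>The labels map the letters of the expansion onto the original ones, and the degrees with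
  a given label add up to the original degree; so the new type refines the old one. If a letter was
  cut, the slots of the expansion are an assignment that separates two of its parts.\<close>

lemma beta_expansion:
  assumes zs: "zs \<in> set (expansions red C 0 ys)" and ys: "valids ys"
    and lab: "\<And>j. j < length ys \<Longrightarrow> lb (ys ! j) = j"
  shows "beta D (map dg ys) \<le> beta D (map (\<lambda>z. dg (fst z)) zs)"
    and "length zs \<noteq> length ys \<Longrightarrow> beta C (map dg ys) < beta C (map (\<lambda>z. dg (fst z)) zs)"
proof -
  note ex = expansions_red[OF _ _ _ zs]
  have labs: "(\<lambda>z. lb (fst z)) ` set zs = {..<length ys}"
  proof -
    have "lb ` set ys = lb ` (!) ys ` {0..<length ys}" using nth_image[of "length ys" ys] by simp
    also have "\<dots> = (\<lambda>j. j) ` {0..<length ys}" unfolding image_image by (rule image_cong) (simp_all add: lab)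
    finally show ?thesis using ex(3) by (simp add: atLeast0LessThan)
  qed
  let ?r = "\<lambda>s. lb (fst (zs ! s))" and ?ns = "map (\<lambda>z. dg (fst z)) zs"
  have r: "?r s < length (map dg ys)" if "s < length ?ns" for s
    using labs nth_mem[of s zs] that by auto
  have surj: "\<exists>s<length ?ns. ?r s = j" if "j < length (map dg ys)" for j
  proof -
    have "j \<in> (\<lambda>z. lb (fst z)) ` set zs" using labs that by simp
    then obtain z where "z \<in> set zs" "lb (fst z) = j" by auto
    then obtain s where "s < length zs" "lb (fst (zs ! s)) = j" by (metis in_set_conv_nth)
    then show ?thesis by auto
  qed
  have sums: "map dg ys ! j = (\<Sum>s<length ?ns. if ?r s = j then ?ns ! s else 0)" if j: "j < length (map dg ys)" for j
  proof -
    have "(\<Sum>l\<leftarrow>ys. if lb l = j then dg l else 0) = (\<Sum>s<length ys. if s = j then dg (ys ! s) else 0)"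
      unfolding sum_list_if_nth by (rule sum.cong) (auto simp: lab)
    also have "\<dots> = dg (ys ! j)" using j by simp
    finally show ?thesis using ex(2)[of j] j by (simp add: sum_list_if_nth cong: if_cong)
  qed
  show "beta D (map dg ys) \<le> beta D ?ns" by (rule beta_refine(1)[OF r surj sums])
  assume "length zs \<noteq> length ys"
  then have "mset (map fst zs) \<noteq> mset ys" by (metis length_map size_mset)
  then obtain z z' where z: "z \<in> set zs" "z' \<in> set zs" "lb (fst z) = lb (fst z')" "snd z \<noteq> snd z'"
    using ex(7) by blast
  then obtain s s' where s: "s < length zs" "s' < length zs" "zs ! s = z" "zs ! s' = z'" by (metis in_set_conv_nth)
  have a: "map snd zs \<in> assigns C ?ns"
    by (rule assigns_of_pairs) (use ex(4,5) in auto)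
  show "beta C (map dg ys) < beta C ?ns"
    by (rule beta_refine(2)[OF r surj sums a, of s s']) (use s z in auto)
qed

lemma sum_list_comps: "valids ys \<Longrightarrow> map dg ys \<in> comps (ldg ys)"
  by (auto simp: comps_def valid_def)

lemma lpr_degree_expansions:
  assumes "zs \<in> set (expansions red D i ys)"
  shows "ldg (map fst zs) = ldg ys"
proof -
  have "ldg (map fst zs) = (\<Sum>z\<leftarrow>zs. \<Sum>s<length D. if snd z = i + s then dg (fst z) else 0)"
    using expansions_red(4)[OF _ _ _ assms] unfolding map_map o_def
    by (intro arg_cong[of _ _ sum_list] map_cong refl) (fastforce dest: subsetD simp: le_iff_add)
  also have "\<dots> = (\<Sum>s<length D. D ! s)"
    unfolding sum_list_sum_swap using expansions_red(5)[OF _ _ _ assms] by (intro sum.cong) auto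
  also have "\<dots> = sum_list D" by (simp add: sum_list_sum_nth atLeast0LessThan)
  also have "\<dots> = ldg ys" using expansions_red(8)[OF _ _ _ assms] by simp
  finally show ?thesis .
qed

lemma lpr_perm_commutative:
  assumes "\<And>x y :: 'a. x * y = y * x"
  shows "mset xs = mset ys \<Longrightarrow> lpr xs = (lpr ys :: 'a)"
proof (induction xs arbitrary: ys)
  case (Cons x xs)
  then have "x \<in> set ys" by (metis list.set_intros(1) set_mset_mset)
  then obtain us vs where ys: "ys = us @ x # vs" by (meson split_list)
  then have "lpr xs = lpr (us @ vs)" using Cons.prems by (intro Cons.IH) simp
  then show ?case using assms[of "val x" "lpr us"] by (simp add: ys flip: mult.assoc)
qed simp

lemma words_subset_H: "lam \<in> comps n \<Longrightarrow> words Q lam \<subseteq> H n"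
  using lpr_in_H by (fastforce simp: words_def comps_def)

lemma diagonalisable_commutative:
  assumes comm: "\<And>x y :: 'a. x * y = y * x"
  shows "diagonalisable_on (H n) (opP n P)"
proof (rule diagonalisable_filtered[OF linear_opP finite_comps])
  let ?U = "words (\<lambda>_. True)"
  have "H n \<subseteq> span (\<Union>lam\<in>comps n. ?U lam)"
  proof
    fix x assume x: "x \<in> H n"
    show "x \<in> span (\<Union>lam\<in>comps n. ?U lam)"
    proof (cases "n = 0")
      case True
      have "1 \<in> (\<Union>lam\<in>comps n. ?U lam)" using True by (auto simp: words_def comps_def intro!: exI[of _ "[]"])
      then have "\<epsilon> x *\<^sub>R 1 \<in> span (\<Union>lam\<in>comps n. ?U lam)" by (intro span_scale span_base)
      then show ?thesis using H_0_eq x True by metis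
    next
      case False
      \<comment> \<open>An element of \<open>H n\<close> has weight at most \<open>n\<close> and is
        itself a one-letter word, so spanning is immediate.\<close>
      have "x \<in> ?U [n]"
        using x False H_subset_F[OF x] by (auto simp: words_def valid_def intro!: exI[of _ "[Letter x n n 0]"])
      moreover have "[n] \<in> comps n" using False by (simp add: comps_def)
      ultimately show ?thesis by (intro span_base) blast
    qed
  qed
  moreover have "span (\<Union>lam\<in>comps n. ?U lam) \<subseteq> H n"
    by (rule span_minimal[OF _ subspace_H]) (use words_subset_H in blast)
  ultimately show "span (\<Union>lam\<in>comps n. ?U lam) = H n" by blast
  fix lam u assume lam: "lam \<in> comps n" and u: "u \<in> ?U lam"
  from u obtain ys0 where ys0: "valids ys0" "map dg ys0 = lam" "u = lpr ys0" by (auto simp: words_def)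
  define ys where "ys = relabel ys0"
  have ys: "valids ys" "map dg ys = lam" "u = lpr ys" "ldg ys = n" "\<And>j. j < length ys \<Longrightarrow> lb (ys ! j) = j"
    using relabel_props(1,3,4,5)[of ys0] relabel_props(2)[where ys = ys0] relabel_props(6)[of ys0] ys0 lam by (auto simp: ys_def comps_def)
  have z: "0 \<notin> set lam" using lam by (simp add: comps_def)
  show "opP n P u - beta_P n P lam *\<^sub>R u \<in>
    span (\<Union>mu\<in>{mu \<in> comps n. beta_P n P mu > beta_P n P lam}. ?U mu)"
    unfolding ys(3) ys(2)[symmetric]
  proof (rule opP_diff_in_span[OF ys(1,5,4)])
    fix C zs assume C: "C \<in> comps n" "comp_weight n P C > 0" and zs: "zs \<in> set (expansions red C 0 ys)"
    note v = valids_expansions[OF ys(1) zs]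
    show "lpr (map fst zs) - (if length zs = length ys then lpr ys else 0) \<in>
      span (\<Union>mu\<in>{mu \<in> comps n. beta_P n P mu > beta_P n P (map dg ys)}. ?U mu)"
    proof (cases "length zs = length ys")
      case True
      then have "lpr (map fst zs) = lpr ys"
        using expansions_red(7)[OF _ _ _ zs] by (intro lpr_perm_commutative[OF comm]) auto
      then show ?thesis using True by (simp add: span_zero)
    next
      case False
      let ?mu = "map dg (map fst zs)"
      have mu: "?mu = map (\<lambda>z. dg (fst z)) zs" by simp
      have "ldg (map fst zs) = n"
        using lpr_degree_expansions[OF zs] ys(4) by simp
      then have mun: "?mu \<in> comps n" using sum_list_comps[OF v] by simp
      have "beta_P n P lam < beta_P n P ?mu"
        by (rule beta_P_less[OF z _ _ _ C])
          (use mun beta_expansion[OF zs ys(1,5)] False in \<open>auto simp: mu ys(2)[symmetric] comps_def simp del: map_map\<close>)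
      moreover have "lpr (map fst zs) \<in> ?U ?mu" 
        using v unfolding words_def by (intro CollectI exI[of _ "map fst zs"]) simp
      ultimately show ?thesis using mun False by (auto simp: ys(2) simp del: map_map intro!: span_base)
    qed
  qed
qed

section \<open>The cocommutative case\<close>

lemma coproduct_primitive:
  assumes "a \<in> F 1 m" "m > 0"
  shows "\<Delta> a = (\<Sum>(x, y)\<leftarrow>[(a, 1), (1, a)]. pure_tensor [x, y])"
proof (rule coproduct_reduced[OF assms])
  fix L assume L: "\<Delta> a = pure_tensor [a, 1] + pure_tensor [1, a] + (\<Sum>(a, b)\<leftarrow>L. pure_tensor [a, b])"
    "\<And>a b. (a, b) \<in> set L \<Longrightarrow> \<exists>i j. 0 < i \<and> i < 1 \<and> 0 < j \<and> j < m \<and> a \<in> F i j \<and> b \<in> F (1 - i) (m - j)"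
  have "L = []"
  proof (rule ccontr)
    assume "L \<noteq> []"
    then obtain x y where "(x, y) \<in> set L" by (metis list.set_intros(1) neq_Nil_conv surj_pair)
    from L(2)[OF this] show False by auto
  qed
  with L(1) show ?thesis by simp
qed

text \<open>\<open>a\<close> is primitive, so it enters exactly one of the convolution factors. That
  factor sees nothing else up to scalars, since \<open>b\<close> has level \<open>k\<close> and the
  other \<open>k\<close> functionals need all of it. The value is therefore a sum over the choices
  of the factor.\<close>

lemma convs_primitive_mult:
  "set w \<subseteq> J \<Longrightarrow> length w = Suc k \<Longrightarrow> a \<in> F 1 m \<Longrightarrow> m > 0 \<Longrightarrow> b \<in> F k n \<Longrightarrow>
    convs w (a * b) = (\<Sum>j<Suc k. (w ! j) a * convs (take j w @ drop (Suc j) w) b)"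
proof (induction w arbitrary: k b n)
  case (Cons f w)
  note prems = Cons.prems
  have fJ: "f \<in> J" "set w \<subseteq> J" and lw: "length w = k" using prems by auto
  obtain L where L: "\<Delta> b = (\<Sum>(x, y)\<leftarrow>L. pure_tensor [x, y])"
    "\<And>x y. (x, y) \<in> set L \<Longrightarrow> \<exists>i\<le>k. \<exists>m\<le>n. x \<in> F i m \<and> y \<in> F (k - i) (n - m)"
    using coproduct_F[OF prems(5)] by metis
  have rest: "set (take j w @ drop (Suc j) w) \<subseteq> J" for j
    using fJ(2) set_take_subset[of j w] set_drop_subset[of "Suc j" w] by auto
  have first: "f (a * x) * convs w y = f a * (\<epsilon> x * convs w y)" if xy: "(x, y) \<in> set L" for x y
  proof -
    obtain i m' where i: "i \<le> k" "x \<in> F i m'" "y \<in> F (k - i) (n - m')" using L(2)[OF xy] by blast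
    show ?thesis
    proof (cases "i = 0")
      case True
      then have "x = \<epsilon> x *\<^sub>R 1" using H_0_eq[OF F_0_subset_H_0] i(2) by blast
      then have "a * x = \<epsilon> x *\<^sub>R a" by (metis mult_scaleR_right mult_1_right)
      then show ?thesis by (simp add: linear_scale[OF linear_J[OF fJ(1)]])
    next
      case False
      then have "convs w y = 0" using i(1,3) fJ(2) lw by (simp add: E_def)
      then show ?thesis by simp
    qed
  qed
  have second: "f x * convs w (a * y) = f x * (\<Sum>j<k. (w ! j) a * convs (take j w @ drop (Suc j) w) y)"
    if xy: "(x, y) \<in> set L" for x y
  proof -
    obtain i m' where i: "i \<le> k" "x \<in> F i m'" "y \<in> F (k - i) (n - m')" using L(2)[OF xy] by blast
    show ?thesis
    proof (cases "i = 0")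
      case True
      then show ?thesis using J_H_0[OF fJ(1) F_0_subset_H_0] i(2) by simp
    next
      case False
      then obtain k' where k': "k = Suc k'" using i(1) by (cases k) auto
      have "y \<in> F k' (n - m')" using False k' by (intro F_mono[OF i(3)]) simp
      from Cons.IH[OF fJ(2) _ prems(3,4) this] lw k' show ?thesis by (simp del: sum.lessThan_Suc)
    qed
  qed
  have bil: "bilinear (\<lambda>x y. f x * convs (take j w @ drop (Suc j) w) y)" for j
    by (rule bilinear_convs[OF fJ(1) rest])
  have "convs (f # w) (a * b) = (\<Sum>q\<leftarrow>L. f (a * fst q) * convs w (snd q)) + (\<Sum>q\<leftarrow>L. f (fst q) * convs w (a * snd q))"
    unfolding convs_Cons conv_def cop_mult_repr[OF bilinear_convs[OF fJ] coproduct_primitive[OF prems(3,4)] L(1)]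
    by simp
  also have "(\<Sum>q\<leftarrow>L. f (a * fst q) * convs w (snd q)) = (\<Sum>q\<leftarrow>L. f a * (\<epsilon> (fst q) * convs w (snd q)))"
    by (rule sum_list_cong) (auto simp: first)
  also have "\<dots> = f a * convs w b"
  proof -
    have "bilinear (\<lambda>x y. \<epsilon> x *\<^sub>R convs w y)"
      by (intro bilinearI linear_scaleR_vec linear_scaleR_real linear_counit linear_convs_J[OF fJ(2)])
    from cop_eq[OF this L(1)] cop_counit_left[OF linear_convs_J[OF fJ(2)], of b]
    have "convs w b = (\<Sum>q\<leftarrow>L. \<epsilon> (fst q) * convs w (snd q))" by (simp add: case_prod_unfold)
    then show ?thesis by (simp add: sum_list_const_mult)
  qed
  also have "(\<Sum>q\<leftarrow>L. f (fst q) * convs w (a * snd q)) =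
      (\<Sum>q\<leftarrow>L. \<Sum>j<k. (w ! j) a * (f (fst q) * convs (take j w @ drop (Suc j) w) (snd q)))"
    by (rule sum_list_cong) (auto simp: second sum_distrib_left mult_ac)
  also have "\<dots> = (\<Sum>j<k. (w ! j) a * convs (f # take j w @ drop (Suc j) w) b)"
    unfolding sum_list_sum_swap convs_Cons conv_def cop_eq[OF bil L(1)]
    by (simp add: sum_list_const_mult case_prod_unfold)
  finally show ?case by (simp add: sum.lessThan_Suc_shift del: sum.lessThan_Suc)
qed simp

definition primitive_words :: "nat \<Rightarrow> 'a set" where
  "primitive_words n = {lpr ys | ys. valids ys \<and> (\<forall>l\<in>set ys. wt l = 1) \<and> ldg ys = n}"

lemma primitive_words_mult:
  assumes "x \<in> span (primitive_words n)" "a \<in> F 1 m" "m > 0"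
  shows "a * x \<in> span (primitive_words (m + n))"
  using assms(1)
proof (induction rule: span_induct_alt)
  case base
  show ?case by (simp add: span_zero)
next
  case (step c x y)
  then obtain ys where ys: "x = lpr ys" "valids ys" "\<forall>l\<in>set ys. wt l = 1" "ldg ys = n"
    by (auto simp: primitive_words_def)
  have "a * x \<in> primitive_words (m + n)"
    using ys assms(2,3) unfolding primitive_words_def
    by (intro CollectI exI[of _ "Letter a 1 m 0 # ys"]) (auto simp: valid_def)
  then have "c *\<^sub>R (a * x) + a * y \<in> span (primitive_words (m + n))"
    by (intro span_add[OF span_scale step.IH] span_base)
  then show ?case by (simp add: algebra_simps)
qed

context
  assumes cocomm: "cocommutative \<Delta>"
begin

lemma conv_commute: "linear f \<Longrightarrow> linear g \<Longrightarrow> conv f g = conv g (f :: 'a \<Rightarrow> real)"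
  using cop_cocommutative[OF cocomm bilinear_mult, of f g]
  by (auto simp: conv_def fun_eq_iff mult.commute)

text \<open>Cocommutativity makes the convolution of real functionals commutative.\<close>

lemma convs_move:
  assumes "f \<in> J" "set us \<subseteq> J" "set vs \<subseteq> J"
  shows "convs (us @ f # vs) = convs (f # us @ vs)"
  using assms(2)
proof (induction us)
  case (Cons u us)
  have lin: "linear u" "linear f" "linear (convs (us @ vs))"
    using Cons.prems assms linear_J linear_convs_J[of "us @ vs"] by auto
  have "convs ((u # us) @ f # vs) = conv u (conv f (convs (us @ vs)))" using Cons by simp
  also have "\<dots> = conv (conv u f) (convs (us @ vs))" using lin by (simp add: conv_assoc)
  also have "\<dots> = conv (conv f u) (convs (us @ vs))" using lin by (simp add: conv_commute)
  also have "\<dots> = conv f (conv u (convs (us @ vs)))" using lin by (simp add: conv_assoc)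
  finally show ?case by simp
qed simp

text \<open>For \<open>x\<close> of weight \<open>k\<close> the sum of the products \<open>a * b\<close> over the terms of the coproduct
  of \<open>x\<close> with primitive \<open>a\<close> equals \<open>k\<close> times \<open>x\<close> up to lower weight.\<close>

lemma F_subset_span_primitive_words:
  "n > 0 \<Longrightarrow> x \<in> F k n \<Longrightarrow> x \<in> span (primitive_words n)"
proof (induction k arbitrary: n x)
  case 0
  then show ?case using F_0_eq[OF 0(2,1)] by (simp add: span_zero)
next
  case (Suc k)
  show ?case
  proof (cases "k = 0")
    case True
    have "x \<in> primitive_words n"
      using Suc.prems True unfolding primitive_words_def
      by (intro CollectI exI[of _ "[Letter x 1 n 0]"]) (auto simp: valid_def)
    then show ?thesis by (rule span_base)
  next
    case False
    obtain L where L: "\<Delta> x = pure_tensor [x, 1] + pure_tensor [1, x] + (\<Sum>(a, b)\<leftarrow>L. pure_tensor [a, b])"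
      "\<And>a b. (a, b) \<in> set L \<Longrightarrow> \<exists>i j. 0 < i \<and> i < Suc k \<and> 0 < j \<and> j < n \<and> a \<in> F i j \<and> b \<in> F (Suc k - i) (n - j)"
      using coproduct_reduced[OF Suc.prems(2,1)] by metis
    then have "\<forall>p\<in>set L. \<exists>i j. 0 < i \<and> i < Suc k \<and> 0 < j \<and> j < n \<and> fst p \<in> F i j \<and> snd p \<in> F (Suc k - i) (n - j)"
      by auto
    then obtain i j where ij: "\<And>p. p \<in> set L \<Longrightarrow>
        0 < i p \<and> i p < Suc k \<and> 0 < j p \<and> j p < n \<and> fst p \<in> F (i p) (j p) \<and> snd p \<in> F (Suc k - i p) (n - j p)"
      by metis
    \<comment> \<open>Only the terms whose first leg has level 1, that is a primitive first leg,
      survive under words of length \<open>k + 1\<close>.\<close>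
    define M where "M = filter (\<lambda>p. i p = 1) L"
    have M: "fst p \<in> F 1 (j p)" "snd p \<in> F k (n - j p)" "0 < j p" "j p < n" if "p \<in> set M" for p
      using ij[of p] that by (auto simp: M_def)
    define z where "z = (\<Sum>p\<leftarrow>M. fst p * snd p)"
    have zW: "z \<in> span (primitive_words n)"
      unfolding z_def
    proof (rule sum_list_in_subspace[OF subspace_span])
      fix p assume p: "p \<in> set M"
      have "snd p \<in> span (primitive_words (n - j p))" using M[OF p] by (intro Suc.IH) auto
      from primitive_words_mult[OF this M(1,3)[OF p]] M(4)[OF p]
      show "fst p * snd p \<in> span (primitive_words n)" by simp
    qed
    have zF: "z \<in> F (Suc k) n"
      unfolding z_def
    proof (rule sum_list_in_subspace[OF subspace_E])
      fix p assume p: "p \<in> set M"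
      show "fst p * snd p \<in> F (Suc k) n" using F_mult[OF M(1,2)[OF p]] M(4)[OF p] by simp
    qed
    have conv_x: "convs (f # w) x = (\<Sum>p\<leftarrow>M. f (fst p) * convs w (snd p))"
      if f: "f \<in> J" "set w \<subseteq> J" "length w = k" for f w
    proof -
      have "\<Delta> x = (\<Sum>(a, b)\<leftarrow>(x, 1) # (1, x) # L. pure_tensor [a, b])" using L(1) by simp
      from cop_eq[OF bilinear_convs[OF f(1,2)] this]
      have "convs (f # w) x = f x * convs w 1 + f 1 * convs w x + (\<Sum>p\<leftarrow>L. f (fst p) * convs w (snd p))"
        by (simp add: conv_def case_prod_unfold)
      moreover have "f 1 = 0" by (rule J_H_0[OF f(1) one_in_H])
      moreover have "convs w 1 = 0" using convs_vanish[OF f(2) one_in_H] False f(3) by simp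
      moreover have "(\<Sum>p\<leftarrow>L. f (fst p) * convs w (snd p)) = (\<Sum>p\<leftarrow>L. if i p = 1 then f (fst p) * convs w (snd p) else 0)"
      proof (rule sum_list_cong)
        fix p assume p: "p \<in> set L"
        have "convs w (snd p) = 0" if "i p \<noteq> 1" using ij[OF p] that f by (auto simp: E_def)
        then show "f (fst p) * convs w (snd p) = (if i p = 1 then f (fst p) * convs w (snd p) else 0)" by auto
      qed
      ultimately show ?thesis by (simp add: M_def sum_list_map_filter')
    qed
    \<comment> \<open>Each of the \<open>k + 1\<close> functionals may be the one that meets the
      primitive leg. As convolution is commutative, each choice contributes
      \<open>convs w x\<close>.\<close>
    have "convs w z = real (Suc k) * convs w x" if w: "set w \<subseteq> J" "length w = Suc k" for w
    proof -
      have wj: "w ! l \<in> J" "set (take l w @ drop (Suc l) w) \<subseteq> J" "length (take l w @ drop (Suc l) w) = k" if l: "l < Suc k" for l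
        using w that set_take_subset[of l w] set_drop_subset[of "Suc l" w] nth_mem[of l w] by auto
      have "convs w z = (\<Sum>p\<leftarrow>M. convs w (fst p * snd p))"
        unfolding z_def by (rule linear_sum_list[OF linear_convs_J[OF w(1)]])
      also have "\<dots> = (\<Sum>p\<leftarrow>M. \<Sum>l<Suc k. (w ! l) (fst p) * convs (take l w @ drop (Suc l) w) (snd p))"
        by (rule sum_list_cong) (rule convs_primitive_mult[OF w M(1,3,2)])
      also have "\<dots> = (\<Sum>l<Suc k. \<Sum>p\<leftarrow>M. (w ! l) (fst p) * convs (take l w @ drop (Suc l) w) (snd p))"
        by (rule sum_list_sum_swap)
      also have "\<dots> = (\<Sum>l<Suc k. convs w x)"
      proof (rule sum.cong[OF refl])
        fix l assume "l \<in> {..<Suc k}"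
        then have l: "l < Suc k" by simp
        have "(\<Sum>p\<leftarrow>M. (w ! l) (fst p) * convs (take l w @ drop (Suc l) w) (snd p)) =
            convs (w ! l # take l w @ drop (Suc l) w) x"
          by (rule conv_x[OF wj[OF l], symmetric])
        also have "\<dots> = convs (take l w @ w ! l # drop (Suc l) w) x"
          using wj(2)[OF l] by (subst convs_move[OF wj(1)[OF l]]) auto
        also have "take l w @ w ! l # drop (Suc l) w = w" using l w(2) by (simp flip: id_take_nth_drop)
        finally show "(\<Sum>p\<leftarrow>M. (w ! l) (fst p) * convs (take l w @ drop (Suc l) w) (snd p)) = convs w x" .
      qed
      finally show ?thesis by simp
    qed
    moreover have "x - (1 / real (Suc k)) *\<^sub>R z \<in> F (Suc k) n"
      by (intro subspace_diff[OF subspace_E] subspace_scale[OF subspace_E] Suc.prems zF)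
    \<comment> \<open>Words of length \<open>k + 1\<close> now vanish on the difference, which
      therefore drops to level \<open>k\<close>.\<close>
    ultimately have "x - (1 / real (Suc k)) *\<^sub>R z \<in> F k n"
      unfolding E_def by (auto simp: le_less linear_diff[OF linear_convs_J] linear_scale[OF linear_convs_J] Suc_le_eq
        dest: Suc_leI intro: le_neq_implies_less)
    then have "x - (1 / real (Suc k)) *\<^sub>R z \<in> span (primitive_words n)" by (rule Suc.IH[OF Suc.prems(1)])
    from span_add[OF this span_scale[OF zW, of "1 / real (Suc k)"]] show ?thesis by simp
  qed
qed

end

text \<open>The terms that arise when neighbouring letters in different slots are exchanged.\<close>

definition swaps :: "('a letter \<times> nat) list \<Rightarrow> 'a set" where
  "swaps us = {lpr (map fst xs) * (val p * val q - val q * val p) * lpr (map fst vs) | xs vs p q i j.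
     i \<noteq> j \<and> mset us = mset (xs @ (p, i) # (q, j) # vs)}"

lemma swaps_mset: "mset us = mset vs \<Longrightarrow> swaps us = swaps vs"
  by (simp add: swaps_def)

lemma swaps_mult:
  assumes "x \<in> span (swaps us)"
  shows "lpr (map fst ls) * x \<in> span (swaps (ls @ us))"
  using assms
proof (induction rule: span_induct_alt)
  case base
  show ?case by (simp add: span_zero)
next
  case (step c x y)
  then obtain xs vs p q i j where x: "x = lpr (map fst xs) * (val p * val q - val q * val p) * lpr (map fst vs)"
    "i \<noteq> j" "mset us = mset (xs @ (p, i) # (q, j) # vs)" unfolding swaps_def by blast
  have "lpr (map fst ls) * x \<in> swaps (ls @ us)"
    unfolding swaps_def
    by (intro CollectI exI[of _ "ls @ xs"] exI[of _ vs] exI[of _ p] exI[of _ q] exI[of _ i] exI[of _ j])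
      (simp add: x mult.assoc)
  then have "c *\<^sub>R (lpr (map fst ls) * x) + lpr (map fst ls) * y \<in> span (swaps (ls @ us))"
    by (intro span_add[OF span_scale step.IH] span_base)
  then show ?case by (simp add: algebra_simps)
qed

lemma swaps_move:
  assumes "s \<noteq> i"
  shows "lpr (map fst pre) * (lpr ls * val y - val y * lpr ls) * lpr (map fst us)
    \<in> span (swaps (pre @ map (\<lambda>l. (l, i)) ls @ (y, s) # us))"
proof (induction ls arbitrary: pre)
  case Nil
  show ?case by (simp add: span_zero)
next
  case (Cons l ls)
  have "lpr (map fst pre) * (val l * val y - val y * val l) * lpr (map fst (map (\<lambda>l. (l, i)) ls @ us))
      \<in> swaps (pre @ map (\<lambda>l. (l, i)) (l # ls) @ (y, s) # us)"
    unfolding swaps_def using assms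
    by (intro CollectI exI[of _ pre] exI[of _ "map (\<lambda>l. (l, i)) ls @ us"] exI[of _ l] exI[of _ y] exI[of _ i] exI[of _ s]) simp
  moreover have "lpr (map fst (pre @ [(l, i)])) * (lpr ls * val y - val y * lpr ls) * lpr (map fst us)
      \<in> span (swaps (pre @ map (\<lambda>l. (l, i)) (l # ls) @ (y, s) # us))"
    using Cons.IH[of "pre @ [(l, i)]"] by simp
  ultimately have "lpr (map fst (pre @ [(l, i)])) * (lpr ls * val y - val y * lpr ls) * lpr (map fst us) +
      lpr (map fst pre) * (val l * val y - val y * val l) * lpr (map fst (map (\<lambda>l. (l, i)) ls @ us))
      \<in> span (swaps (pre @ map (\<lambda>l. (l, i)) (l # ls) @ (y, s) # us))"
    by (rule span_add[OF _ span_base, rotated])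
  then show ?case by (simp add: o_def algebra_simps)
qed

text \<open>\<open>us\<close> is the original word with the slots attached. Restoring the original
  order moves a letter of the right part only past letters of the left part; the latter have slot
  \<open>i\<close> and the former other slots, so every exchange is between different slots.\<close>

lemma splits_swaps:
  assumes "A \<in> set (splits red ys)" "\<forall>l\<in>set ys. wt l = 1" "map fst us' = snd A" "i \<notin> snd ` set us'"
  shows "\<exists>us. map fst us = ys \<and> mset us = mset (map (\<lambda>l. (l, i)) (fst A) @ us') \<and>
    lpr (fst A) * lpr (snd A) - lpr ys \<in> span (swaps us)"
  using assms
proof (induction ys arbitrary: A us')
  case Nil
  then show ?case by (simp add: span_zero)
next
  case (Cons y ys)
  have "red y = []" using Cons.prems(2) by (intro red_primitive) simp
  then obtain B where B: "B \<in> set (splits red ys)" "A = (y # fst B, snd B) \<or> A = (fst B, y # snd B)"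
    using Cons.prems(1) by fastforce
  from B(2) show ?case
  proof
    assume A: "A = (y # fst B, snd B)"
    obtain us where us: "map fst us = ys" "mset us = mset (map (\<lambda>l. (l, i)) (fst B) @ us')"
      "lpr (fst B) * lpr (snd B) - lpr ys \<in> span (swaps us)"
      using Cons.IH[OF B(1), of us'] Cons.prems A by auto
    have "val y * (lpr (fst B) * lpr (snd B) - lpr ys) \<in> span (swaps ((y, i) # us))"
      using swaps_mult[OF us(3), of "[(y, i)]"] by simp
    then show ?thesis using us A by (intro exI[of _ "(y, i) # us"]) (simp add: algebra_simps)
  next
    assume A: "A = (fst B, y # snd B)"
    then obtain s us'' where us': "us' = (y, s) # us''" "map fst us'' = snd B" "s \<noteq> i"
      using Cons.prems(3,4) by (cases us') auto
    obtain us where us: "map fst us = ys" "mset us = mset (map (\<lambda>l. (l, i)) (fst B) @ us'')"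
      "lpr (fst B) * lpr (snd B) - lpr ys \<in> span (swaps us)"
      using Cons.IH[OF B(1), of us''] Cons.prems us' by auto
    have m: "mset ((y, s) # us) = mset (map (\<lambda>l. (l, i)) (fst B) @ (y, s) # us'')" using us(2) by simp
    have "val y * (lpr (fst B) * lpr (snd B) - lpr ys) \<in> span (swaps ((y, s) # us))"
      using swaps_mult[OF us(3), of "[(y, s)]"] by simp
    moreover have "(lpr (fst B) * val y - val y * lpr (fst B)) * lpr (snd B) \<in> span (swaps ((y, s) # us))"
      using swaps_move[OF us'(3), of "[]" "fst B" y us''] swaps_mset[OF m] us'(2) by simp
    ultimately have "val y * (lpr (fst B) * lpr (snd B) - lpr ys) + (lpr (fst B) * val y - val y * lpr (fst B)) * lpr (snd B)
      \<in> span (swaps ((y, s) # us))" by (rule span_add)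
    then show ?thesis using us us' A by (intro exI[of _ "(y, s) # us"]) (simp add: algebra_simps)
  qed
qed

lemma expansions_swaps:
  assumes "zs \<in> set (expansions red D i ys)" "\<forall>l\<in>set ys. wt l = 1"
  shows "\<exists>us. map fst us = ys \<and> mset us = mset zs \<and> lpr (map fst zs) - lpr ys \<in> span (swaps us)"
  using assms
proof (induction D arbitrary: i ys zs)
  case Nil
  then show ?case by (auto simp: span_zero split: if_splits)
next
  case (Cons d D)
  then obtain A zs' where A: "A \<in> set (splits red ys)" and zs': "zs' \<in> set (expansions red D (Suc i) (snd A))"
    and zs: "zs = map (\<lambda>l. (l, i)) (fst A) @ zs'" by (auto split: if_splits)
  have "set (snd A) \<subseteq> set ys" using A Cons.prems(2)
  proof (induction ys arbitrary: A)
    case (Cons y ys)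
    have "red y = []" using Cons.prems(2) by (intro red_primitive) simp
    then show ?case using Cons by fastforce
  qed simp
  then obtain us' where us': "map fst us' = snd A" "mset us' = mset zs'" "lpr (map fst zs') - lpr (snd A) \<in> span (swaps us')"
    using Cons.IH[OF zs'] Cons.prems(2) by blast
  have "set us' = set zs'" using us'(2) by (metis set_mset_mset)
  then have "i \<notin> snd ` set us'" using expansions_red(4)[OF _ _ _ zs'] by auto
  from splits_swaps[OF A Cons.prems(2) us'(1) this]
  obtain us where us: "map fst us = ys" "mset us = mset (map (\<lambda>l. (l, i)) (fst A) @ us')"
    "lpr (fst A) * lpr (snd A) - lpr ys \<in> span (swaps us)" by blast
  have "lpr (fst A) * (lpr (map fst zs') - lpr (snd A)) \<in> span (swaps us)"
    using swaps_mult[OF us'(3), of "map (\<lambda>l. (l, i)) (fst A)"] swaps_mset[OF us(2)] by (simp add: o_def)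
  from span_add[OF this us(3)]
  have "lpr (map fst zs) - lpr ys \<in> span (swaps us)" by (simp add: zs o_def algebra_simps)
  then show ?case using us us'(2) by (intro exI[of _ us]) (simp add: zs)
qed

lemma diagonalisable_cocommutative:
  assumes cocomm: "cocommutative \<Delta>"
  shows "diagonalisable_on (H n) (opP n P)"
proof (rule diagonalisable_on_uminus, rule diagonalisable_filtered[OF _ finite_comps])
  let ?U = "words (\<lambda>l. wt l = 1)"
  let ?b = "\<lambda>lam. - beta_P n P lam"
  show "linear (\<lambda>x. - opP n P x)" by (rule linear_compose_neg[OF linear_opP])
  have pw: "primitive_words n \<subseteq> (\<Union>lam\<in>comps n. ?U lam)"
    using sum_list_comps by (fastforce simp: primitive_words_def words_def)
  have "H n \<subseteq> span (\<Union>lam\<in>comps n. ?U lam)"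
  proof
    fix x assume x: "x \<in> H n"
    show "x \<in> span (\<Union>lam\<in>comps n. ?U lam)"
    proof (cases "n = 0")
      case True
      have "1 \<in> (\<Union>lam\<in>comps n. ?U lam)" using True by (auto simp: words_def comps_def intro!: exI[of _ "[]"])
      then have "\<epsilon> x *\<^sub>R 1 \<in> span (\<Union>lam\<in>comps n. ?U lam)" by (intro span_scale span_base)
      then show ?thesis using H_0_eq x True by metis
    next
      case False
      then have "x \<in> span (primitive_words n)"
        using F_subset_span_primitive_words[OF cocomm _ H_subset_F[OF x]] by simp
      then show ?thesis using span_mono[OF pw] by blast
    qed
  qed
  moreover have "span (\<Union>lam\<in>comps n. ?U lam) \<subseteq> H n"
    by (rule span_minimal[OF _ subspace_H]) (use words_subset_H in blast)
  ultimately show "span (\<Union>lam\<in>comps n. ?U lam) = H n" by blast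
  fix lam u assume lam: "lam \<in> comps n" and u: "u \<in> ?U lam"
  from u obtain ys0 where ys0: "valids ys0" "\<forall>l\<in>set ys0. wt l = 1" "map dg ys0 = lam" "u = lpr ys0"
    by (auto simp: words_def)
  define ys where "ys = relabel ys0"
  have ys: "valids ys" "map dg ys = lam" "u = lpr ys" "ldg ys = n" "\<And>j. j < length ys \<Longrightarrow> lb (ys ! j) = j"
    using relabel_props(1,3,4,5)[of ys0] relabel_props(2)[where ys = ys0] relabel_props(6)[of ys0] ys0 lam
    by (auto simp: ys_def comps_def)
  have "wt ` set ys = wt ` set ys0" using relabel_props(5)[of ys0] unfolding ys_def by (metis set_map)
  then have wt1: "\<forall>l\<in>set ys. wt l = 1" using ys0(2) by (metis image_iff)
  have z: "0 \<notin> set lam" using lam by (simp add: comps_def)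
  let ?W = "\<Union>mu\<in>{mu \<in> comps n. ?b mu > ?b lam}. ?U mu"
  have "opP n P u - beta_P n P lam *\<^sub>R u \<in> span ?W"
    unfolding ys(3) ys(2)[symmetric]
  proof (rule opP_diff_in_span[OF ys(1,5,4)])
    fix C zs assume C: "C \<in> comps n" "comp_weight n P C > 0" and zs: "zs \<in> set (expansions red C 0 ys)"
    note v = valids_expansions[OF ys(1) zs]
    have lwt: "lwt xs = length xs" if "\<forall>l\<in>set xs. wt l = 1" for xs :: "'a letter list"
      using that by (induction xs) auto
    have wt_ge: "lwt xs \<ge> length xs" if "valids xs" for xs
      using that by (induction xs) (auto simp: valid_def)
    \<comment> \<open>All letters of \<open>ys\<close> have weight 1 and the total weight is kept,
      so no letter is cut.\<close>
    have len: "length zs = length ys"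
      using expansions_red(1,6)[OF _ _ _ zs] lwt[OF wt1] wt_ge[OF v] by (simp add: o_def)
    obtain us where us: "map fst us = ys" "mset us = mset zs" "lpr (map fst zs) - lpr ys \<in> span (swaps us)"
      using expansions_swaps[OF zs wt1] by blast
    have "swaps us \<subseteq> ?W"
    proof
      fix x assume "x \<in> swaps us"
      then obtain xs vs p q i j where x: "x = lpr (map fst xs) * (val p * val q - val q * val p) * lpr (map fst vs)"
        "i \<noteq> j" "mset us = mset (xs @ (p, i) # (q, j) # vs)" unfolding swaps_def by blast
      define ts where "ts = map fst xs @ Letter (val p * val q - val q * val p) 1 (dg p + dg q) 0 # map fst vs"
      have ms: "mset ys = mset (map fst xs @ p # q # map fst vs)"
        unfolding us(1)[symmetric] mset_map x(3) by simp
      then have "set ys = set (map fst xs @ p # q # map fst vs)" by (metis set_mset_mset)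
      then have vp: "valid p" "valid q" "wt p = 1" "wt q = 1" "valids (map fst xs)" "valids (map fst vs)"
        "\<forall>l\<in>set (map fst xs). wt l = 1" "\<forall>l\<in>set (map fst vs). wt l = 1"
        using ys(1) wt1 by auto
      \<comment> \<open>\<open>E 2\<close> is \<open>F 1\<close>: the commutator of two primitive
        elements is again primitive, so it serves as a single letter of weight 1.\<close>
      have "val p * val q - val q * val p \<in> E (1 + 1) (dg p + dg q)"
        using vp by (intro E_commutator) (auto simp: valid_def)
      then have vc: "valid (Letter (val p * val q - val q * val p) 1 (dg p + dg q) 0)"
        using vp by (simp add: valid_def numeral_2_eq_2)
      have tsU: "x \<in> ?U (map dg ts)"
        using vp unfolding words_def ts_def
        by (intro CollectI exI[of _ "map fst xs @ Letter (val p * val q - val q * val p) 1 (dg p + dg q) 0 # map fst vs"])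
          (use vc in \<open>simp_all add: x mult.assoc ball_Un\<close>)
      let ?rest = "map dg (map fst xs @ map fst vs)"
      have b1: "beta D (map dg ts) = beta D ((dg p + dg q) # ?rest)" for D
        by (rule beta_mset_eq) (simp add: ts_def)
      have b2: "beta D lam = beta D (dg p # dg q # ?rest)" for D
        unfolding ys(2)[symmetric] using arg_cong[OF ms, of "image_mset dg"] by (intro beta_mset_eq) (simp add: multiset.map_comp)
      \<comment> \<open>The slots of the expansion put \<open>p\<close> and \<open>q\<close> in
        different blocks, which gives an assignment of the finer type that does not come from the
        merged one.\<close>
      have "map snd ((p, i) # (q, j) # xs @ vs) \<in> assigns C (map (\<lambda>z. dg (fst z)) ((p, i) # (q, j) # xs @ vs))"
      proof (rule assigns_of_pairs)
        have m: "mset zs = mset ((p, i) # (q, j) # xs @ vs)" using us(2) x(3) by simp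
        then have st: "set zs = set ((p, i) # (q, j) # xs @ vs)" by (metis set_mset_mset)
        then show "snd ` set ((p, i) # (q, j) # xs @ vs) \<subseteq> {..<length C}"
          using expansions_red(4)[OF _ _ _ zs] by (simp add: atLeast0LessThan flip: st)
        fix s assume s: "s < length C"
        have "(\<Sum>z\<leftarrow>(p, i) # (q, j) # xs @ vs. if snd z = s then dg (fst z) else 0) = (\<Sum>z\<leftarrow>zs. if snd z = s then dg (fst z) else 0)"
          unfolding sum_mset_sum_list[symmetric] mset_map m ..
        then show "(\<Sum>z\<leftarrow>(p, i) # (q, j) # xs @ vs. if snd z = s then dg (fst z) else 0) = C ! s"
          using expansions_red(5)[OF _ _ _ zs] s by simp
      qed
      then have lt: "beta C (map dg ts) < beta C lam"
        unfolding b1 b2 using x(2) by (intro beta_merge(2)[of i j "map snd (xs @ vs)"]) (simp_all add: o_def)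
      have le: "beta D (map dg ts) \<le> beta D lam" for D
        unfolding b1 b2 by (rule beta_merge(1))
      have tsn: "map dg ts \<in> comps n"
      proof -
        have "sum_list (map dg ts) = sum_list (map dg ys)"
          using arg_cong[OF ms, of "\<lambda>M. sum_mset (image_mset dg M)"]
          by (simp add: ts_def sum_mset_sum_list[symmetric] flip: mset_map)
        moreover have "0 \<notin> set (map dg ts)" using vp by (auto simp: ts_def valid_def)
        ultimately show ?thesis using ys(4) by (simp add: comps_def)
      qed
      have "beta_P n P (map dg ts) < beta_P n P lam"
        using tsn by (intro beta_P_less[OF _ z le lt C]) (simp add: comps_def)
      then show "x \<in> ?W" using tsU tsn by auto
    qed
    from subsetD[OF span_mono[OF this] us(3)] len
    show "lpr (map fst zs) - (if length zs = length ys then lpr ys else 0) \<in>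
      span (\<Union>mu\<in>{mu \<in> comps n. ?b mu > ?b (map dg ys)}. ?U mu)" by (simp add: ys(2))
  qed
  from span_neg[OF this]
  show "- opP n P u - ?b lam *\<^sub>R u \<in> span ?W" by simp
qed

section \<open>A basis of monomials\<close>

text \<open>Its span is the part of weight \<open>k\<close> and degree \<open>m\<close> of the
  decomposables of the associated graded algebra, lifted to \<open>F k m\<close> and hence taken
  together with the lower term \<open>E k m\<close>.\<close>

definition decomposables :: "nat \<Rightarrow> nat \<Rightarrow> 'a set" where
  "decomposables k m = E k m \<union> {x * y | x y i j. 0 < i \<and> i < k \<and> 0 < j \<and> j < m \<and> x \<in> F i j \<and> y \<in> F (k - i) (m - j)}"

text \<open>\<open>B\<close> represents a basis of the indecomposables, and \<open>f\<close> is the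
  dual family, which vanishes on the decomposables.\<close>

definition generator_choice :: "nat \<Rightarrow> nat \<Rightarrow> 'a set \<Rightarrow> ('a \<Rightarrow> 'a \<Rightarrow> real) \<Rightarrow> bool" where
  "generator_choice k m B f \<longleftrightarrow> finite B \<and> B \<subseteq> F k m \<and> F k m \<subseteq> span (B \<union> decomposables k m) \<and>
     (\<forall>x. linear (f x)) \<and> (\<forall>x\<in>B. \<forall>y\<in>decomposables k m. f x y = 0) \<and>
     (\<forall>x\<in>B. \<forall>y\<in>B. f x y = (if y = x then 1 else 0))"

lemma decomposables_subset: "decomposables k m \<subseteq> F k m"
proof -
  have "x * y \<in> F k m" if "i < k" "j < m" "x \<in> F i j" "y \<in> F (k - i) (m - j)" for x y i j
    using F_mult[OF that(3,4)] that(1,2) by simp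
  then show ?thesis using E_mono[of k "Suc k"] by (auto simp: decomposables_def)
qed

lemma generator_choice_exists: "\<exists>B f. generator_choice k m B f"
proof -
  obtain BN where BN: "BN \<subseteq> decomposables k m" "independent BN" "decomposables k m \<subseteq> span BN"
    by (rule maximal_independent_subset)
  have "BN \<subseteq> F k m" using BN(1) decomposables_subset by blast
  then obtain C where C: "BN \<subseteq> C" "C \<subseteq> F k m" "independent C" "F k m \<subseteq> span C"
    by (rule maximal_independent_subset_extend[OF _ BN(2)])
  have finC: "finite C" using C(2) E_H by (intro finite_independent_H[OF C(3), of m]) blast
  have "\<exists>f. (\<forall>e. linear (f e)) \<and> (\<forall>e\<in>C. \<forall>e'\<in>C. f e e' = (if e' = e then 1 else 0 :: real))"
  proof (rule dual_basis[OF finC C(3)])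
    fix f :: "'a \<Rightarrow> 'a \<Rightarrow> real"
    assume "\<And>e. linear (f e)" "\<And>e e'. e \<in> C \<Longrightarrow> e' \<in> C \<Longrightarrow> f e e' = (if e' = e then 1 else 0)"
    then show ?thesis by blast
  qed
  then obtain f :: "'a \<Rightarrow> 'a \<Rightarrow> real" where f: "\<And>e. linear (f e)"
    "\<And>e e'. e \<in> C \<Longrightarrow> e' \<in> C \<Longrightarrow> f e e' = (if e' = e then 1 else 0)" by blast
  have "f x y = 0" if "x \<in> C - BN" "y \<in> decomposables k m" for x y
  proof (rule linear_eq_0_on_span[OF f(1)[of x], of BN])
    show "y \<in> span BN" using that BN(3) by blast
    fix z assume "z \<in> BN"
    then have "z \<in> C" "z \<noteq> x" using C(1) that by auto
    then show "f x z = 0" using f(2)[of x z] that by simp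
  qed
  moreover have "span C \<subseteq> span ((C - BN) \<union> decomposables k m)"
    by (rule span_mono) (use BN(1) in blast)
  ultimately have "generator_choice k m (C - BN) f"
    using finC C f unfolding generator_choice_def by auto
  then show ?thesis by blast
qed

definition chosen :: "nat \<Rightarrow> nat \<Rightarrow> 'a set \<times> ('a \<Rightarrow> 'a \<Rightarrow> real)" where
  "chosen k m = (SOME p. generator_choice k m (fst p) (snd p))"

lemma chosen: "generator_choice k m (fst (chosen k m)) (snd (chosen k m))"
  unfolding chosen_def by (rule someI_ex) (use generator_choice_exists in simp)

text \<open>The label is fixed at 0, so that a generator is determined by its value, weight and
  degree.\<close>

definition gens :: "'a letter set" where
  "gens = {Letter x k m 0 | x k m. 0 < k \<and> 0 < m \<and> x \<in> fst (chosen k m)}"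

text \<open>Precomposition with the projection makes the dual functional homogeneous, so that it
  belongs to \<open>J\<close>.\<close>

definition coord :: "'a letter \<Rightarrow> 'a \<Rightarrow> real" where
  "coord l y = snd (chosen (wt l) (dg l)) (val l) (pr (dg l) y)"

lemma gensD: "l \<in> gens \<Longrightarrow> val l \<in> fst (chosen (wt l) (dg l))" "l \<in> gens \<Longrightarrow> valid l" "l \<in> gens \<Longrightarrow> lb l = 0"
  using chosen by (force simp: gens_def valid_def generator_choice_def)+

lemma linear_coord: "linear (coord l)"
  unfolding coord_def[abs_def]
  by (rule linear_compose'[OF _ linear_pr]) (use chosen in \<open>auto simp: generator_choice_def\<close>)

lemma coord_J: "l \<in> gens \<Longrightarrow> coord l \<in> J"
proof -
  assume l: "l \<in> gens"
  have "coord l y = 0" if "y \<in> H j" "j \<noteq> dg l" for y j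
    using linear_0[of "snd (chosen (wt l) (dg l)) (val l)"] chosen[of "wt l" "dg l"] that
    by (auto simp: coord_def pr_H generator_choice_def)
  then have "hom_functional (dg l) (coord l)" using linear_coord by (auto simp: hom_functional_def)
  then show ?thesis using gensD(2)[OF l] by (auto simp: J_def valid_def)
qed

lemma coord_other_degree: "l \<in> gens \<Longrightarrow> y \<in> H j \<Longrightarrow> j \<noteq> dg l \<Longrightarrow> coord l y = 0"
  using linear_0[of "snd (chosen (wt l) (dg l)) (val l)"] chosen[of "wt l" "dg l"]
  by (auto simp: coord_def pr_H generator_choice_def)

lemma coord_decomposable:
  assumes "l \<in> gens" "y \<in> decomposables (wt l) (dg l)"
  shows "coord l y = 0"
proof -
  have "y \<in> H (dg l)" using assms(2) decomposables_subset E_H by blast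
  then show ?thesis
    using chosen[of "wt l" "dg l"] gensD(1)[OF assms(1)] assms(2) by (simp add: coord_def pr_H generator_choice_def)
qed

text \<open>In the degree of \<open>l\<close>, a level below \<open>wt l\<close> means membership in
  \<open>E (wt l)\<close>, which is part of the decomposables.\<close>

lemma coord_low:
  assumes "l \<in> gens" "y \<in> F i j" "i < wt l"
  shows "coord l y = 0"
proof (cases "j = dg l")
  case True
  then have "y \<in> decomposables (wt l) (dg l)"
    using E_mono[of "Suc i" "wt l"] assms by (auto simp: decomposables_def)
  then show ?thesis by (rule coord_decomposable[OF assms(1)])
next
  case False
  then show ?thesis using coord_other_degree[OF assms(1) E_H[OF assms(2)]] by simp
qed

lemma coord_mult:
  assumes "l \<in> gens" "x \<in> F i j" "y \<in> F i' j'" "0 < i" "0 < i'" "0 < j" "0 < j'" "i + i' = wt l"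
  shows "coord l (x * y) = 0"
proof (cases "j + j' = dg l")
  case True
  then have "i < wt l" "j < dg l" "i' = wt l - i" "j' = dg l - j" using assms by auto
  then have "x * y \<in> decomposables (wt l) (dg l)"
    using assms unfolding decomposables_def by blast
  then show ?thesis by (rule coord_decomposable[OF assms(1)])
next
  case False
  then show ?thesis using coord_other_degree[OF assms(1) E_H[OF F_mult[OF assms(2,3)]]] by simp
qed

lemma coord_gens:
  assumes "l \<in> gens" "l' \<in> gens" "wt l = wt l'"
  shows "coord l (val l') = (if l' = l then 1 else 0)"
proof (cases "dg l' = dg l")
  case True
  have "val l' \<in> H (dg l)" using gensD(2)[OF assms(2)] True E_H by (auto simp: valid_def)
  then have "coord l (val l') = (if val l' = val l then 1 else 0)"
    using chosen[of "wt l" "dg l"] gensD(1)[OF assms(1)] gensD(1)[OF assms(2)] assms(3) True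
    by (simp add: coord_def pr_H generator_choice_def)
  moreover have "l' = l \<longleftrightarrow> val l' = val l"
    using gensD(3)[OF assms(1)] gensD(3)[OF assms(2)] assms(3) True by (auto intro: letter.expand)
  ultimately show ?thesis by simp
next
  case False
  then show ?thesis
    using coord_other_degree[OF assms(1), of "val l'" "dg l'"] gensD(2)[OF assms(2)] E_H by (auto simp: valid_def)
qed

lemma finite_gens: "finite {l \<in> gens. dg l \<le> n}"
proof (rule finite_subset)
  \<comment> \<open>A generator heavier than its degree would have a level below its own weight, so
    its own coordinate, which is 1, would vanish.\<close>
  have le: "wt l \<le> dg l" if l: "l \<in> gens" for l
  proof (rule ccontr)
    assume "\<not> wt l \<le> dg l"
    then have "coord l (val l) = 0"
      using coord_low[OF l H_subset_F[OF E_H]] gensD(2)[OF l] by (auto simp: valid_def)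
    then show False using coord_gens[OF l l] by simp
  qed
  show "{l \<in> gens. dg l \<le> n} \<subseteq> (\<Union>k\<le>n. \<Union>m\<le>n. (\<lambda>x. Letter x k m 0) ` fst (chosen k m))"
  proof
    fix l assume "l \<in> {l \<in> gens. dg l \<le> n}"
    then have l: "l \<in> gens" "dg l \<le> n" by auto
    from l(1) obtain x k m where x: "l = Letter x k m 0" "x \<in> fst (chosen k m)" by (auto simp: gens_def)
    have "k \<le> n" "m \<le> n" using le[OF l(1)] l(2) x(1) by auto
    with x show "l \<in> (\<Union>k\<le>n. \<Union>m\<le>n. (\<lambda>x. Letter x k m 0) ` fst (chosen k m))" by auto
  qed
  show "finite (\<Union>k\<le>n. \<Union>m\<le>n. (\<lambda>x. Letter x k m 0) ` fst (chosen k m))"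
    using chosen by (auto simp: generator_choice_def)
qed

section \<open>Monomials in the generators span the graded components\<close>

definition Mons :: "nat \<Rightarrow> 'a letter multiset set" where
  "Mons n = {M. set_mset M \<subseteq> gens \<and> (\<Sum>l\<in>#M. dg l) = n}"

definition mlist :: "'a letter multiset \<Rightarrow> 'a letter list" where
  "mlist M = (SOME xs. mset xs = M)"

lemma mset_mlist [simp]: "mset (mlist M) = M"
  unfolding mlist_def by (rule someI_ex) (rule ex_mset)

lemma set_mlist [simp]: "set (mlist M) = set_mset M"
  by (metis mset_mlist set_mset_mset)

lemma size_mlist [simp]: "length (mlist M) = size M"
  by (metis mset_mlist size_mset)

lemma sum_mlist [simp]: "(\<Sum>l\<leftarrow>mlist M. f l) = (\<Sum>l\<in>#M. f l)"
  by (metis mset_map mset_mlist sum_mset_sum_list)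

definition mon :: "'a letter multiset \<Rightarrow> 'a" where
  "mon M = lpr (mlist M)"

lemma Mons_valids: "M \<in> Mons n \<Longrightarrow> valids (mlist M)"
  using gensD(2) by (auto simp: Mons_def)

lemma length_le_ldg: "valids ys \<Longrightarrow> length ys \<le> ldg ys"
  by (induction ys) (auto simp: valid_def)

lemma finite_Mons: "finite (Mons n)"
proof (rule finite_subset)
  show "Mons n \<subseteq> mset ` {xs. set xs \<subseteq> {l \<in> gens. dg l \<le> n} \<and> length xs \<le> n}"
  proof
    fix M assume M: "M \<in> Mons n"
    have "dg l \<le> n" if "l \<in> set (mlist M)" for l
    proof -
      have "dg l \<le> (\<Sum>l\<leftarrow>mlist M. dg l)" using that by (intro member_le_sum_list) auto
      then show ?thesis using M by (simp add: Mons_def)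
    qed
    moreover have "length (mlist M) \<le> n"
      using length_le_ldg[OF Mons_valids[OF M]] M by (simp add: Mons_def)
    ultimately have "mlist M \<in> {xs. set xs \<subseteq> {l \<in> gens. dg l \<le> n} \<and> length xs \<le> n}"
      using M by (auto simp: Mons_def)
    then show "M \<in> mset ` {xs. set xs \<subseteq> {l \<in> gens. dg l \<le> n} \<and> length xs \<le> n}"
      by (rule image_eqI[rotated]) simp
  qed
qed (intro finite_imageI finite_lists_length_le finite_gens)

lemma mon_in_H: "M \<in> Mons n \<Longrightarrow> mon M \<in> H n"
  unfolding mon_def using lpr_in_H[OF Mons_valids] by (force simp: Mons_def)

abbreviation mwt :: "'a letter multiset \<Rightarrow> nat" where "mwt M \<equiv> (\<Sum>l\<in>#M. wt l)"

text \<open>The monomials that may occur when a word of weight \<open>K\<close> and length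
  \<open>p\<close> is rewritten: at a lower weight the length is free, at the same weight it can
  only grow.\<close>

definition lower_mons :: "nat \<Rightarrow> nat \<Rightarrow> nat \<Rightarrow> 'a letter multiset set" where
  "lower_mons n K p = {M \<in> Mons n. mwt M < K \<or> mwt M = K \<and> size M \<ge> p}"

text \<open>A letter that is not a generator is replaced by generators of its weight and degree, by
  elements of lower level, and by products of two letters. These decrease, respectively, the number
  of non-generators, the weight, and the difference of \<open>n\<close> and the length; the order of
  the induction is lexicographic. The difference can shrink because a word of degree
  \<open>n\<close> has at most \<open>n\<close> letters.\<close>

lemma lpr_in_span_mons:
  "valids ys \<Longrightarrow> ldg ys = n \<Longrightarrow> lpr ys \<in> span (mon ` lower_mons n (lwt ys) (length ys))"
proof (induction "(lwt ys, n - length ys, length (filter (\<lambda>l. l \<notin> gens) ys))" arbitrary: ys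
    rule: wf_induct_rule[OF wf_lex_prod[OF wf_less_than wf_lex_prod[OF wf_less_than wf_less_than]]])
  case (1 ys)
  note valid = 1(2) and deg = 1(3)
  have IH: "lpr zs \<in> span (mon ` lower_mons n (lwt zs) (length zs))"
    if "valids zs" "ldg zs = n"
      "lwt zs < lwt ys \<or> lwt zs = lwt ys \<and> (n - length zs < n - length ys \<or> length zs = length ys \<and>
       length (filter (\<lambda>l. l \<notin> gens) zs) < length (filter (\<lambda>l. l \<notin> gens) ys))" for zs
    using that by (intro 1(1)) auto
  let ?S = "span (mon ` lower_mons n (lwt ys) (length ys))"
  \<comment> \<open>A nonzero element of lower level is itself a one-letter word of smaller
    weight.\<close>
  have E_low: "x \<in> ?S" if x: "x \<in> E (lwt ys) n" for x
  proof -
    show ?thesis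
    proof (cases "lwt ys")
      case 0
      have "x = 0" using x unfolding 0 by (rule E_0_eq)
      then show ?thesis by (simp add: span_zero)
    next
      case (Suc k)
      then have "ys \<noteq> []" by auto
      then have n: "n > 0" using deg valid by (cases ys) (auto simp: valid_def)
      show ?thesis
      proof (cases "k = 0")
        case True
        then have "x = 0" using F_0_eq[of x n] x n Suc by simp
        then show ?thesis by (simp add: span_zero)
      next
        case False
        then have "lpr [Letter x k n 0] \<in> span (mon ` lower_mons n (lwt [Letter x k n 0]) (length [Letter x k n 0]))"
          using x Suc n by (intro IH) (auto simp: valid_def)
        also have "\<dots> \<subseteq> ?S" by (intro span_mono image_mono) (auto simp: lower_mons_def Suc)
        finally show ?thesis by simp
      qed
    qed
  qed
  show ?case
  proof (cases "set ys \<subseteq> gens")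
    case True
    have sums: "mwt (mset ys) = lwt ys" "(\<Sum>l\<in>#mset ys. dg l) = n"
      using deg by (simp_all flip: mset_map add: sum_mset_sum_list)
    have "mset ys \<in> lower_mons n (lwt ys) (length ys)"
      using True sums by (simp add: lower_mons_def Mons_def)
    then have "mon (mset ys) \<in> ?S" by (intro span_base imageI)
    moreover have "lpr ys - mon (mset ys) \<in> ?S"
      using lpr_perm[OF valid, of "mlist (mset ys)"] deg by (intro E_low) (simp add: mon_def)
    ultimately have "(lpr ys - mon (mset ys)) + mon (mset ys) \<in> ?S" by (intro span_add)
    then show ?thesis by simp
  next
    case False
    then obtain l where l: "l \<in> set ys" "l \<notin> gens" by blast
    then obtain us vs where ys: "ys = us @ l # vs" by (meson split_list)
    have vl: "valid l" "valids us" "valids vs" using valid by (auto simp: ys)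
    let ?k = "wt l" and ?m = "dg l"
    have repl: "lpr us * z * lpr vs \<in> ?S" if "z \<in> span (fst (chosen ?k ?m) \<union> decomposables ?k ?m)" for z
      using that
    proof (induction rule: span_induct_alt)
      case base
      show ?case by (simp add: span_zero)
    next
      case (step c z y)
      consider "z \<in> fst (chosen ?k ?m)" | "z \<in> E ?k ?m"
        | x' y' i j where "z = x' * y'" "0 < i" "i < ?k" "0 < j" "j < ?m" "x' \<in> F i j" "y' \<in> F (?k - i) (?m - j)"
        using step.hyps(1) unfolding decomposables_def by blast
      then have "lpr us * z * lpr vs \<in> ?S"
      proof cases
        case 1
        let ?zs = "us @ Letter z ?k ?m 0 # vs"
        have "Letter z ?k ?m 0 \<in> gens" using 1 vl(1) by (auto simp: gens_def valid_def)
        then have "lpr ?zs \<in> span (mon ` lower_mons n (lwt ?zs) (length ?zs))"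
          using vl gensD(2) deg l(2) by (intro IH) (auto simp: ys)
        then show ?thesis by (simp add: ys mult.assoc)
      next
        case 2
        have "lpr us * z * lpr vs \<in> E (lwt us + ?k + lwt vs) (ldg us + ?m + ldg vs)"
          using vl 2 by (intro E_F_mult F_E_mult lpr_in_F)
        then show ?thesis using deg by (intro E_low) (simp add: ys add.assoc)
      next
        case (3 x' y' i j)
        let ?zs = "us @ Letter x' i j 0 # Letter y' (?k - i) (?m - j) 0 # vs"
        have vz: "valids ?zs" using vl 3 by (auto simp: valid_def)
        have dz: "ldg ?zs = n" using 3 deg by (simp add: ys)
        then have "length ys < n" using length_le_ldg[OF vz] by (simp add: ys)
        then have "lpr ?zs \<in> span (mon ` lower_mons n (lwt ?zs) (length ?zs))"
          using 3 by (intro IH[OF vz dz]) (simp add: ys)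
        also have "\<dots> \<subseteq> ?S" using 3 by (intro span_mono image_mono) (auto simp: lower_mons_def ys)
        finally show ?thesis by (simp add: 3(1) mult.assoc)
      qed
      then have "c *\<^sub>R (lpr us * z * lpr vs) + lpr us * y * lpr vs \<in> ?S"
        by (rule span_add[OF span_scale step.IH])
      then show ?case by (simp add: algebra_simps)
    qed
    have "val l \<in> span (fst (chosen ?k ?m) \<union> decomposables ?k ?m)"
      using vl(1) chosen[of ?k ?m] by (auto simp: valid_def generator_choice_def)
    from repl[OF this] show ?thesis by (simp add: ys mult.assoc)
  qed
qed

lemma H_eq_span_mons: "H n = span (mon ` Mons n)"
proof
  show "span (mon ` Mons n) \<subseteq> H n" by (rule span_minimal[OF _ subspace_H]) (use mon_in_H in blast)
  show "H n \<subseteq> span (mon ` Mons n)"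
  proof
    fix x assume x: "x \<in> H n"
    show "x \<in> span (mon ` Mons n)"
    proof (cases "n = 0")
      case True
      have "lpr [] \<in> span (mon ` lower_mons 0 (lwt ([] :: 'a letter list)) (length ([] :: 'a letter list)))"
        by (rule lpr_in_span_mons) auto
      also have "\<dots> \<subseteq> span (mon ` Mons n)" using True by (intro span_mono image_mono) (auto simp: lower_mons_def)
      finally have "\<epsilon> x *\<^sub>R 1 \<in> span (mon ` Mons n)" by (intro span_scale) simp
      then show ?thesis using H_0_eq x True by metis
    next
      case False
      have "lpr [Letter x n n 0] \<in> span (mon ` lower_mons n (lwt [Letter x n n 0]) (length [Letter x n n 0]))"
        using False H_subset_F[OF x] by (intro lpr_in_span_mons) (auto simp: valid_def)
      also have "\<dots> \<subseteq> span (mon ` Mons n)" by (intro span_mono image_mono) (auto simp: lower_mons_def)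
      finally show ?thesis by simp
    qed
  qed
qed

section \<open>Linear independence of the monomials\<close>

lemma convs_coord_low:
  "set ls \<subseteq> gens \<Longrightarrow> x \<in> F k n \<Longrightarrow> k < lwt ls \<Longrightarrow> convs (map coord ls) x = 0"
proof (induction ls arbitrary: x k n)
  case (Cons l ls)
  have J: "coord l \<in> J" "set (map coord ls) \<subseteq> J" using Cons.prems(1) coord_J by auto
  obtain L where L: "\<Delta> x = (\<Sum>(a, b)\<leftarrow>L. pure_tensor [a, b])"
    "\<And>a b. (a, b) \<in> set L \<Longrightarrow> \<exists>i\<le>k. \<exists>m\<le>n. a \<in> F i m \<and> b \<in> F (k - i) (n - m)"
    using coproduct_F[OF Cons.prems(2)] by metis
  have "cop (\<lambda>a b. coord l a * convs (map coord ls) b) x \<in> {0}"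
  proof (rule cop_in_subspace[OF bilinear_convs[OF J] subspace_single_0 L(1)])
    fix a b assume "(a, b) \<in> set L"
    then obtain i m where i: "i \<le> k" "a \<in> F i m" "b \<in> F (k - i) (n - m)" using L(2) by blast
    \<comment> \<open>\<open>coord l\<close> needs level \<open>wt l\<close> in the first leg, which
      leaves the second leg short of the weight that the other coordinates need.\<close>
    show "coord l a * convs (map coord ls) b \<in> {0}"
    proof (cases "i < wt l")
      case True
      then show ?thesis using coord_low[OF _ i(2)] Cons.prems(1) by simp
    next
      case False
      then have "k - i < lwt ls" using Cons.prems(3) i(1) by simp
      then show ?thesis using Cons.IH[OF _ i(3)] Cons.prems(1) by simp
    qed
  qed
  then show ?case by (simp add: conv_def)
qed simp

lemma convs_coord_Cons:
  assumes "set (l # ls) \<subseteq> gens" "valids ys"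
  shows "convs (map coord (l # ls)) (lpr ys) =
    (\<Sum>A\<leftarrow>splits red ys. coord l (lpr (fst A)) * convs (map coord ls) (lpr (snd A)))"
proof -
  have J: "coord l \<in> J" "set (map coord ls) \<subseteq> J" using assms(1) coord_J by auto
  have "\<Delta> (lpr ys) = (\<Sum>(a, b)\<leftarrow>map (\<lambda>A. (lpr (fst A), lpr (snd A))) (splits red ys). pure_tensor [a, b])"
    by (simp add: coproduct_lpr[OF assms(2)] o_def)
  from cop_eq[OF bilinear_convs[OF J] this] show ?thesis by (simp add: conv_def o_def)
qed

text \<open>The total weight equals that of the coordinates, so neither side may fall short and both
  match exactly. A left part of two or more letters with the weight of \<open>l\<close> would be
  decomposable, and \<open>coord l\<close> would vanish on it.\<close>

lemma coord_term:
  assumes A: "A \<in> set (splits red ys)" and ys: "valids ys" and l: "set (l # ls) \<subseteq> gens" "lwt ys = lwt (l # ls)"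
    and nz: "coord l (lpr (fst A)) * convs (map coord ls) (lpr (snd A)) \<noteq> 0"
  shows "\<exists>a. fst A = [a] \<and> wt a = wt l \<and> lwt (snd A) = lwt ls"
proof -
  note v = valids_splits[OF ys A]
  have w: "lwt (fst A) + lwt (snd A) = wt l + lwt ls" using splits_red(2)[OF _ _ _ A] l(2) by simp
  have "\<not> lwt (fst A) < wt l" using coord_low[OF _ lpr_in_F] v l(1) nz by auto
  moreover have "\<not> lwt (snd A) < lwt ls" using convs_coord_low[OF _ lpr_in_F] v l(1) nz by auto
  ultimately have eq: "lwt (fst A) = wt l" "lwt (snd A) = lwt ls" using w by auto
  have "\<exists>a. fst A = [a]"
  proof (cases "fst A")
    case Nil
    then show ?thesis using eq(1) gensD(2)[of l] l(1) by (auto simp: valid_def)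
  next
    case (Cons a as)
    show ?thesis
    proof (cases "as = []")
      case False
      have va: "valid a" "valids as" using v Cons by auto
      have "0 < lwt as" "0 < ldg as" using va(2) False by (cases as; auto simp: valid_def)+
      then have "coord l (val a * lpr as) = 0"
        using va(1) l(1) eq(1) Cons lpr_in_F[OF va(2)]
        by (intro coord_mult[of l "val a" "wt a" "dg a" "lpr as" "lwt as" "ldg as"]) (auto simp: valid_def)
      then show ?thesis using nz Cons by simp
    qed (use Cons in simp)
  qed
  then show ?thesis using eq by auto
qed

text \<open>Each coordinate absorbs one letter, and splitting never shortens a word; so letters are
  left over when the coordinates are used up.\<close>

lemma convs_coord_long:
  "set ls \<subseteq> gens \<Longrightarrow> valids ys \<Longrightarrow> lwt ys = lwt ls \<Longrightarrow> length ys > length ls \<Longrightarrow> convs (map coord ls) (lpr ys) = 0"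
proof (induction ls arbitrary: ys)
  case Nil
  then show ?case by (cases ys) (auto simp: valid_def)
next
  case (Cons l ls)
  have "coord l (lpr (fst A)) * convs (map coord ls) (lpr (snd A)) = 0" if A: "A \<in> set (splits red ys)" for A
  proof (rule ccontr)
    assume nz: "coord l (lpr (fst A)) * convs (map coord ls) (lpr (snd A)) \<noteq> 0"
    then obtain a where a: "fst A = [a]" "lwt (snd A) = lwt ls" using coord_term[OF A Cons.prems(2,1,3)] by blast
    then have "length (snd A) > length ls" using splits_red(6)[OF _ _ _ A] Cons.prems(4) by simp
    then show False using Cons.IH[OF _ _ a(2)] Cons.prems(1) valids_splits[OF Cons.prems(2) A] nz by simp
  qed
  then have "(\<Sum>A\<leftarrow>splits red ys. coord l (lpr (fst A)) * convs (map coord ls) (lpr (snd A))) = (\<Sum>A\<leftarrow>splits red ys. 0)"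
    by (rule sum_list_cong)
  then show ?case unfolding convs_coord_Cons[OF Cons.prems(1,2)] by simp
qed

text \<open>On generators of its own weight a coordinate is 0 or 1, so the expansion has no negative
  terms, and a single matching of letters with coordinates makes the value positive.\<close>

lemma convs_coord_same_length:
  "set ls \<subseteq> gens \<Longrightarrow> set ys \<subseteq> gens \<Longrightarrow> lwt ys = lwt ls \<Longrightarrow> length ys = length ls \<Longrightarrow>
    (if mset ys = mset ls then convs (map coord ls) (lpr ys) > 0 else convs (map coord ls) (lpr ys) = 0)"
proof (induction ls arbitrary: ys)
  case Nil
  then show ?case by (simp add: counit_one)
next
  case (Cons l ls)
  have v: "valids ys" using Cons.prems(2) gensD(2) by auto
  let ?t = "\<lambda>A. coord l (lpr (fst A)) * convs (map coord ls) (lpr (snd A))"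
  have main: "?t A = 0 \<or> (?t A > 0 \<and> mset ys = mset (l # ls))" if A: "A \<in> set (splits red ys)" for A
  proof (rule disjCI)
    assume contra: "\<not> (?t A > 0 \<and> mset ys = mset (l # ls))"
    show "?t A = 0"
    proof (rule ccontr)
      assume nz: "?t A \<noteq> 0"
      from coord_term[OF A v Cons.prems(1,3) nz] obtain a
        where a: "fst A = [a]" "wt a = wt l" "lwt (snd A) = lwt ls" by blast
      have "\<not> length (snd A) > length ls"
        using convs_coord_long[OF _ _ a(3)] Cons.prems(1) valids_splits[OF v A] nz by auto
      then have m: "mset ys = add_mset a (mset (snd A))"
        using splits_red(5)[OF _ _ _ A] a(1) Cons.prems(4) by auto
      then have "set ys = insert a (set (snd A))" by (metis set_mset_add_mset_insert set_mset_mset)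
      then have g: "a \<in> gens" "set (snd A) \<subseteq> gens" using Cons.prems(2) by auto
      have "a = l" using coord_gens[of l a] g(1) a(1,2) Cons.prems(1) nz by (auto split: if_splits)
      moreover have "length (snd A) = length ls" using arg_cong[OF m, of size] Cons.prems(4) by simp
      ultimately have "mset (snd A) = mset ls \<and> convs (map coord ls) (lpr (snd A)) > 0"
        using Cons.IH[OF _ g(2) a(3)] Cons.prems(1) nz by (auto split: if_splits)
      then show False
        using contra m \<open>a = l\<close> coord_gens[of l l] Cons.prems(1) a(1) by simp
    qed
  qed
  show ?case
  proof (cases "mset ys = mset (l # ls)")
    case True
    then have "l \<in> set ys" by (metis list.set_intros(1) set_mset_mset)
    then obtain us vs where ys: "ys = us @ l # vs" by (meson split_list)
    then have m: "mset (us @ vs) = mset ls" using True by simp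
    \<comment> \<open>The term that takes out \<open>l\<close> uncut and leaves the other letters to
      the remaining coordinates.\<close>
    let ?A = "([l], us @ vs)"
    have A: "?A \<in> set (splits red ys)" unfolding ys by (rule splits_extract)
    have "set (us @ vs) \<subseteq> gens" "lwt (us @ vs) = lwt ls" "length (us @ vs) = length ls"
      using Cons.prems ys by auto
    then have "?t ?A > 0"
      using Cons.IH[of "us @ vs"] m Cons.prems(1) coord_gens[of l l] by auto
    moreover have "?t A \<ge> 0" if "A \<in> set (splits red ys)" for A using main[OF that] by auto
    ultimately have "(\<Sum>A\<leftarrow>splits red ys. ?t A) > 0"
      by (intro sum_list_pos_member[OF _ A])
    then show ?thesis using True convs_coord_Cons[OF Cons.prems(1) v] by simp
  next
    case False
    then have "?t A = 0" if "A \<in> set (splits red ys)" for A using main[OF that] by simp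
    then have "(\<Sum>A\<leftarrow>splits red ys. ?t A) = (\<Sum>A\<leftarrow>splits red ys. 0)" by (rule sum_list_cong)
    then show ?thesis using False unfolding convs_coord_Cons[OF Cons.prems(1) v] by simp
  qed
qed

text \<open>Among the monomials with nonzero coefficient, \<open>M0\<close> has maximal weight and,
  within that weight, minimal length. The coordinates of its letters vanish on all others: on
  lighter ones by weight, on longer ones by length, and on those of equal weight and length by the
  pairing.\<close>

lemma mons_independent:
  assumes zero: "(\<Sum>M\<in>Mons n. c M *\<^sub>R mon M) = 0" and M: "M \<in> Mons n"
  shows "c M = 0"
proof (rule ccontr)
  assume nz: "c M \<noteq> 0"
  let ?A = "{M \<in> Mons n. c M \<noteq> 0}"
  define K where "K = Max (mwt ` ?A)"
  have finA: "finite ?A" using finite_Mons by simp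
  have "K \<in> mwt ` ?A" unfolding K_def by (rule Max_in) (use finA M nz in auto)
  then obtain M1 where M1: "M1 \<in> ?A" "mwt M1 = K" by blast
  have leK: "mwt M \<le> K" if "M \<in> ?A" for M unfolding K_def using finA that by (intro Max_ge) auto
  obtain M0 where M0: "M0 \<in> ?A \<and> mwt M0 = K" "\<And>M. M \<in> ?A \<and> mwt M = K \<Longrightarrow> size M0 \<le> size M"
    using ex_has_least_nat[of "\<lambda>M. M \<in> ?A \<and> mwt M = K" M1 size] M1 by auto
  let ?g = "convs (map coord (mlist M0))"
  have g: "set (mlist M0) \<subseteq> gens" using M0(1) by (simp add: Mons_def)
  have lin: "linear ?g" using g coord_J by (intro linear_convs_J) auto
  have "c M *\<^sub>R ?g (mon M) = (if M = M0 then c M0 * ?g (mon M0) else 0)" if M: "M \<in> Mons n" for M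
  proof (cases "c M = 0")
    case True
    then show ?thesis using M0(1) by auto
  next
    case False
    then have MA: "M \<in> ?A" using M by simp
    have vM: "valids (mlist M)" by (rule Mons_valids[OF M])
    consider "mwt M < K" | "mwt M = K" "size M > size M0" | "mwt M = K" "size M = size M0"
      using leK[OF MA] M0(2)[of M] MA by linarith
    then show ?thesis
    proof cases
      case 1
      then have "?g (mon M) = 0" unfolding mon_def
        using M0(1) by (intro convs_coord_low[OF g lpr_in_F[OF vM]]) simp
      then show ?thesis using 1 M0(1) by auto
    next
      case 2
      then have "?g (mon M) = 0" unfolding mon_def
        using M0(1) by (intro convs_coord_long[OF g vM]) auto
      then show ?thesis using 2 by auto
    next
      case 3
      then have "if M = M0 then ?g (mon M) > 0 else ?g (mon M) = 0"
        using convs_coord_same_length[OF g, of "mlist M"] M M0(1) by (auto simp: mon_def Mons_def)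
      then show ?thesis by (auto split: if_splits)
    qed
  qed
  then have "?g (\<Sum>M\<in>Mons n. c M *\<^sub>R mon M) = (\<Sum>M\<in>Mons n. if M = M0 then c M0 * ?g (mon M0) else 0)"
    by (simp add: linear_sum[OF lin] linear_scale[OF lin])
  also have "\<dots> = c M0 * ?g (mon M0)" using M0(1) finite_Mons by simp
  finally have "c M0 * ?g (mon M0) = 0" using zero linear_0[OF lin] by simp
  moreover have "?g (mon M0) > 0"
    using convs_coord_same_length[OF g g] by (simp add: mon_def)
  ultimately show False using M0(1) by simp
qed

lemma inj_on_mon: "inj_on mon (Mons n)"
proof (rule inj_onI, rule ccontr)
  fix M M' assume M: "M \<in> Mons n" "M' \<in> Mons n" "mon M = mon M'" "M \<noteq> M'"
  let ?c = "\<lambda>L. (if L = M then 1 else 0) - (if L = M' then 1 else (0::real))"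
  have "(\<Sum>L\<in>Mons n. ?c L *\<^sub>R mon L) = mon M - mon M'"
    using M finite_Mons by (simp add: scaleR_diff_left sum_subtractf if_distrib[of "\<lambda>c. c *\<^sub>R _"] cong: if_cong)
  then have "?c M = 0" using M by (intro mons_independent[where n = n and c = ?c and M = M]) simp_all
  then show False using M(4) by simp
qed

lemma independent_mons: "independent (mon ` Mons n)"
proof (rule independent_if_scalars_zero)
  fix f x assume f: "(\<Sum>x\<in>mon ` Mons n. f x *\<^sub>R x) = 0" and x: "x \<in> mon ` Mons n"
  then show "f x = 0"
    using mons_independent[where n = n and c = "\<lambda>M. f (mon M)"] by (auto simp: sum.reindex[OF inj_on_mon])
qed (simp add: finite_Mons)

lemma dim_H: "dim (H n) = card (Mons n)"
proof -
  have "dim (H n) = dim (span (mon ` Mons n))" by (rule arg_cong[OF H_eq_span_mons])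
  also have "\<dots> = card (mon ` Mons n)" unfolding dim_span by (rule dim_eq_card_independent[OF independent_mons])
  also have "\<dots> = card (Mons n)" by (rule card_image[OF inj_on_mon])
  finally show ?thesis .
qed

section \<open>Triangularity in the monomial basis\<close>

lemma opP_triangular:
  assumes M: "M \<in> Mons n"
  shows "opP n P (mon M) - beta_P n P (map dg (mlist M)) *\<^sub>R mon M \<in>
    span (mon ` {N \<in> Mons n. mwt N < mwt M \<or> mwt N = mwt M \<and> size N > size M})"
proof -
  define ys where "ys = relabel (mlist M)"
  have p: "map val ys = map val (mlist M)" "map dg ys = map dg (mlist M)" "map wt ys = map wt (mlist M)" "length ys = size M"
    and lab: "\<And>j. j < length ys \<Longrightarrow> lb (ys ! j) = j" and v: "valids ys"
    using relabel_props(1,3,4,5)[of "mlist M"] relabel_props(2)[where ys = "mlist M"]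
      relabel_props(6)[of "mlist M"] Mons_valids[OF M] by (auto simp: ys_def)
  have deg: "ldg ys = n" using p(2) M by (simp add: Mons_def)
  have w: "lwt ys = mwt M" using p(3) by simp
  let ?W = "mon ` {N \<in> Mons n. mwt N < mwt M \<or> mwt N = mwt M \<and> size N > size M}"
  have "opP n P (lpr ys) - beta_P n P (map dg ys) *\<^sub>R lpr ys \<in> span ?W"
  proof (rule opP_diff_in_span[OF v lab deg])
    fix C zs assume zs: "zs \<in> set (expansions red C 0 ys)"
    note vz = valids_expansions[OF v zs]
    have wz: "lwt (map fst zs) = mwt M" using expansions_red(1)[OF _ _ _ zs] w by (simp add: o_def)
    have dz: "ldg (map fst zs) = n" using lpr_degree_expansions[OF zs] deg by simp
    show "lpr (map fst zs) - (if length zs = length ys then lpr ys else 0) \<in> span ?W"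
    proof (cases "length zs = length ys")
      case True
      then have m: "mset (map fst zs) = mset ys" using expansions_red(7)[OF _ _ _ zs] by auto
      have E: "lpr (map fst zs) - lpr ys \<in> E (mwt M) n" using lpr_perm[OF vz m] wz dz by simp
      have "x \<in> span ?W" if x: "x \<in> E (mwt M) n" for x
      proof (cases "n = 0 \<or> mwt M \<le> 1")
        case True
        \<comment> \<open>Here a one-letter word of weight \<open>mwt M - 1\<close> and degree
          \<open>n\<close> would not be valid, but \<open>x\<close> is 0.\<close>
        have "x = 0"
        proof (cases "mwt M = 0")
          case False
          have "ys \<noteq> []" using False w by auto
          then have "n > 0" using deg v by (cases ys) (auto simp: valid_def)
          then show ?thesis using True False x F_0_eq[of x n] by (auto simp: le_Suc_eq)
        next
          case zero: True
          show ?thesis using x unfolding zero by (rule E_0_eq)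
        qed
        then show ?thesis by (simp add: span_zero)
      next
        case False
        then obtain k where k: "mwt M = Suc k" "k > 0" by (cases "mwt M") auto
        have "lpr [Letter x k n 0] \<in> span (mon ` lower_mons n (lwt [Letter x k n 0]) (length [Letter x k n 0]))"
          using x k False by (intro lpr_in_span_mons) (auto simp: valid_def)
        also have "\<dots> \<subseteq> span ?W" by (intro span_mono image_mono) (auto simp: lower_mons_def k)
        finally show ?thesis by simp
      qed
      from this[OF E] show ?thesis using True by simp
    next
      case False
      then have l: "length zs > size M" using expansions_red(6)[OF _ _ _ zs] p(4) by simp
      have "lpr (map fst zs) \<in> span (mon ` lower_mons n (lwt (map fst zs)) (length (map fst zs)))"
        by (rule lpr_in_span_mons[OF vz dz])
      also have "\<dots> \<subseteq> span ?W" using l wz by (intro span_mono image_mono) (auto simp: lower_mons_def)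
      finally show ?thesis using False by simp
    qed
  qed
  then show ?thesis using p by (simp add: mon_def)
qed

end

section \<open>Characteristic polynomials\<close>

definition base_change :: "'v::real_vector list \<Rightarrow> 'v list \<Rightarrow> real mat" where
  "base_change bs cs = mat (length bs) (length cs) (\<lambda>(i, j). representation (set bs) (cs ! j) (bs ! i))"

lemma ordered_basisD:
  assumes "ordered_basis V bs"
  shows "distinct bs" "independent (set bs)" "span (set bs) = V" "subspace V" "i < length bs \<Longrightarrow> bs ! i \<in> V"
proof -
  show *: "distinct bs" "independent (set bs)" "span (set bs) = V"
    using assms by (simp_all add: ordered_basis_def module_dependent_eq)
  show "subspace V" unfolding *(3)[symmetric] by simp
  show "i < length bs \<Longrightarrow> bs ! i \<in> V" unfolding *(3)[symmetric] by (intro span_base) simp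
qed

lemma ordered_basis_length:
  assumes "ordered_basis V bs"
  shows "length bs = dim V"
proof -
  note b = ordered_basisD[OF assms]
  have "dim (set bs) = card (set bs)" by (rule dim_eq_card_independent[OF b(2)])
  then show ?thesis unfolding b(3)[symmetric] dim_span using distinct_card[OF b(1)] by simp
qed

lemma representation_combination:
  assumes "ordered_basis V bs" "\<And>k. k < n \<Longrightarrow> v k \<in> V"
  shows "representation (set bs) (\<Sum>k<n. c k *\<^sub>R v k) x = (\<Sum>k<n. c k * representation (set bs) (v k) x)"
proof -
  note b = ordered_basisD[OF assms(1)]
  have v: "v k \<in> span (set bs)" if "k \<in> {..<n}" for k using assms(2) that b(3) by simp
  have "representation (set bs) (\<Sum>k<n. c k *\<^sub>R v k) = (\<lambda>x. \<Sum>k<n. representation (set bs) (c k *\<^sub>R v k) x)"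
    by (rule representation_sum[OF b(2)]) (use v span_scale in blast)
  then show ?thesis using v by (simp add: representation_scale[OF b(2)])
qed

lemma expand_in_basis:
  assumes "ordered_basis V bs" "v \<in> V"
  shows "v = (\<Sum>k<length bs. representation (set bs) v (bs ! k) *\<^sub>R bs ! k)"
proof -
  note b = ordered_basisD[OF assms(1)]
  have "v = (\<Sum>x\<in>set bs. representation (set bs) v x *\<^sub>R x)"
    using sum_representation_eq[OF b(2), of v "set bs"] assms(2) b(3) by simp
  also have "\<dots> = (\<Sum>k<length bs. representation (set bs) v (bs ! k) *\<^sub>R bs ! k)"
    using bij_betw_nth[OF b(1) refl refl] by (intro sum.reindex_bij_betw[symmetric]) (simp add: atLeast0LessThan)
  finally show ?thesis .
qed

lemma base_change_mult:
  assumes bs: "ordered_basis V bs" and cs: "ordered_basis V cs" and v: "v \<in> V"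
  shows "(\<Sum>k<length cs. representation (set cs) v (cs ! k) * representation (set bs) (cs ! k) x) = representation (set bs) v x"
proof -
  have "representation (set bs) v x = representation (set bs) (\<Sum>k<length cs. representation (set cs) v (cs ! k) *\<^sub>R cs ! k) x"
    using expand_in_basis[OF cs v] by simp
  also have "\<dots> = (\<Sum>k<length cs. representation (set cs) v (cs ! k) * representation (set bs) (cs ! k) x)"
    by (rule representation_combination[OF bs]) (rule ordered_basisD(5)[OF cs])
  finally show ?thesis by simp
qed

lemma base_change_inverse:
  assumes bs: "ordered_basis V bs" and cs: "ordered_basis V cs"
  shows "base_change bs cs * base_change cs bs = 1\<^sub>m (length bs)"
proof (rule eq_matI)
  fix i j assume "i < dim_row (1\<^sub>m (length bs))" "j < dim_col (1\<^sub>m (length bs))"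
  then have ij: "i < length bs" "j < length bs" by auto
  note b = ordered_basisD[OF bs]
  have "(base_change bs cs * base_change cs bs) $$ (i, j) =
      (\<Sum>k<length cs. representation (set bs) (cs ! k) (bs ! i) * representation (set cs) (bs ! j) (cs ! k))"
    using ij by (simp add: base_change_def scalar_prod_def atLeast0LessThan)
  also have "\<dots> = representation (set bs) (bs ! j) (bs ! i)"
    using base_change_mult[OF bs cs b(5)[OF ij(2)], of "bs ! i"] by (simp add: mult.commute)
  also have "\<dots> = 1\<^sub>m (length bs) $$ (i, j)"
    using ij by (simp add: representation_basis[OF b(2)] nth_eq_iff_index_eq[OF b(1)])
  finally show "(base_change bs cs * base_change cs bs) $$ (i, j) = 1\<^sub>m (length bs) $$ (i, j)" .
qed (simp_all add: base_change_def)

lemma char_poly_operator_matrix_basis: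
  assumes bs: "ordered_basis V bs" and cs: "ordered_basis V cs"
    and f: "linear f" "\<And>v. v \<in> V \<Longrightarrow> f v \<in> V"
  shows "char_poly (operator_matrix bs f) = char_poly (operator_matrix cs f)"
proof (rule char_poly_similar, rule similar_matI)
  let ?n = "length bs"
  have len: "length cs = ?n" using ordered_basis_length[OF bs] ordered_basis_length[OF cs] by simp
  let ?P = "base_change bs cs" and ?Q = "base_change cs bs"
  show "{operator_matrix bs f, operator_matrix cs f, ?P, ?Q} \<subseteq> carrier_mat ?n ?n"
    by (simp add: operator_matrix_def base_change_def len)
  show "?P * ?Q = 1\<^sub>m ?n" by (rule base_change_inverse[OF bs cs])
  show "?Q * ?P = 1\<^sub>m ?n" using base_change_inverse[OF cs bs] by (simp add: len)
  note b = ordered_basisD[OF bs] and c = ordered_basisD[OF cs]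
  show "operator_matrix bs f = ?P * operator_matrix cs f * ?Q"
  proof (rule eq_matI)
    fix i j assume "i < dim_row (?P * operator_matrix cs f * ?Q)" "j < dim_col (?P * operator_matrix cs f * ?Q)"
    then have ij: "i < ?n" "j < ?n" by (simp_all add: base_change_def)
    have "(?P * operator_matrix cs f * ?Q) $$ (i, j) =
      (\<Sum>k<?n. (\<Sum>l<?n. representation (set bs) (cs ! l) (bs ! i) * representation (set cs) (f (cs ! k)) (cs ! l)) *
          representation (set cs) (bs ! j) (cs ! k))"
      using ij len by (simp add: base_change_def operator_matrix_def scalar_prod_def atLeast0LessThan)
    also have "\<dots> = (\<Sum>k<length cs. representation (set cs) (bs ! j) (cs ! k) * representation (set bs) (f (cs ! k)) (bs ! i))"
    proof (rule sum.cong)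
      fix k assume "k \<in> {..<length cs}"
      then have "f (cs ! k) \<in> V" using f(2) c(5) by simp
      from base_change_mult[OF bs cs this, of "bs ! i"]
      show "(\<Sum>l<?n. representation (set bs) (cs ! l) (bs ! i) * representation (set cs) (f (cs ! k)) (cs ! l)) *
          representation (set cs) (bs ! j) (cs ! k) =
        representation (set cs) (bs ! j) (cs ! k) * representation (set bs) (f (cs ! k)) (bs ! i)"
        by (simp add: len mult.commute)
    qed (simp add: len)
    also have "\<dots> = representation (set bs) (\<Sum>k<length cs. representation (set cs) (bs ! j) (cs ! k) *\<^sub>R f (cs ! k)) (bs ! i)"
      by (rule representation_combination[OF bs, symmetric]) (use f(2) c(5) in blast)
    also have "(\<Sum>k<length cs. representation (set cs) (bs ! j) (cs ! k) *\<^sub>R f (cs ! k)) = f (bs ! j)"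
      using arg_cong[OF expand_in_basis[OF cs b(5)[OF ij(2)]], of f]
      by (simp add: linear_sum[OF f(1)] linear_scale[OF f(1)])
    also have "representation (set bs) (f (bs ! j)) (bs ! i) = operator_matrix bs f $$ (i, j)"
      using ij by (simp add: operator_matrix_def)
    finally show "operator_matrix bs f $$ (i, j) = (?P * operator_matrix cs f * ?Q) $$ (i, j)" by simp
  qed (simp_all add: operator_matrix_def base_change_def)
qed

lemma char_poly_triangular:
  assumes cs: "ordered_basis V cs" and f: "\<And>j. j < length cs \<Longrightarrow> f (cs ! j) - d j *\<^sub>R cs ! j \<in> span (set (take j cs))"
  shows "char_poly (operator_matrix cs f) = (\<Prod>j<length cs. [:- d j, 1:])"
proof -
  note c = ordered_basisD[OF cs]
  let ?A = "operator_matrix cs f"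
  have entry: "?A $$ (i, j) = (if i = j then d j else 0)" if ij: "i < length cs" "j < length cs" "j \<le> i" for i j
  proof -
    let ?w = "f (cs ! j) - d j *\<^sub>R cs ! j"
    have w: "?w \<in> span (set (take j cs))" using f ij by blast
    have sub: "set (take j cs) \<subseteq> set cs" by (rule set_take_subset)
    have wV: "?w \<in> span (set cs)" using w span_mono[OF sub] by blast
    have "cs ! i \<notin> set (take j cs)"
      using ij c(1) by (auto simp: in_set_conv_nth nth_eq_iff_index_eq)
    then have "representation (set cs) ?w (cs ! i) = 0"
      using representation_extend[OF c(2) w sub] representation_ne_zero by metis
    moreover have "representation (set cs) (f (cs ! j)) (cs ! i) =
        d j * representation (set cs) (cs ! j) (cs ! i) + representation (set cs) ?w (cs ! i)"
    proof -
      have cj: "cs ! j \<in> span (set cs)" using ij by (intro span_base) simp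
      have "f (cs ! j) = d j *\<^sub>R cs ! j + ?w" by simp
      then have "representation (set cs) (f (cs ! j)) = representation (set cs) (d j *\<^sub>R cs ! j + ?w)" by (rule arg_cong)
      then show ?thesis
        unfolding representation_add[OF c(2) wV span_scale[OF cj]] representation_scale[OF c(2) cj] by simp
    qed
    ultimately show ?thesis
      using ij by (simp add: operator_matrix_def representation_basis[OF c(2)] nth_eq_iff_index_eq[OF c(1)])
  qed
  have carr: "?A \<in> carrier_mat (length cs) (length cs)" by (simp add: operator_matrix_def)
  have "upper_triangular ?A" using entry carr by (auto simp: upper_triangular_def)
  then have "char_poly ?A = (\<Prod>a\<leftarrow>diag_mat ?A. [:- a, 1:])" by (rule char_poly_upper_triangular[OF carr])
  also have "diag_mat ?A = map d [0..<length cs]"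
    using carr entry by (auto simp: diag_mat_def)
  finally show ?thesis by (simp add: prod.list_conv_set_nth atLeast0LessThan o_def)
qed

context graded_connected_hopf_algebra_fd
begin

lemma op_in_H: "x \<in> H n \<Longrightarrow> C \<in> comps n \<Longrightarrow> op C x \<in> H n"
proof -
  have "op C x \<in> H (sum_list C)" for C x
  proof (induction C arbitrary: x)
    case Nil
    show ?case using subspace_scale[OF subspace_H one_in_H] by simp
  next
    case (Cons d C)
    obtain L where L: "\<Delta> x = (\<Sum>(a, b)\<leftarrow>L. pure_tensor [a, b])" by (rule coproduct_repr)
    show ?case unfolding list.map convs_Cons conv_def
      by (rule cop_in_subspace[OF bilinear_mult[OF linear_pr linear_op] subspace_H L])
        (simp add: mult_in_H[OF pr_in_H Cons.IH])
  qed
  then show "C \<in> comps n \<Longrightarrow> op C x \<in> H n" by (auto simp: comps_def)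
qed

lemma opP_in_H: "x \<in> H n \<Longrightarrow> opP n P x \<in> H n"
  unfolding opP_def by (intro subspace_sum[OF subspace_H] subspace_scale[OF subspace_H] op_in_H)

lemma char_poly_opP:
  assumes bs: "ordered_basis (H n) bs"
  shows "char_poly (operator_matrix bs (opP n P)) = (\<Prod>M\<in>Mons n. [:- beta_P n P (map dg (mlist M)), 1:])"
proof -
  \<comment> \<open>The key is lexicographic: lighter monomials come first, and among equal weights
    the longer ones. The factor \<open>Suc n\<close> separates the weights, because a monomial of
    degree \<open>n\<close> has at most \<open>n\<close> letters.\<close>
  define key where "key M = mwt M * Suc n + (n - size M)" for M :: "'a letter multiset"
  obtain Ms0 where Ms0: "set Ms0 = Mons n" "distinct Ms0" using finite_distinct_list[OF finite_Mons] by blast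
  define Ms where "Ms = sort_key key Ms0"
  have Ms: "set Ms = Mons n" "distinct Ms" "sorted (map key Ms)" by (simp_all add: Ms_def Ms0)
  define cs where "cs = map mon Ms"
  have dcs: "distinct cs" using Ms inj_on_mon by (simp add: cs_def distinct_map)
  have scs: "set cs = mon ` Mons n" by (simp add: cs_def Ms)
  have cs: "ordered_basis (H n) cs"
    using dcs scs independent_mons[of n] H_eq_span_mons[of n] by (simp add: ordered_basis_def module_dependent_eq)
  have tri: "opP n P (cs ! j) - beta_P n P (map dg (mlist (Ms ! j))) *\<^sub>R cs ! j \<in> span (set (take j cs))"
    if j: "j < length cs" for j
  proof -
    have jM: "j < length Ms" using j by (simp add: cs_def)
    then have M: "Ms ! j \<in> Mons n" using Ms(1) nth_mem by blast
    have "mon ` {N \<in> Mons n. mwt N < mwt (Ms ! j) \<or> mwt N = mwt (Ms ! j) \<and> size N > size (Ms ! j)} \<subseteq> set (take j cs)"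
    proof
      fix x assume "x \<in> mon ` {N \<in> Mons n. mwt N < mwt (Ms ! j) \<or> mwt N = mwt (Ms ! j) \<and> size N > size (Ms ! j)}"
      then obtain N where N: "N \<in> Mons n" "x = mon N"
        "mwt N < mwt (Ms ! j) \<or> mwt N = mwt (Ms ! j) \<and> size N > size (Ms ! j)" by blast
      then obtain i where i: "i < length Ms" "Ms ! i = N" using Ms(1) by (metis in_set_conv_nth)
      have sz: "size N \<le> n" using length_le_ldg[OF Mons_valids[OF N(1)]] N(1) by (simp add: Mons_def)
      have "key N < key (Ms ! j)"
        using N(3)
      proof
        assume "mwt N < mwt (Ms ! j)"
        then have "Suc (mwt N) * Suc n \<le> mwt (Ms ! j) * Suc n" by (intro mult_le_mono1) simp
        then show ?thesis by (simp add: key_def)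
      next
        assume *: "mwt N = mwt (Ms ! j) \<and> size N > size (Ms ! j)"
        then have "n - size N < n - size (Ms ! j)" using sz by linarith
        then show ?thesis unfolding key_def conjunct1[OF *] by (rule add_strict_left_mono)
      qed
      moreover have "key (Ms ! j) \<le> key (Ms ! i)" if "j \<le> i"
        using sorted_nth_mono[OF Ms(3) that] i(1) jM by simp
      ultimately have "i < j" using i(2) by (meson leD not_le)
      then show "x \<in> set (take j cs)"
        using i N(2) jM by (auto simp: cs_def take_map in_set_conv_nth intro!: imageI exI[of _ i])
    qed
    from subsetD[OF span_mono[OF this] opP_triangular[OF M]] show ?thesis using jM by (simp add: cs_def)
  qed
  have "char_poly (operator_matrix bs (opP n P)) = char_poly (operator_matrix cs (opP n P))"
    by (rule char_poly_operator_matrix_basis[OF bs cs linear_opP opP_in_H])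
  also have "\<dots> = (\<Prod>j<length Ms. [:- beta_P n P (map dg (mlist (Ms ! j))), 1:])"
    using char_poly_triangular[OF cs tri] by (simp add: cs_def)
  also have "\<dots> = (\<Prod>M\<in>Mons n. [:- beta_P n P (map dg (mlist M)), 1:])"
    using bij_betw_nth[OF Ms(2) refl Ms(1)[symmetric]] by (intro prod.reindex_bij_betw) (simp add: atLeast0LessThan)
  finally show ?thesis .
qed

end

section \<open>Counting multisets\<close>

definition wmultisets :: "('l \<Rightarrow> nat) \<Rightarrow> 'l set \<Rightarrow> nat \<Rightarrow> 'l multiset set" where
  "wmultisets w A n = {M. set_mset M \<subseteq> A \<and> (\<Sum>l\<in>#M. w l) = n}"

lemma size_le_weight: "(\<And>l. l \<in># M \<Longrightarrow> w l > 0) \<Longrightarrow> size M \<le> (\<Sum>l\<in>#M. w l :: nat)"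
proof (induction M)
  case (add x M)
  then have "w x > 0" "size M \<le> (\<Sum>l\<in>#M. w l)" by auto
  then show ?case by simp
qed simp

lemma finite_wmultisets:
  assumes "finite A" "\<And>l. l \<in> A \<Longrightarrow> w l > 0"
  shows "finite (wmultisets w A n)"
proof (rule finite_subset)
  show "wmultisets w A n \<subseteq> mset ` {xs. set xs \<subseteq> A \<and> length xs \<le> n}"
  proof
    fix M assume M: "M \<in> wmultisets w A n"
    obtain xs where xs: "mset xs = M" using ex_mset by blast
    have "size M \<le> n" using M size_le_weight[of M w] assms(2) by (auto simp: wmultisets_def)
    moreover have "set xs = set_mset M" using xs by auto
    moreover have "length xs = size M" using xs by auto
    ultimately show "M \<in> mset ` {xs. set xs \<subseteq> A \<and> length xs \<le> n}"
      using M xs by (intro image_eqI[of _ _ xs]) (auto simp: wmultisets_def)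
  qed
qed (intro finite_imageI finite_lists_length_le assms(1))

text \<open>A multiset that contains \<open>x\<close> loses one copy of it. In terms of generating
  functions this is multiplication by \<open>1 - fps_X ^ w x\<close>.\<close>

lemma card_wmultisets_insert:
  assumes A: "finite A" "x \<notin> A" "\<And>l. l \<in> insert x A \<Longrightarrow> w l > 0"
  shows "card (wmultisets w (insert x A) n) =
    card (wmultisets w A n) + (if w x \<le> n then card (wmultisets w (insert x A) (n - w x)) else 0)"
proof -
  let ?W = "wmultisets w (insert x A)"
  have fin: "finite (?W k)" for k using A by (intro finite_wmultisets) auto
  have "{M \<in> ?W n. x \<notin># M} = wmultisets w A n" using A(2) by (auto simp: wmultisets_def)
  moreover have "{M \<in> ?W n. x \<in># M} = (if w x \<le> n then add_mset x ` ?W (n - w x) else {})"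
  proof (intro equalityI subsetI)
    fix M assume M: "M \<in> {M \<in> ?W n. x \<in># M}"
    then obtain N where N: "M = add_mset x N" by (auto dest: multi_member_split)
    then have "N \<in> ?W (n - w x)" "w x \<le> n" using M by (auto simp: wmultisets_def)
    then show "M \<in> (if w x \<le> n then add_mset x ` ?W (n - w x) else {})" using N by simp
  qed (auto simp: wmultisets_def split: if_splits)
  moreover have "?W n = {M \<in> ?W n. x \<notin># M} \<union> {M \<in> ?W n. x \<in># M}" by blast
  then have "card (?W n) = card {M \<in> ?W n. x \<notin># M} + card {M \<in> ?W n. x \<in># M}"
    using fin by (subst card_Un_disjoint[symmetric]) auto
  ultimately show ?thesis by (simp add: card_image inj_on_def)
qed

lemma fps_wmultisets:
  assumes "finite A" "\<And>l. l \<in> A \<Longrightarrow> w l > 0"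
  shows "Abs_fps (\<lambda>n. real (card (wmultisets w A n))) = (\<Prod>l\<in>A. inverse (1 - fps_X ^ w l))"
  using assms
proof (induction A rule: finite_induct)
  case empty
  have "wmultisets w {} n = (if n = 0 then {{#}} else {})" for n by (auto simp: wmultisets_def)
  then show ?case by (intro fps_ext) simp
next
  case (insert x A)
  let ?G = "\<lambda>A. Abs_fps (\<lambda>n. real (card (wmultisets w A n)))"
  have "?G (insert x A) * (1 - fps_X ^ w x) = ?G A"
  proof (rule fps_ext)
    fix n
    show "fps_nth (?G (insert x A) * (1 - fps_X ^ w x)) n = fps_nth (?G A) n"
      using card_wmultisets_insert[OF insert.hyps insert.prems, where n = n]
      by (simp add: right_diff_distrib fps_X_power_mult_right_nth not_less)
  qed
  then have "?G A * inverse (1 - fps_X ^ w x) = ?G (insert x A) * (1 - fps_X ^ w x) * inverse (1 - fps_X ^ w x)"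
    by (rule arg_cong[OF sym])
  also have "\<dots> = ?G (insert x A) * ((1 - fps_X ^ w x) * inverse (1 - fps_X ^ w x))" by (rule mult.assoc)
  also have "(1 - fps_X ^ w x) * inverse (1 - fps_X ^ w x :: real fps) = 1"
    using insert.prems[of x] by (intro inverse_mult_eq_1') simp
  finally have "?G (insert x A) = ?G A * inverse (1 - fps_X ^ w x)" by simp
  then show ?case using insert by (simp add: mult.commute)
qed

lemma finite_submultisets: "finite {A. A \<subseteq># (M :: 'l multiset)}"
proof (rule finite_subset)
  show "{A. A \<subseteq># M} \<subseteq> (\<Union>n\<le>size M. wmultisets (\<lambda>_. 1) (set_mset M) n)"
    by (auto simp: wmultisets_def dest: mset_subset_eqD size_mset_mono)
qed (simp add: finite_wmultisets)

section \<open>The exponents are the numbers of generators\<close>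

text \<open>For \<open>m > 0\<close> the series is \<open>1 + a x^m\<close> up to terms of degree
  above \<open>m\<close>. Products add the coefficients \<open>a\<close>, which is how an exponent
  can be read off.\<close>

definition starts :: "nat \<Rightarrow> real \<Rightarrow> real fps \<Rightarrow> bool" where
  "starts m a f \<longleftrightarrow> fps_nth f 0 = 1 \<and> (\<forall>j. 0 < j \<longrightarrow> j < m \<longrightarrow> fps_nth f j = 0) \<and> fps_nth f m = a"

lemma starts_mult_nth:
  assumes "starts m a f" "m > 0"
  shows "j < m \<Longrightarrow> fps_nth (f * g) j = fps_nth g j" "fps_nth (f * g) m = fps_nth g m + a * fps_nth g 0"
proof -
  have split: "fps_nth (f * g) j = fps_nth g j + (\<Sum>i\<in>{1..j}. fps_nth f i * fps_nth g (j - i))" for j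
    using assms(1) by (simp add: fps_mult_nth sum.atLeast_Suc_atMost starts_def)
  show "fps_nth (f * g) j = fps_nth g j" if "j < m"
    unfolding split using assms(1) that by (simp add: starts_def sum.neutral)
  have "(\<Sum>i\<in>{1..m}. fps_nth f i * fps_nth g (m - i)) = (\<Sum>i\<in>{m}. fps_nth f i * fps_nth g (m - i))"
    using assms by (intro sum.mono_neutral_right) (auto simp: starts_def)
  then show "fps_nth (f * g) m = fps_nth g m + a * fps_nth g 0"
    unfolding split using assms(1) by (simp add: starts_def)
qed

lemma starts_mult:
  assumes "starts m a f" "starts m c g" "m > 0"
  shows "starts m (a + c) (f * g)"
  using assms starts_mult_nth(1)[OF assms(1,3), where g = g] starts_mult_nth(2)[OF assms(1,3), where g = g]
  by (simp add: starts_def)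

lemma starts_one: "m > 0 \<Longrightarrow> starts m 0 1"
  by (simp add: starts_def)

lemma starts_inverse:
  assumes "starts m a f" "m > 0"
  shows "starts m (- a) (inverse f)"
proof -
  have 1: "f * inverse f = 1" using assms(1) by (intro inverse_mult_eq_1') (simp add: starts_def)
  have "fps_nth (inverse f) j = fps_nth 1 j" if "j < m" for j
    using starts_mult_nth(1)[OF assms that, of "inverse f"] by (simp add: 1)
  moreover have "fps_nth (inverse f) m = - a"
    using starts_mult_nth(2)[OF assms, of "inverse f"] calculation[of 0] assms(2) by (simp add: 1)
  ultimately show ?thesis using assms by (simp add: starts_def)
qed

lemma starts_power: "starts m a f \<Longrightarrow> m > 0 \<Longrightarrow> starts m (real k * a) (f ^ k)"
proof (induction k)
  case (Suc k)
  then show ?case using starts_mult[of m a f "real k * a" "f ^ k"] by (simp add: algebra_simps)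
qed (simp add: starts_one)

lemma starts_euler_factor: "m > 0 \<Longrightarrow> starts m (real_of_int b) ((1 - fps_X ^ m) powi (- b))"
proof -
  assume m: "m > 0"
  have s: "starts m (- 1) (1 - fps_X ^ m)" using m by (auto simp: starts_def)
  show ?thesis
  proof (cases "b > 0")
    case True
    then show ?thesis using starts_power[OF starts_inverse[OF s m] m, of "nat b"] by (simp add: power_int_def)
  next
    case False
    then show ?thesis using starts_power[OF s m, of "nat (- b)"] by (simp add: power_int_def)
  qed
qed

context graded_connected_hopf_algebra_fd
begin

definition ngens :: "nat \<Rightarrow> nat" where
  "ngens d = card {l \<in> gens. dg l = d}"

lemma dg_gens: "l \<in> gens \<Longrightarrow> dg l > 0"
  using gensD(2) by (simp add: valid_def)

lemma finite_gens_dg: "finite {l \<in> gens. dg l = d}"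
  by (rule finite_subset[OF _ finite_gens[of d]]) auto

lemma Mons_eq_wmultisets:
  assumes "d \<le> N"
  shows "Mons d = wmultisets dg {l \<in> gens. dg l \<le> N} d"
proof -
  have le: "dg l \<le> d" if "M \<in> Mons d" "l \<in># M" for M l
  proof -
    have "dg l \<le> (\<Sum>l\<leftarrow>mlist M. dg l)" using that(2) by (intro member_le_sum_list) auto
    then show ?thesis using that(1) by (simp add: Mons_def)
  qed
  show ?thesis
  proof (intro equalityI subsetI)
    fix M assume M: "M \<in> Mons d"
    have "\<forall>l\<in>#M. dg l \<le> N" using le[OF M] assms le_trans by blast
    then show "M \<in> wmultisets dg {l \<in> gens. dg l \<le> N} d" using M by (auto simp: Mons_def wmultisets_def)
  qed (auto simp: Mons_def wmultisets_def)
qed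

lemma hilbert_product:
  "Abs_fps (\<lambda>n. real (card (wmultisets dg {l \<in> gens. dg l \<le> N} n))) =
    (\<Prod>k<N. (1 - fps_X ^ Suc k) powi (- int (ngens (Suc k))))"
proof (induction N)
  case 0
  have e: "{l \<in> gens. dg l \<le> 0} = {}" using dg_gens by auto
  show ?case using fps_wmultisets[of "{}" dg] unfolding e by simp
next
  case (Suc N)
  have "{l \<in> gens. dg l \<le> Suc N} = {l \<in> gens. dg l \<le> N} \<union> {l \<in> gens. dg l = Suc N}" by auto
  then have "(\<Prod>l\<in>{l \<in> gens. dg l \<le> Suc N}. inverse (1 - fps_X ^ dg l :: real fps)) =
      (\<Prod>l\<in>{l \<in> gens. dg l \<le> N}. inverse (1 - fps_X ^ dg l)) * (\<Prod>l\<in>{l \<in> gens. dg l = Suc N}. inverse (1 - fps_X ^ dg l))"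
    by (simp add: prod.union_disjoint finite_gens finite_gens_dg disjoint_iff)
  also have "(\<Prod>l\<in>{l \<in> gens. dg l = Suc N}. inverse (1 - fps_X ^ dg l :: real fps)) = inverse (1 - fps_X ^ Suc N) ^ ngens (Suc N)"
    unfolding ngens_def by simp
  finally show ?case
    using Suc.IH fps_wmultisets[OF finite_gens[of N], of dg] fps_wmultisets[OF finite_gens[of "Suc N"], of dg] dg_gens
    by (simp add: power_int_def)
qed

text \<open>Euler products have unique exponents: if the first \<open>k\<close> factors agree, the
  coefficient at \<open>k + 1\<close> depends only on the exponent of the next factor, as later
  factors start beyond it. The comparison is with the product that counts multisets of
  generators.\<close>

lemma exponents_eq_ngens:
  assumes b: "(\<lambda>k. (1 - fps_X ^ Suc k) powi (- b (Suc k))) has_prod (Abs_fps (\<lambda>i. real (dim (H i))) :: real fps)"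
  shows "b (Suc k) = int (ngens (Suc k))"
proof -
  let ?h = "Abs_fps (\<lambda>i. real (card (Mons i)))"
  let ?f = "\<lambda>k. (1 - fps_X ^ Suc k :: real fps) powi (- b (Suc k))"
  let ?g = "\<lambda>k. (1 - fps_X ^ Suc k :: real fps) powi (- int (ngens (Suc k)))"
  have "M = {#}" if "M \<in> Mons 0" for M
  proof -
    have "\<forall>l\<in>#M. dg l > 0" using that dg_gens by (fastforce simp: Mons_def)
    then show ?thesis using size_le_weight[of M dg] that by (simp add: Mons_def)
  qed
  moreover have "{#} \<in> Mons 0" by (simp add: Mons_def)
  ultimately have "Mons 0 = {{#}}" by blast
  then have "fps_nth ?h 0 = 1" by simp
  \<comment> \<open>\<open>has_prod\<close> treats the limit 0 separately; a nonzero limit means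
    that the partial products themselves converge.\<close>
  then have h0: "?h \<noteq> 0" by force
  have "?f has_prod ?h" using b by (simp add: dim_H)
  then have lim: "(\<lambda>n. \<Prod>k\<le>n. ?f k) \<longlonglongrightarrow> ?h" using h0 by (auto simp: has_prod_def raw_has_prod_def)
  have step: "fps_nth (\<Prod>k<Suc N. ?f k) d = fps_nth (\<Prod>k<N. ?f k) d" if "d \<le> N" for N d
    using starts_mult_nth(1)[OF starts_euler_factor[of "Suc N" "b (Suc N)"], of d "\<Prod>k<N. ?f k"] that
    by (simp add: mult.commute)
  have const: "fps_nth (\<Prod>k<N + e. ?f k) d = fps_nth (\<Prod>k<N. ?f k) d" if "d \<le> N" for N d e
  proof (induction e)
    case (Suc e)
    then show ?case using step[of d "N + e"] that by simp
  qed simp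
  have h: "fps_nth ?h d = fps_nth (\<Prod>k<N. ?f k) d" if "d \<le> N" for N d
  proof -
    \<comment> \<open>Convergence of formal power series is eventual constancy of every
      coefficient.\<close>
    have "eventually (\<lambda>n. fps_nth (\<Prod>k\<le>n. ?f k) d = fps_nth ?h d) sequentially"
      using lim unfolding tendsto_fps_iff by blast
    then obtain n0 where "\<And>n. n \<ge> n0 \<Longrightarrow> fps_nth (\<Prod>k\<le>n. ?f k) d = fps_nth ?h d"
      unfolding eventually_sequentially by blast
    from this[of "N + n0"] have "fps_nth (\<Prod>k<N + Suc n0. ?f k) d = fps_nth ?h d"
      by (simp add: lessThan_Suc_atMost del: prod.lessThan_Suc prod.atMost_Suc)
    then show ?thesis using const[OF that, of "Suc n0"] by simp
  qed
  have h': "fps_nth ?h d = fps_nth (\<Prod>k<N. ?g k) d" if "d \<le> N" for N d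
    using arg_cong[OF hilbert_product[of N], of "\<lambda>f. fps_nth f d"] Mons_eq_wmultisets[OF that] by simp
  show ?thesis
  proof (induction k rule: less_induct)
    case (less k)
    have eq: "(\<Prod>i<k. ?f i) = (\<Prod>i<k. ?g i)" by (rule prod.cong) (use less in auto)
    have zero: "fps_nth (\<Prod>i<k. ?g i) 0 = 1"
    proof -
      have "fps_nth (?g i) 0 = 1" for i using starts_euler_factor[of "Suc i" "int (ngens (Suc i))"] by (simp add: starts_def)
      then show ?thesis by (induction k) simp_all
    qed
    have "fps_nth (\<Prod>i<Suc k. ?f i) (Suc k) = fps_nth (\<Prod>i<Suc k. ?g i) (Suc k)"
      using h[of "Suc k" "Suc k"] h'[of "Suc k" "Suc k"] by simp
    then have e: "fps_nth (?f k * (\<Prod>i<k. ?g i)) (Suc k) = fps_nth (?g k * (\<Prod>i<k. ?g i)) (Suc k)"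
      unfolding prod.lessThan_Suc eq by (simp only: mult.commute)
    have "fps_nth (?f k * (\<Prod>i<k. ?g i)) (Suc k) = fps_nth (\<Prod>i<k. ?g i) (Suc k) + real_of_int (b (Suc k))"
      using starts_mult_nth(2)[OF starts_euler_factor[OF zero_less_Suc] zero_less_Suc, where g = "\<Prod>i<k. ?g i"]
      unfolding zero mult_1_right .
    moreover have "fps_nth (?g k * (\<Prod>i<k. ?g i)) (Suc k) = fps_nth (\<Prod>i<k. ?g i) (Suc k) + real_of_int (int (ngens (Suc k)))"
      using starts_mult_nth(2)[OF starts_euler_factor[OF zero_less_Suc] zero_less_Suc, where g = "\<Prod>i<k. ?g i"]
      unfolding zero mult_1_right .
    ultimately have "real_of_int (b (Suc k)) = real_of_int (int (ngens (Suc k)))" using e by linarith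
    then show ?case by (simp only: of_int_eq_iff)
  qed
qed

section \<open>Counting monomials by type\<close>

definition typed_monomials :: "nat \<Rightarrow> nat multiset \<Rightarrow> 'a letter multiset set" where
  "typed_monomials N mu = {M. set_mset M \<subseteq> {l \<in> gens. dg l \<le> N} \<and> image_mset dg M = mu}"

lemma filter_dg_image: "filter_mset P (image_mset dg M) = image_mset dg (filter_mset (\<lambda>l. P (dg l)) M)"
  by (induction M) auto

text \<open>A monomial separates into its generators of degree at most \<open>N\<close> and those of
  degree \<open>Suc N\<close>; of the latter, \<open>mu\<close> prescribes only the number.\<close>

lemma card_typed_monomials_Suc:
  "card (typed_monomials (Suc N) mu) =
    card (typed_monomials N (filter_mset (\<lambda>d. d \<noteq> Suc N) mu)) *
    card (wmultisets (\<lambda>_. 1) {l \<in> gens. dg l = Suc N} (count mu (Suc N)))"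
proof -
  let ?P = "\<lambda>l. dg l \<noteq> Suc N"
  let ?A = "typed_monomials N (filter_mset (\<lambda>d. d \<noteq> Suc N) mu)"
  let ?B = "wmultisets (\<lambda>_. 1) {l \<in> gens. dg l = Suc N} (count mu (Suc N))"
  have eq_repl: "filter_mset (\<lambda>d. \<not> d \<noteq> Suc N) mu = replicate_mset (count mu (Suc N)) (Suc N)"
    using filter_eq_replicate_mset[where D = mu and x = "Suc N"] by simp
  have "bij_betw (\<lambda>M. (filter_mset ?P M, filter_mset (\<lambda>l. \<not> ?P l) M)) (typed_monomials (Suc N) mu) (?A \<times> ?B)"
  proof (rule bij_betw_byWitness[where f' = "\<lambda>(M, M'). M + M'"])
    show "\<forall>M\<in>typed_monomials (Suc N) mu. (\<lambda>(M, M'). M + M') (filter_mset ?P M, filter_mset (\<lambda>l. \<not> ?P l) M) = M"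
      by (simp add: multiset_partition[symmetric] del: not_not)
    show "\<forall>p\<in>?A \<times> ?B. (filter_mset ?P ((\<lambda>(M, M'). M + M') p), filter_mset (\<lambda>l. \<not> ?P l) ((\<lambda>(M, M'). M + M') p)) = p"
    proof
      fix p assume "p \<in> ?A \<times> ?B"
      then obtain M M' where p: "p = (M, M')" "M \<in> ?A" "M' \<in> ?B" by blast
      have "\<forall>l\<in>#M. ?P l" "\<forall>l\<in>#M'. \<not> ?P l"
        using p(2,3) by (force simp: typed_monomials_def wmultisets_def)+
      then have "filter_mset ?P M = M" "filter_mset ?P M' = {#}"
        "filter_mset (\<lambda>l. \<not> ?P l) M = {#}" "filter_mset (\<lambda>l. \<not> ?P l) M' = M'"
        by (auto simp: filter_mset_eq_conv filter_mset_eq_mempty_iff)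
      then show "(filter_mset ?P ((\<lambda>(M, M'). M + M') p), filter_mset (\<lambda>l. \<not> ?P l) ((\<lambda>(M, M'). M + M') p)) = p"
        by (simp add: p(1))
    qed
    show "(\<lambda>M. (filter_mset ?P M, filter_mset (\<lambda>l. \<not> ?P l) M)) ` typed_monomials (Suc N) mu \<subseteq> ?A \<times> ?B"
    proof (rule image_subsetI)
      fix M assume M: "M \<in> typed_monomials (Suc N) mu"
      have "image_mset dg (filter_mset (\<lambda>l. \<not> ?P l) M) = replicate_mset (count mu (Suc N)) (Suc N)"
        using M eq_repl filter_dg_image[of "\<lambda>d. \<not> d \<noteq> Suc N" M] by (simp add: typed_monomials_def)
      then have "size (filter_mset (\<lambda>l. \<not> ?P l) M) = count mu (Suc N)" by (metis size_image_mset size_replicate_mset)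
      moreover have "image_mset dg (filter_mset ?P M) = filter_mset (\<lambda>d. d \<noteq> Suc N) mu"
        using M filter_dg_image[of "\<lambda>d. d \<noteq> Suc N" M] by (simp add: typed_monomials_def)
      ultimately show "(filter_mset ?P M, filter_mset (\<lambda>l. \<not> ?P l) M) \<in> ?A \<times> ?B"
        using M by (auto simp: typed_monomials_def wmultisets_def sum_mset_constant)
    qed
    show "(\<lambda>(M, M'). M + M') ` (?A \<times> ?B) \<subseteq> typed_monomials (Suc N) mu"
    proof (rule image_subsetI)
      fix p assume "p \<in> ?A \<times> ?B"
      then obtain M M' where p: "p = (M, M')" "M \<in> ?A" "M' \<in> ?B" by blast
      have "image_mset dg M' = image_mset (\<lambda>_. Suc N) M'"
        using p(3) by (intro image_mset_cong) (auto simp: wmultisets_def)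
      also have "\<dots> = replicate_mset (count mu (Suc N)) (Suc N)"
        using p(3) by (simp add: wmultisets_def image_mset_const_eq sum_mset_constant)
      finally have "image_mset dg (M + M') = mu"
        using p(2) multiset_partition[of mu "\<lambda>d. d \<noteq> Suc N"] unfolding eq_repl by (simp add: typed_monomials_def)
      then show "(\<lambda>(M, M'). M + M') p \<in> typed_monomials (Suc N) mu"
        using p by (auto simp: typed_monomials_def wmultisets_def)
    qed
  qed
  from bij_betw_same_card[OF this] show ?thesis by (simp add: card_cartesian_product)
qed

lemma typed_monomials_empty: "d \<in># mu \<Longrightarrow> d > N \<Longrightarrow> typed_monomials N mu = {}"
  by (fastforce simp: typed_monomials_def)

lemma mfps_partial_prod_eq:
  assumes b: "\<And>k. b (Suc k) = int (ngens (Suc k))"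
  shows "mfps_partial_prod (\<lambda>i. mfps_of_fps i ((1 - fps_X) powi (- b i))) N mu = real (card (typed_monomials N mu))"
proof (induction N arbitrary: mu)
  case 0
  have e: "{l \<in> gens. dg l \<le> 0} = {}" using dg_gens by auto
  have "typed_monomials 0 mu = (if mu = {#} then {{#}} else {})" unfolding typed_monomials_def e by auto
  then show ?case by simp
next
  case (Suc N)
  let ?F = "\<lambda>i. mfps_of_fps i ((1 - fps_X) powi (- b i))"
  let ?A0 = "filter_mset (\<lambda>d. d \<noteq> Suc N) mu"
  have coeff: "fps_nth ((1 - fps_X) powi (- b (Suc N))) c = real (card (wmultisets (\<lambda>_. 1) {l \<in> gens. dg l = Suc N} c))" for c
    using arg_cong[OF fps_wmultisets[OF finite_gens_dg[of "Suc N"], of "\<lambda>_. 1"], of "\<lambda>f. fps_nth f c"]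
    by (simp add: b ngens_def power_int_def)
  have "mfps_partial_prod ?F (Suc N) mu = (\<Sum>A | A \<subseteq># mu. real (card (typed_monomials N A)) * ?F (Suc N) (mu - A))"
    by (simp add: mfps_times_def Suc.IH)
  \<comment> \<open>Only one submultiset contributes: \<open>A\<close> may contain no part above
    \<open>N\<close>, and its complement nothing but copies of \<open>Suc N\<close>.\<close>
  also have "\<dots> = (\<Sum>A\<in>{?A0}. real (card (typed_monomials N A)) * ?F (Suc N) (mu - A))"
  proof (rule sum.mono_neutral_right)
    show "finite {A. A \<subseteq># mu}" by (rule finite_submultisets)
    show "{?A0} \<subseteq> {A. A \<subseteq># mu}" by simp
    show "\<forall>A\<in>{A. A \<subseteq># mu} - {?A0}. real (card (typed_monomials N A)) * ?F (Suc N) (mu - A) = 0"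
    proof
      fix A assume A: "A \<in> {A. A \<subseteq># mu} - {?A0}"
      show "real (card (typed_monomials N A)) * ?F (Suc N) (mu - A) = 0"
      proof (rule ccontr)
        assume nz: "real (card (typed_monomials N A)) * ?F (Suc N) (mu - A) \<noteq> 0"
        then have "typed_monomials N A \<noteq> {}" by auto
        then have 1: "d \<le> N" if "d \<in># A" for d using typed_monomials_empty[OF that] by force
        have 2: "set_mset (mu - A) \<subseteq> {Suc N}" using nz by (auto simp: mfps_of_fps_def split: if_splits)
        have "mu = A + (mu - A)" using A by simp
        then have "?A0 = filter_mset (\<lambda>d. d \<noteq> Suc N) A + filter_mset (\<lambda>d. d \<noteq> Suc N) (mu - A)"
          by (metis filter_union_mset)
        also have "filter_mset (\<lambda>d. d \<noteq> Suc N) (mu - A) = {#}" using 2 by (subst filter_mset_eq_mempty_iff) auto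
        also have "filter_mset (\<lambda>d. d \<noteq> Suc N) A = A" using 1 by (force simp: filter_mset_eq_conv)
        finally show False using A by simp
      qed
    qed
  qed
  also have "\<dots> = real (card (typed_monomials N ?A0)) * ?F (Suc N) (mu - ?A0)" by simp
  also have "mu - ?A0 = replicate_mset (count mu (Suc N)) (Suc N)"
    by (rule multiset_eqI) auto
  also have "?F (Suc N) \<dots> = real (card (wmultisets (\<lambda>_. 1) {l \<in> gens. dg l = Suc N} (count mu (Suc N))))"
    by (simp add: mfps_of_fps_def coeff)
  finally show ?case by (simp add: card_typed_monomials_Suc)
qed

lemma multiplicity_series_eq:
  assumes b: "\<And>k. b (Suc k) = int (ngens (Suc k))"
  shows "multiplicity_series b mu = real (card {M. set_mset M \<subseteq> gens \<and> image_mset dg M = mu})"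
proof -
  \<comment> \<open>From the largest part of \<open>mu\<close> on, the partial products have a
    constant coefficient at \<open>mu\<close>; the 0 covers the empty multiset.\<close>
  define N where "N = Max (insert 0 (set_mset mu))"
  have eq: "typed_monomials n mu = {M. set_mset M \<subseteq> gens \<and> image_mset dg M = mu}" if "n \<ge> N" for n
  proof -
    have "dg l \<le> n" if "M \<in> {M. set_mset M \<subseteq> gens \<and> image_mset dg M = mu}" "l \<in># M" for M l
    proof -
      have "dg l \<in># mu" using that by auto
      then have "dg l \<le> N" unfolding N_def by (intro Max_ge) auto
      then show ?thesis using \<open>n \<ge> N\<close> by simp
    qed
    then show ?thesis unfolding typed_monomials_def by blast
  qed
  have "(\<lambda>n. real (card (typed_monomials n mu))) \<longlonglongrightarrow> real (card {M. set_mset M \<subseteq> gens \<and> image_mset dg M = mu})"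
    by (rule tendsto_eventually) (use eq in \<open>auto simp: eventually_sequentially intro!: exI[of _ N]\<close>)
  then show ?thesis
    unfolding multiplicity_series_def mfps_prod_def mfps_partial_prod_eq[OF b] by (rule limI)
qed

definition mtype :: "'a letter multiset \<Rightarrow> nat list" where
  "mtype M = rev (sort (map dg (mlist M)))"

lemma mset_mtype: "mset (mtype M) = image_mset dg M"
  by (simp add: mtype_def)

lemma mtype_partitions: "M \<in> Mons n \<Longrightarrow> mtype M \<in> partitions n"
proof -
  assume M: "M \<in> Mons n"
  have "sum_list (mtype M) = n" using M unfolding sum_mset_sum_list[symmetric] mset_mtype by (simp add: Mons_def)
  moreover have "set (mtype M) = dg ` set_mset M" unfolding set_mset_mset[symmetric] mset_mtype by simp
  then have "0 \<notin> set (mtype M)" using M dg_gens by (fastforce simp: Mons_def)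
  moreover have "sorted_wrt (\<ge>) (mtype M)" by (simp add: mtype_def sorted_wrt_rev)
  ultimately show ?thesis by (simp add: partitions_def)
qed

lemma mtype_eq_iff:
  assumes "lam \<in> partitions n"
  shows "mtype M = lam \<longleftrightarrow> image_mset dg M = mset lam"
proof
  assume "image_mset dg M = mset lam"
  then have "mset (rev (mtype M)) = mset (rev lam)" by (simp add: mset_mtype)
  moreover have "sorted (rev (mtype M))" by (simp add: mtype_def)
  moreover have "sorted (rev lam)" using assms by (simp add: partitions_def sorted_wrt_rev)
  ultimately have "rev (mtype M) = rev lam" by (metis properties_for_sort)
  then show "mtype M = lam" by simp
qed (auto simp: mset_mtype[symmetric])

lemma partitions_subset_comps: "partitions n \<subseteq> comps n"
  by (auto simp: partitions_def comps_def)

lemma char_poly_partitions: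
  assumes bs: "ordered_basis (H n) bs"
  shows "char_poly (operator_matrix bs (opP n P)) =
    (\<Prod>lam\<in>partitions n. [:- beta_P n P lam, 1:] ^ card {M. set_mset M \<subseteq> gens \<and> image_mset dg M = mset lam})"
proof -
  have fin: "finite (partitions n)" by (rule finite_subset[OF partitions_subset_comps finite_comps])
  \<comment> \<open>The eigenvalue depends only on the multiset of degrees, so the order chosen by
    \<open>mlist\<close> does not affect it.\<close>
  have beta: "beta_P n P (map dg (mlist M)) = beta_P n P (mtype M)" for M
    unfolding beta_P_def by (intro infsum_cong) (simp add: beta_mset_eq[of "mtype M" "map dg (mlist M)"] mset_mtype)
  have "(\<Prod>M\<in>Mons n. [:- beta_P n P (map dg (mlist M)), 1:]) =
    (\<Prod>lam\<in>partitions n. \<Prod>M\<in>{M \<in> Mons n. mtype M = lam}. [:- beta_P n P (mtype M), 1:])"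
    unfolding beta by (rule prod.group[OF finite_Mons fin, symmetric]) (use mtype_partitions in auto)
  also have "\<dots> = (\<Prod>lam\<in>partitions n. [:- beta_P n P lam, 1:] ^ card {M. set_mset M \<subseteq> gens \<and> image_mset dg M = mset lam})"
  proof (rule prod.cong[OF refl])
    fix lam assume lam: "lam \<in> partitions n"
    have "{M \<in> Mons n. mtype M = lam} = {M. set_mset M \<subseteq> gens \<and> image_mset dg M = mset lam}"
      using lam by (auto simp: mtype_eq_iff[OF lam] Mons_def partitions_def sum_mset_sum_list)
    moreover have "(\<Prod>M\<in>{M \<in> Mons n. mtype M = lam}. [:- beta_P n P (mtype M), 1:]) =
      (\<Prod>M\<in>{M \<in> Mons n. mtype M = lam}. [:- beta_P n P lam, 1:])"
      by (rule prod.cong) auto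
    ultimately show "(\<Prod>M\<in>{M \<in> Mons n. mtype M = lam}. [:- beta_P n P (mtype M), 1:]) =
      [:- beta_P n P lam, 1:] ^ card {M. set_mset M \<subseteq> gens \<and> image_mset dg M = mset lam}"
      by simp
  qed
  finally show ?thesis using char_poly_opP[OF bs] by simp
qed

end

theorem theorem3p5:
  fixes H :: "nat \<Rightarrow> 'a::real_algebra_1 set"
    and \<Delta> :: "'a \<Rightarrow> 'a tensor"
    and \<epsilon> :: "'a \<Rightarrow> real"
    and S :: "'a \<Rightarrow> 'a"
    and n :: nat
    and P :: "nat list pmf"
    and b :: "nat \<Rightarrow> int"
  assumes hopf: "graded_connected_hopf_algebra H \<Delta> \<epsilon> S"
    and findim: "\<And>i. finite_dimensional (H i)"
    and P: "set_pmf P \<subseteq> weak_compositions n"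
    and b: "(\<lambda>k. (1 - fps_X ^ Suc k) powi (- b (Suc k))) has_prod
              (Abs_fps (\<lambda>i. real (real_vector.dim (H i))) :: real fps)"
  shows "(\<exists>m :: nat list \<Rightarrow> nat.
            (\<forall>lam\<in>partitions n. real (m lam) = multiplicity_series b (mset lam)) \<and>
            (\<forall>bs. ordered_basis (H n) bs \<longrightarrow>
               char_poly (operator_matrix bs (mDelta_P H \<Delta> \<epsilon> n P)) =
                 (\<Prod>lam\<in>partitions n. [:- beta_P n P lam, 1:] ^ m lam))) \<and>
         ((\<forall>x y :: 'a. x * y = y * x) \<or> cocommutative \<Delta> \<longrightarrow>
            diagonalisable_on (H n) (mDelta_P H \<Delta> \<epsilon> n P))"
proof -
  interpret graded_connected_hopf_algebra_fd H \<Delta> \<epsilon> S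
    using hopf findim by (simp add: graded_connected_hopf_algebra_fd_def graded_connected_hopf_algebra_fd_axioms_def)
  let ?m = "\<lambda>lam. card {M. set_mset M \<subseteq> gens \<and> image_mset dg M = mset lam}"
  have "\<forall>lam\<in>partitions n. real (?m lam) = multiplicity_series b (mset lam)"
    using multiplicity_series_eq[OF exponents_eq_ngens[OF b]] by simp
  moreover have "\<forall>bs. ordered_basis (H n) bs \<longrightarrow> char_poly (operator_matrix bs (mDelta_P H \<Delta> \<epsilon> n P)) =
      (\<Prod>lam\<in>partitions n. [:- beta_P n P lam, 1:] ^ ?m lam)"
    unfolding mDelta_P_eq using char_poly_partitions by blast
  moreover have "(\<forall>x y :: 'a. x * y = y * x) \<or> cocommutative \<Delta> \<longrightarrow> diagonalisable_on (H n) (mDelta_P H \<Delta> \<epsilon> n P)"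
    unfolding mDelta_P_eq using diagonalisable_commutative diagonalisable_cocommutative by blast
  ultimately show ?thesis by - (intro conjI exI[of _ ?m], assumption+)
qed

end
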